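(* Assume (A1). Let $K_2:=2^d$ and $K_1:=c\,2^{d+1}(1+\kappa_{\mathcal T}^2L^{2d+2})$ with $c=c(d,c_0)$ chosen such that $\sum_{z\in\mathcal N}|||\lambda_zu|||^2\le K_1|||u|||^2$ for all $u\in\mathcal V$, and let $\vartheta:=1/(K_2+K_1^{-1})$. Then $$|||\mathrm{id}-\vartheta\mathcal P|||:=\sup_{v\in\mathcal V\setminus\{0\}}\frac{|||v-\vartheta\mathcal Pv|||}{|||v|||}\ \le\ \gamma_{\mathcal P}:=\frac{K_2}{K_1^{-1}+K_2}<1 .$$
   Context: Let $d\ge1$ and $\varepsilon>0$ with $\varepsilon^{-1}\in\mathbb N$; let $D=(0,1)^d$, identified with the torus $\mathbb R^d/\mathbb Z^d$ (everything periodic). $\mathcal T$ is the partition of $D$ into the closed cubes of side $\varepsilon$ with vertices in $\varepsilon\mathbb Z^d$. Fix $0\le\alpha\le\beta$ and $V\in L^\infty(D)$ constant on each element of $\mathcal T$ with value $\alpha$ or $\beta$; $\mathcal T_\alpha,\mathcal T_\beta$ are the elements where $V=\alpha$, resp. $\beta$, $\Omega_\alpha$ the interior of the union of $\mathcal T_\alpha$. $\mathcal V=H^1_{\rm per}(D)$, $a(u,v)=\int_D(\nabla u\cdot\nabla v+Vuv)\,dx$, $|||v|||^2=a(v,v)$. A periodic cube is a union of elements of $\mathcal T$ which, viewed periodically in $\mathbb R^d$, is a closed cube. $L$ is the largest $k$ such that a periodic cube of side $\varepsilon k$ lies in $\overline{\Omega_\alpha}$ ($L:=1$ if $\mathcal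 T_\alpha=\emptyset$). A maximal $\alpha$-cube is a periodic cube contained in $\overline{\Omega_\alpha}$ not strictly contained in another such cube; $\kappa_{\mathcal T}$ is the maximum over $q\in\mathcal T_\alpha$ of the number of maximal $\alpha$-cubes containing $q$. Assumption (A1): $\mathcal T_\beta\neq\emptyset$ and $\beta\ge c_0\,\varepsilon^{-2}$ for a fixed $c_0>0$. $\mathcal N$ is the set of vertices of $\mathcal T$; $\lambda_z$ ($z\in\mathcal N$) is the periodic continuous function, multilinear on each element, with $\lambda_z(z)=1$ and $\lambda_z(w)=0$ at other vertices; $D_z=\operatorname{supp}\lambda_z$, $\mathcal V_z=H^1_0(D_z)$ (extended by zero). $P_z\colon\mathcal V\to\mathcal V_z$ is the $a$-orthogonal projection ($a(P_zu,v)=a(u,v)$ for $v\in\mathcal V_z$), and $\mathcal P:=\sum_zP_z$. *)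

theory Defs
  imports "HOL-Analysis.Analysis"
begin

text \<open>Setting: d = CARD('d), the torus R^d/Z^d represented by the unit cube D = (0,1)^d,
  mesh width eps = 1/n with n a positive natural number.\<close>

definition unitD :: "(real^'d::finite) set" where
  "unitD = {x. \<forall>i. 0 < x$i \<and> x$i < 1}"

definition Idx :: "nat \<Rightarrow> ('d::finite \<Rightarrow> nat) set" where
  "Idx n = {k. \<forall>i. k i < n}"

definition elem :: "nat \<Rightarrow> ('d::finite \<Rightarrow> nat) \<Rightarrow> (real^'d) set" where
  "elem n k = {x. \<forall>i. real (k i) / real n \<le> x$i \<and> x$i \<le> real (k i + 1) / real n}"

text \<open>Periodic 1D hat function of width 1/n centred at 0 (periodized), and the
  periodic multilinear hat function lambda_z of the vertex z = k/n.\<close>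
definition hat :: "nat \<Rightarrow> real \<Rightarrow> real" where
  "hat n t = max 0 (1 - \<bar>t - of_int \<lfloor>t\<rfloor>\<bar> * real n)
           + max 0 (1 - \<bar>t - of_int \<lfloor>t\<rfloor> - 1\<bar> * real n)"

definition lam :: "nat \<Rightarrow> ('d::finite \<Rightarrow> nat) \<Rightarrow> real^'d \<Rightarrow> real" where
  "lam n k x = (\<Prod>i\<in>UNIV. hat n (x$i - real (k i) / real n))"

definition pd :: "'d::finite \<Rightarrow> (real^'d \<Rightarrow> real) \<Rightarrow> real^'d \<Rightarrow> real" where
  "pd i f x = frechet_derivative f (at x) (axis i 1)"

fun iter_pd :: "'d::finite list \<Rightarrow> (real^'d \<Rightarrow> real) \<Rightarrow> real^'d \<Rightarrow> real" where
  "iter_pd [] f = f"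
| "iter_pd (i # is) f = pd i (iter_pd is f)"

definition smooth_fun :: "(real^'d::finite \<Rightarrow> real) \<Rightarrow> bool" where
  "smooth_fun f \<longleftrightarrow> (\<forall>is x. iter_pd is f differentiable (at x))"

definition periodic_fun :: "(real^'d::finite \<Rightarrow> real) \<Rightarrow> bool" where
  "periodic_fun f \<longleftrightarrow> (\<forall>x i. f (x + axis i 1) = f x)"

definition test_fun :: "(real^'d::finite \<Rightarrow> real) \<Rightarrow> bool" where
  "test_fun f \<longleftrightarrow> smooth_fun f \<and> periodic_fun f"

definition L2D :: "(real^'d::finite \<Rightarrow> real) \<Rightarrow> bool" where
  "L2D u \<longleftrightarrow> set_borel_measurable lborel unitD u \<and>
             set_integrable lborel unitD (\<lambda>x. (u x)^2)"

definition has_weak_grad :: "(real^'d::finite \<Rightarrow> real) \<Rightarrow> (real^'d \<Rightarrow> real^'d) \<Rightarrow> bool" where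
  "has_weak_grad u g \<longleftrightarrow> (\<forall>i. L2D (\<lambda>x. g x $ i)) \<and>
     (\<forall>\<phi>. test_fun \<phi> \<longrightarrow> (\<forall>i.
        set_lebesgue_integral lborel unitD (\<lambda>x. u x * pd i \<phi> x)
        = - set_lebesgue_integral lborel unitD (\<lambda>x. g x $ i * \<phi> x)))"

definition H1per :: "(real^'d::finite \<Rightarrow> real) \<Rightarrow> bool" where
  "H1per u \<longleftrightarrow> L2D u \<and> (\<exists>g. has_weak_grad u g)"

definition wgrad :: "(real^'d::finite \<Rightarrow> real) \<Rightarrow> real^'d \<Rightarrow> real^'d" where
  "wgrad u = (SOME g. has_weak_grad u g)"

definition aform :: "(real^'d::finite \<Rightarrow> real) \<Rightarrow> (real^'d \<Rightarrow> real) \<Rightarrow> (real^'d \<Rightarrow> real) \<Rightarrow> real" where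
  "aform V u v = set_lebesgue_integral lborel unitD
      (\<lambda>x. wgrad u x \<bullet> wgrad v x + V x * u x * v x)"

definition enorm :: "(real^'d::finite \<Rightarrow> real) \<Rightarrow> (real^'d \<Rightarrow> real) \<Rightarrow> real" where
  "enorm V u = sqrt (aform V u u)"

definition h1sq :: "(real^'d::finite \<Rightarrow> real) \<Rightarrow> real" where
  "h1sq u = set_lebesgue_integral lborel unitD (\<lambda>x. (u x)^2 + wgrad u x \<bullet> wgrad u x)"

text \<open>Patches D_z = supp lambda_z (periodic subset of R^d), local spaces V_z = H^1_0(D_z)
  (closure in H^1 of smooth periodic functions with support inside the interior of D_z),
  a-orthogonal projections P_z and the additive Schwarz operator P.\<close>
definition Dz :: "nat \<Rightarrow> ('d::finite \<Rightarrow> nat) \<Rightarrow> (real^'d) set" where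
  "Dz n k = closure {x. lam n k x \<noteq> 0}"

definition Vz :: "nat \<Rightarrow> ('d::finite \<Rightarrow> nat) \<Rightarrow> (real^'d \<Rightarrow> real) set" where
  "Vz n k = {u. H1per u \<and> (\<exists>\<phi>. (\<forall>m. test_fun (\<phi> m) \<and>
                 closure {x. \<phi> m x \<noteq> 0} \<subseteq> interior (Dz n k)) \<and>
              (\<lambda>m. h1sq (\<lambda>x. \<phi> m x - u x)) \<longlonglongrightarrow> 0)}"

definition Pz :: "(real^'d::finite \<Rightarrow> real) \<Rightarrow> nat \<Rightarrow> ('d \<Rightarrow> nat) \<Rightarrow> (real^'d \<Rightarrow> real) \<Rightarrow> (real^'d \<Rightarrow> real)" where
  "Pz V n k u = (SOME w. w \<in> Vz n k \<and> (\<forall>v\<in>Vz n k. aform V w v = aform V u v))"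

definition Pop :: "(real^'d::finite \<Rightarrow> real) \<Rightarrow> nat \<Rightarrow> (real^'d \<Rightarrow> real) \<Rightarrow> (real^'d \<Rightarrow> real)" where
  "Pop V n u = (\<lambda>x. \<Sum>k\<in>(Idx n :: ('d \<Rightarrow> nat) set). Pz V n k u x)"

text \<open>Periodic cubes of elements (side m elements, lower corner a, indices mod n),
  maximal alpha-cubes, L and kappa.  Ta is the set of element indices of T_alpha.\<close>
definition pcube :: "nat \<Rightarrow> ('d::finite \<Rightarrow> nat) \<Rightarrow> nat \<Rightarrow> ('d \<Rightarrow> nat) set" where
  "pcube n a m = {k. \<exists>j. (\<forall>i. j i < m) \<and> (\<forall>i. k i = (a i + j i) mod n)}"

definition is_pcube :: "nat \<Rightarrow> ('d::finite \<Rightarrow> nat) set \<Rightarrow> bool" where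
  "is_pcube n C \<longleftrightarrow> (\<exists>a\<in>Idx n. \<exists>m. 1 \<le> m \<and> m \<le> n \<and> C = pcube n a m)"

definition Lsize :: "nat \<Rightarrow> ('d::finite \<Rightarrow> nat) set \<Rightarrow> nat" where
  "Lsize n Ta = (if Ta = {} then 1 else
     Max {m. \<exists>a\<in>Idx n. 1 \<le> m \<and> m \<le> n \<and> pcube n a m \<subseteq> Ta})"

definition max_acubes :: "nat \<Rightarrow> ('d::finite \<Rightarrow> nat) set \<Rightarrow> ('d \<Rightarrow> nat) set set" where
  "max_acubes n Ta = {C. is_pcube n C \<and> C \<subseteq> Ta \<and>
      \<not> (\<exists>C'. is_pcube n C' \<and> C' \<subseteq> Ta \<and> C \<subset> C')}"

definition kappa :: "nat \<Rightarrow> ('d::finite \<Rightarrow> nat) set \<Rightarrow> nat" where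
  "kappa n Ta = (if Ta = {} then 0 else
     Max ((\<lambda>q. card {C \<in> max_acubes n Ta. q \<in> C}) ` Ta))"

definition K1 :: "real \<Rightarrow> nat \<Rightarrow> ('d::finite \<Rightarrow> nat) set \<Rightarrow> real" where
  "K1 c n Ta = c * 2 ^ (CARD('d) + 1) *
     (1 + real (kappa n Ta) ^ 2 * real (Lsize n Ta) ^ (2 * CARD('d) + 2))"

definition K2 :: "'d::finite itself \<Rightarrow> real" where
  "K2 _ = 2 ^ CARD('d)"

end

theory Submission
  imports Defs
begin

text \<open>
  The operator id - theta P is symmetric for a, so its norm is the supremum of its quadratic form,
  and it suffices to bound a(Pu, u) from both sides. The upper bound is Cauchy-Schwarz together with
  the fact that almost every point lies in at most 2^d patches. For the lower bound one writes u as
  the sum of the functions lambda_z u, which lie in V_z, and uses the assumed stability.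

  The projections exist because V_z is complete for the energy norm: a Poincare inequality, with one
  element where V = beta > 0, makes a coercive. Density of the test functions and uniqueness of weak
  gradients both come from the waves cos(2 pi k.x + s): they are eigenfunctions of the
  Laplacian, and by Stone-Weierstrass only a null function is orthogonal to all of them. Finally lambda_z u
  is in V_z because lambda_z is a limit of smooth functions with compact support inside D_z and
  bounded, almost everywhere convergent gradients.
\<close>

subsection \<open>Square integrable functions\<close>

text \<open>The damping parameter is dictated by the two quadratic bounds. They place the form of
  theta P between theta/K1 and theta K2 times the energy, so that of id - theta P lies between 1 -
  theta K2 and 1 - theta/K1; for theta = 1/(K2 + 1/K1) the first is positive and the second is
  exactly gamma. The strict inequality gamma < 1 requires K1 > 0, and since the sign of
  \<open>c\<close> is left open, this is extracted from the stability bound at the constant function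
  1. Two obstacles shape the analytic part. Functions that agree almost everywhere are not
  identified, and \<open>wgrad\<close> is merely some weak gradient; hence the Hilbert space
  arguments run for semidefinite forms, and identities between gradients hold almost everywhere
  only. Moreover V_z is the closure of functions supported strictly inside D_z, whereas lambda_z is
  only Lipschitz and its support fills D_z; so lambda_z has to be replaced by smooth multipliers
  with smaller supports.\<close>

definition sqint :: "'a measure \<Rightarrow> ('a \<Rightarrow> real) \<Rightarrow> bool" where
  "sqint M f \<longleftrightarrow> f \<in> borel_measurable M \<and> integrable M (\<lambda>x. (f x)\<^sup>2)"

lemma sqint_measurable [measurable_dest]: "sqint M f \<Longrightarrow> f \<in> borel_measurable M"
  by (simp add: sqint_def)

lemma abs_mult_le_sum_squares: "\<bar>a * b\<bar> \<le> a\<^sup>2 + (b::real)\<^sup>2"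
proof -
  have "0 \<le> (\<bar>a\<bar> - \<bar>b\<bar>)\<^sup>2" by simp
  then have "2 * \<bar>a * b\<bar> \<le> a\<^sup>2 + b\<^sup>2" by (simp add: power2_diff abs_mult)
  then show ?thesis by linarith
qed

lemma square_lincomb_le: "(a * x + b * y)\<^sup>2 \<le> 2 * a\<^sup>2 * x\<^sup>2 + 2 * b\<^sup>2 * (y::real)\<^sup>2"
proof -
  have "0 \<le> (a * x - b * y)\<^sup>2" by simp
  then show ?thesis by (simp add: power2_eq_square algebra_simps)
qed

lemma sqint_mult_integrable:
  assumes "sqint M f" "sqint M g"
  shows "integrable M (\<lambda>x. f x * g x)"
proof (rule Bochner_Integration.integrable_bound)
  show "integrable M (\<lambda>x. (f x)\<^sup>2 + (g x)\<^sup>2)" using assms by (simp add: sqint_def)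
  show "(\<lambda>x. f x * g x) \<in> borel_measurable M" using assms unfolding sqint_def by auto
  show "AE x in M. norm (f x * g x) \<le> norm ((f x)\<^sup>2 + (g x)\<^sup>2)"
    using abs_mult_le_sum_squares by (auto simp: abs_mult[symmetric])
qed

lemma sqint_lincomb:
  assumes "sqint M f" "sqint M g"
  shows "sqint M (\<lambda>x. a * f x + b * g x)"
  unfolding sqint_def
proof
  show 1: "(\<lambda>x. a * f x + b * g x) \<in> borel_measurable M" using assms unfolding sqint_def by auto
  show "integrable M (\<lambda>x. (a * f x + b * g x)\<^sup>2)"
  proof (rule Bochner_Integration.integrable_bound)
    show "integrable M (\<lambda>x. 2 * a\<^sup>2 * (f x)\<^sup>2 + 2 * b\<^sup>2 * (g x)\<^sup>2)"
      using assms by (simp add: sqint_def)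
    show "AE x in M. norm ((a * f x + b * g x)\<^sup>2) \<le> norm (2 * a\<^sup>2 * (f x)\<^sup>2 + 2 * b\<^sup>2 * (g x)\<^sup>2)"
      using square_lincomb_le by (auto intro!: AE_I2)
  qed (use 1 in measurable)
qed

lemma sqint_diff: "sqint M f \<Longrightarrow> sqint M g \<Longrightarrow> sqint M (\<lambda>x. f x - g x)"
  using sqint_lincomb[of M f g 1 "-1"] by simp

lemma sqint_add: "sqint M f \<Longrightarrow> sqint M g \<Longrightarrow> sqint M (\<lambda>x. f x + g x)"
  using sqint_lincomb[of M f g 1 1] by simp

lemma sqint_zero: "sqint M (\<lambda>x. 0)"
  by (simp add: sqint_def)

lemma sqint_bounded_mult:
  assumes "sqint M f" "h \<in> borel_measurable M" "AE x in M. \<bar>h x\<bar> \<le> C"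
  shows "sqint M (\<lambda>x. h x * f x)"
  unfolding sqint_def
proof
  show 1: "(\<lambda>x. h x * f x) \<in> borel_measurable M" using assms unfolding sqint_def by auto
  show "integrable M (\<lambda>x. (h x * f x)\<^sup>2)"
  proof (rule Bochner_Integration.integrable_bound)
    show "integrable M (\<lambda>x. C\<^sup>2 * (f x)\<^sup>2)" using assms by (simp add: sqint_def)
    show "AE x in M. norm ((h x * f x)\<^sup>2) \<le> norm (C\<^sup>2 * (f x)\<^sup>2)"
      using assms(3)
    proof eventually_elim
      case (elim x)
      then have "(h x)\<^sup>2 \<le> C\<^sup>2" by (metis abs_ge_zero power2_abs power_mono)
      then show ?case by (simp add: power_mult_distrib mult_right_mono)
    qed
  qed (use 1 in measurable)
qed

lemma sqint_bounded:
  assumes "finite_measure M" "h \<in> borel_measurable M" "AE x in M. \<bar>h x\<bar> \<le> C"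
  shows "sqint M h"
proof -
  interpret finite_measure M by fact
  have "sqint M (\<lambda>x. 1)" by (simp add: sqint_def)
  from sqint_bounded_mult[OF this assms(2,3)] show ?thesis by simp
qed

lemma sqint_integrable:
  assumes "finite_measure M" "sqint M f"
  shows "integrable M f"
proof -
  have "sqint M (\<lambda>x. 1)" by (rule sqint_bounded[OF assms(1), where C = 1]) auto
  from sqint_mult_integrable[OF assms(2) this] show ?thesis by simp
qed

text \<open>The Riesz-Fischer argument for functions rather than classes: a fast subsequence
  converges almost everywhere, and Fatou's lemma compares the whole sequence with that pointwise
  limit.\<close>

lemma L2_complete:
  assumes f: "\<And>m. sqint M (f m)"
    and C: "\<And>e::real. e > 0 \<Longrightarrow> \<exists>N::nat. \<forall>m\<ge>N. \<forall>n\<ge>N. (\<integral>x. (f m x - f n x)\<^sup>2 \<partial>M) < e"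
  shows "\<exists>g. sqint M g \<and> (\<lambda>m. \<integral>x. (f m x - g x)\<^sup>2 \<partial>M) \<longlonglongrightarrow> 0"
proof -
  note [measurable] = sqint_measurable[OF f]
  have int2: "integrable M (\<lambda>x. (f m x - f n x)\<^sup>2)" for m n
    using sqint_diff[OF f f] by (simp add: sqint_def)
  have "\<exists>N. \<forall>m\<ge>N. \<forall>n\<ge>N. (\<integral>x. (f m x - f n x)\<^sup>2 \<partial>M) < (1/4)^k" for k
    by (rule C) simp
  then obtain N where N: "\<And>k m n. m \<ge> N k \<Longrightarrow> n \<ge> N k \<Longrightarrow> (\<integral>x. (f m x - f n x)\<^sup>2 \<partial>M) < (1/4)^k"
    by metis
  \<comment> \<open>The running maximum makes \<open>r k\<close> admissible for every earlier
    threshold, so the Cauchy estimate with index \<open>k\<close> applies to both \<open>h k\<close>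
    and \<open>h (Suc k)\<close>.\<close>
  define r where "r k = (MAX j\<in>{..k}. N j)" for k
  have rN: "r k \<ge> N j" if "j \<le> k" for j k
    unfolding r_def using that by (intro Max_ge) auto
  define h where "h k = f (r k)" for k
  \<comment> \<open>The weight \<open>2^k\<close> is small enough for the integrals, which decay
    like \<open>(1/4)^k\<close>, and large enough to control the first power of the
    increments.\<close>
  define D where "D k x = 2^k * (h (Suc k) x - h k x)\<^sup>2" for k x
  have hm [measurable]: "h k \<in> borel_measurable M" for k by (simp add: h_def)
  have Dint: "(\<integral>\<^sup>+x. ennreal (D k x) \<partial>M) \<le> ennreal ((1/2)^k)" for k
  proof -
    have "(\<integral>\<^sup>+x. ennreal (D k x) \<partial>M) = ennreal (\<integral>x. D k x \<partial>M)"
      unfolding D_def h_def by (intro nn_integral_eq_integral) (auto simp: int2)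
    also have "(\<integral>x. D k x \<partial>M) = 2^k * (\<integral>x. (h (Suc k) x - h k x)\<^sup>2 \<partial>M)"
      by (simp add: D_def)
    also have "\<dots> \<le> 2^k * (1/4)^k"
      unfolding h_def by (intro mult_left_mono less_imp_le[OF N] rN) auto
    also have "\<dots> = (1/2)^k" by (simp add: power_mult_distrib[symmetric])
    finally show ?thesis by (simp add: ennreal_leI)
  qed
  have "(\<integral>\<^sup>+x. (\<Sum>k. ennreal (D k x)) \<partial>M) = (\<Sum>k. \<integral>\<^sup>+x. ennreal (D k x) \<partial>M)"
    by (intro nn_integral_suminf) (simp add: D_def)
  also have "\<dots> \<le> (\<Sum>k. ennreal ((1/2)^k))" by (intro suminf_le Dint) auto
  also have "\<dots> = ennreal (\<Sum>k. (1/2)^k)"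
    by (intro suminf_ennreal2) (auto simp: summable_geometric)
  finally have "(\<integral>\<^sup>+x. (\<Sum>k. ennreal (D k x)) \<partial>M) \<noteq> \<infinity>"
    by (auto simp: top_unique)
  then have "AE x in M. (\<Sum>k. ennreal (D k x)) \<noteq> \<infinity>"
    by (intro nn_integral_PInf_AE) (auto simp: D_def)
  then have conv: "AE x in M. convergent (\<lambda>k. h k x)"
  proof eventually_elim
    case (elim x)
    have sD: "summable (\<lambda>k. D k x)"
      using elim by (intro summable_suminf_not_top) (auto simp: D_def)
    have "summable (\<lambda>k. h (Suc k) x - h k x)"
    proof (rule summable_comparison_test')
      show "summable (\<lambda>k. D k x + (1/2)^k)" using sD by (intro summable_add) auto
      fix k :: nat
      let ?a = "h (Suc k) x - h k x"
      \<comment> \<open>The arithmetic-geometric mean inequality trades the increment for its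
        weighted square plus the summable term \<open>(1/2)^k\<close>.\<close>
      have "0 \<le> (\<bar>?a\<bar> * 2^k - 1)\<^sup>2" by simp
      then have "2 * \<bar>?a\<bar> * 2^k \<le> ?a\<^sup>2 * (2^k * 2^k) + 1"
        by (simp add: power2_eq_square algebra_simps)
      then have "2 * \<bar>?a\<bar> \<le> (?a\<^sup>2 * (2^k * 2^k) + 1) / 2^k"
        by (simp add: pos_le_divide_eq)
      also have "\<dots> = D k x + (1/2)^k"
        by (simp add: D_def power_divide add_divide_distrib)
      finally have "2 * \<bar>?a\<bar> \<le> D k x + (1/2)^k" .
      moreover have "norm ?a \<le> 2 * \<bar>?a\<bar>" by simp
      ultimately show "norm ?a \<le> D k x + (1/2)^k" by (rule order_trans[rotated])
    qed
    then have "convergent (\<lambda>n. \<Sum>k<n. h (Suc k) x - h k x)"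
      by (simp add: summable_iff_convergent)
    moreover have "(\<lambda>n. \<Sum>k<n. h (Suc k) x - h k x) = (\<lambda>n. h n x - h 0 x)"
      by (intro ext sum_lessThan_telescope)
    ultimately have "convergent (\<lambda>n. h n x - h 0 x)" by simp
    then have "convergent (\<lambda>n. (h n x - h 0 x) + h 0 x)"
      by (intro convergent_add convergent_const)
    then show ?case by simp
  qed
  define g where "g x = lim (\<lambda>k. h k x)" for x
  have gm [measurable]: "g \<in> borel_measurable M"
    unfolding g_def by (intro borel_measurable_lim_metric) simp
  have fg: "(\<integral>\<^sup>+x. ennreal ((f m x - g x)\<^sup>2) \<partial>M) \<le> ennreal (4 * e)"
    if m: "\<forall>m\<ge>K. \<forall>n\<ge>K. (\<integral>x. (f m x - f n x)\<^sup>2 \<partial>M) < e" "m \<ge> K" and e: "e > 0" for m K e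
  proof -
    obtain k0 where k0: "(1/4)^k0 < e" using e real_arch_pow_inv[of e "1/4"] by auto
    have le: "(\<integral>x. (f m x - h k x)\<^sup>2 \<partial>M) \<le> 4 * e" if "k \<ge> k0" for k
    proof -
      \<comment> \<open>A common comparison index: beyond \<open>K\<close> it is close to
        \<open>f m\<close>, beyond \<open>r k\<close> it is close to \<open>h k\<close>. The two
        errors, each below \<open>e\<close>, give the factor 4.\<close>
      let ?p = "max K (r k)"
      have a: "(\<integral>x. (f m x - f ?p x)\<^sup>2 \<partial>M) < e" using m by simp
      have "(\<integral>x. (f ?p x - h k x)\<^sup>2 \<partial>M) < (1/4)^k0"
        unfolding h_def using rN[OF that] by (intro N) (simp_all add: le_max_iff_disj)
      then have b: "(\<integral>x. (f ?p x - h k x)\<^sup>2 \<partial>M) < e" using k0 by simp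
      have "(\<integral>x. (f m x - h k x)\<^sup>2 \<partial>M)
          \<le> (\<integral>x. 2 * (f m x - f ?p x)\<^sup>2 + 2 * (f ?p x - h k x)\<^sup>2 \<partial>M)"
      proof (rule integral_mono)
        fix x
        show "(f m x - h k x)\<^sup>2 \<le> 2 * (f m x - f ?p x)\<^sup>2 + 2 * (f ?p x - h k x)\<^sup>2"
          using square_lincomb_le[of 1 "f m x - f ?p x" 1 "f ?p x - h k x"] by simp
      qed (auto simp: h_def int2)
      also have "\<dots> = 2 * (\<integral>x. (f m x - f ?p x)\<^sup>2 \<partial>M) + 2 * (\<integral>x. (f ?p x - h k x)\<^sup>2 \<partial>M)"
        unfolding h_def by (simp add: int2)
      finally show ?thesis using a b by linarith
    qed
    have "(\<integral>\<^sup>+x. ennreal ((f m x - g x)\<^sup>2) \<partial>M)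
        = (\<integral>\<^sup>+x. liminf (\<lambda>k. ennreal ((f m x - h k x)\<^sup>2)) \<partial>M)"
    proof (rule nn_integral_cong_AE)
      show "AE x in M. ennreal ((f m x - g x)\<^sup>2) = liminf (\<lambda>k. ennreal ((f m x - h k x)\<^sup>2))"
        using conv
      proof eventually_elim
        case (elim x)
        then have "(\<lambda>k. h k x) \<longlonglongrightarrow> g x" by (simp add: g_def convergent_LIMSEQ_iff)
        then have "(\<lambda>k. ennreal ((f m x - h k x)\<^sup>2)) \<longlonglongrightarrow> ennreal ((f m x - g x)\<^sup>2)"
          by (intro tendsto_ennrealI tendsto_intros)
        then show ?case by (intro lim_imp_Liminf[symmetric]) auto
      qed
    qed
    also have "\<dots> \<le> liminf (\<lambda>k. \<integral>\<^sup>+x. ennreal ((f m x - h k x)\<^sup>2) \<partial>M)"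
      by (intro nn_integral_liminf) simp
    also have "\<dots> = liminf (\<lambda>k. ennreal (\<integral>x. (f m x - h k x)\<^sup>2 \<partial>M))"
      unfolding h_def by (subst nn_integral_eq_integral) (auto simp: int2)
    also have "\<dots> \<le> limsup (\<lambda>k. ennreal (\<integral>x. (f m x - h k x)\<^sup>2 \<partial>M))"
      by (simp add: Liminf_le_Limsup)
    also have "\<dots> \<le> ennreal (4*e)"
      by (intro Limsup_bounded eventually_sequentiallyI[of k0] ennreal_leI le)
    finally show ?thesis .
  qed
  have int_fg: "integrable M (\<lambda>x. (f m x - g x)\<^sup>2)" and le_fg: "(\<integral>x. (f m x - g x)\<^sup>2 \<partial>M) \<le> 4 * e"
    if m: "\<forall>m\<ge>K. \<forall>n\<ge>K. (\<integral>x. (f m x - f n x)\<^sup>2 \<partial>M) < e" "m \<ge> K" and e: "e > 0" for m K e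
  proof -
    note fg = fg[OF m e]
    show *: "integrable M (\<lambda>x. (f m x - g x)\<^sup>2)"
      by (rule integrableI_nonneg) (use fg in \<open>auto intro: le_less_trans\<close>)
    have "ennreal (\<integral>x. (f m x - g x)\<^sup>2 \<partial>M) \<le> ennreal (4 * e)"
      using fg * by (subst (asm) nn_integral_eq_integral) auto
    then show "(\<integral>x. (f m x - g x)\<^sup>2 \<partial>M) \<le> 4 * e" using e by simp
  qed
  obtain K where "\<forall>m\<ge>K. \<forall>n\<ge>K. (\<integral>x. (f m x - f n x)\<^sup>2 \<partial>M) < 1" using C[of 1] by auto
  from int_fg[OF this order_refl] have "sqint M (\<lambda>x. f K x - g x)" by (simp add: sqint_def)
  from sqint_diff[OF f this, of K] have "sqint M g" by simp
  moreover have "(\<lambda>m. \<integral>x. (f m x - g x)\<^sup>2 \<partial>M) \<longlonglongrightarrow> 0"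
  proof (rule LIMSEQ_I)
    fix e :: real assume "e > 0"
    then obtain K where K: "\<forall>m\<ge>K. \<forall>n\<ge>K. (\<integral>x. (f m x - f n x)\<^sup>2 \<partial>M) < e / 8" using C[of "e/8"] by auto
    have "norm ((\<integral>x. (f m x - g x)\<^sup>2 \<partial>M) - 0) < e" if "m \<ge> K" for m
      using le_fg[OF K that] \<open>e > 0\<close> by simp
    then show "\<exists>K. \<forall>m\<ge>K. norm ((\<integral>x. (f m x - g x)\<^sup>2 \<partial>M) - 0) < e" by blast
  qed
  ultimately show ?thesis by blast
qed

subsection \<open>Projections and the Schwarz bound in semi-inner product spaces\<close>

text \<open>Definiteness is left out because a function that vanishes almost everywhere has energy
  zero without being the zero function; the carrier is explicit because the forms behave well only
  on it.\<close>

locale semi_inner =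
  fixes H :: "('x \<Rightarrow> real) set" and B :: "('x \<Rightarrow> real) \<Rightarrow> ('x \<Rightarrow> real) \<Rightarrow> real"
  assumes H_lin: "u \<in> H \<Longrightarrow> v \<in> H \<Longrightarrow> (\<lambda>x. a * u x + b * v x) \<in> H"
    and B_sym: "u \<in> H \<Longrightarrow> v \<in> H \<Longrightarrow> B u v = B v u"
    and B_lin: "u \<in> H \<Longrightarrow> v \<in> H \<Longrightarrow> w \<in> H \<Longrightarrow> B (\<lambda>x. a * u x + b * v x) w = a * B u w + b * B v w"
    and B_nonneg: "u \<in> H \<Longrightarrow> 0 \<le> B u u"
begin

lemma B_lin_right:
  assumes "u \<in> H" "v \<in> H" "w \<in> H"
  shows "B w (\<lambda>x. a * u x + b * v x) = a * B w u + b * B w v"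
  using assms B_lin[of u v w] B_sym[of w] H_lin by metis

lemma H_diff: "u \<in> H \<Longrightarrow> v \<in> H \<Longrightarrow> (\<lambda>x. u x - v x) \<in> H"
  using H_lin[of u v 1 "-1"] by simp

lemma B_diff: "u \<in> H \<Longrightarrow> v \<in> H \<Longrightarrow> w \<in> H \<Longrightarrow> B (\<lambda>x. u x - v x) w = B u w - B v w"
  using B_lin[of u v w 1 "-1"] by simp

lemma B_diff_right: "u \<in> H \<Longrightarrow> v \<in> H \<Longrightarrow> w \<in> H \<Longrightarrow> B w (\<lambda>x. u x - v x) = B w u - B w v"
  using B_lin_right[of u v w 1 "-1"] by simp

lemma B_quad:
  assumes "u \<in> H" "v \<in> H"
  shows "B (\<lambda>x. a * u x + b * v x) (\<lambda>x. a * u x + b * v x) = a\<^sup>2 * B u u + 2 * a * b * B u v + b\<^sup>2 * B v v"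
  using assms by (simp add: B_lin B_lin_right H_lin B_sym[of v u] power2_eq_square algebra_simps)

text \<open>The first-order condition at a minimum. The witness \<open>?t\<close> makes the
  quadratic term at most \<open>?t * p\<close>, half of the left side.\<close>

lemma linear_le_quadratic_imp_zero:
  fixes p q :: real
  assumes "\<And>t. 2 * t * p \<le> t\<^sup>2 * q"
  shows "p = 0"
proof (rule ccontr)
  assume p: "p \<noteq> 0"
  let ?t = "p / (\<bar>q\<bar> + 1)"
  have "2 * ?t * p \<le> ?t\<^sup>2 * \<bar>q\<bar>"
    using assms[of ?t] by (rule order_trans) (auto intro: mult_left_mono)
  also have "\<dots> \<le> ?t\<^sup>2 * (\<bar>q\<bar> + 1)" by (intro mult_left_mono) auto
  also have "\<dots> = ?t * p" by (simp add: power2_eq_square)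
  finally have "?t * p \<le> 0" by simp
  moreover have "?t * p > 0" using p by (auto simp: zero_less_mult_iff zero_less_divide_iff add_nonneg_pos)
  ultimately show False by simp
qed

text \<open>For a semidefinite form \<open>B v v = 0\<close> does not give \<open>v = 0\<close>, so
  this case is separate: there nonnegativity bounds a linear function of \<open>t\<close> from
  above, which forces \<open>B u v = 0\<close>.\<close>

lemma Cauchy_Schwarz:
  assumes "u \<in> H" "v \<in> H"
  shows "(B u v)\<^sup>2 \<le> B u u * B v v"
proof (cases "B v v = 0")
  case True
  have "2 * t * (B u v) \<le> t\<^sup>2 * 0 + B u u" for t
    using B_nonneg[OF H_lin[OF assms, of 1 "-t"]] B_quad[OF assms, of 1 "-t"] True by simp
  then have bd: "2 * t * B u v \<le> B u u" for t by simp
  have "B u v = 0"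
  proof (rule ccontr)
    assume "B u v \<noteq> 0"
    \<comment> \<open>For this \<open>t\<close> the left side of the bound equals
      \<open>B u u + 1\<close>.\<close>
    then show False using bd[of "(B u u + 1) / (2 * B u v)"] by simp
  qed
  then show ?thesis using True by simp
next
  case False
  then have pos: "B v v > 0" using B_nonneg[OF assms(2)] by simp
  have "0 \<le> B v v * (B u u * B v v - (B u v)\<^sup>2)"
    using B_nonneg[OF H_lin[OF assms, of "B v v" "- B u v"]] B_quad[OF assms, of "B v v" "- B u v"]
    by (simp add: power2_eq_square algebra_simps)
  then show ?thesis using pos by (simp add: zero_le_mult_iff)
qed

text \<open>Convergence in the seminorm implies weak convergence, by Cauchy-Schwarz against the
  fixed \<open>v\<close>.\<close>

lemma tendsto_B:
  assumes w: "\<And>m. w m \<in> H" and l: "l \<in> H" and v: "v \<in> H"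
    and lim: "(\<lambda>m. B (\<lambda>x. w m x - l x) (\<lambda>x. w m x - l x)) \<longlonglongrightarrow> 0"
  shows "(\<lambda>m. B (w m) v) \<longlonglongrightarrow> B l v"
proof -
  have "(\<lambda>m. (B (\<lambda>x. w m x - l x) v)\<^sup>2) \<longlonglongrightarrow> 0"
  proof (rule tendsto_sandwich[OF _ _ tendsto_const])
    show "(\<lambda>m. B (\<lambda>x. w m x - l x) (\<lambda>x. w m x - l x) * B v v) \<longlonglongrightarrow> 0"
      using tendsto_mult_right[OF lim, of "B v v"] by simp
  qed (auto intro!: always_eventually Cauchy_Schwarz H_diff w l v)
  then have "(\<lambda>m. B (w m) v - B l v) \<longlonglongrightarrow> 0"
    by (simp add: B_diff w l v)
  then show ?thesis by (simp add: LIM_zero_iff)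
qed

text \<open>The projection is the limit of a minimising sequence for the distance from
  \<open>u\<close> to \<open>W\<close>. Completeness is assumed in sequential form for differences,
  so no quotient by null functions has to be formed.\<close>

lemma ex_projection:
  assumes WH: "W \<subseteq> H" and W0: "W \<noteq> {}"
    and Wlin: "\<And>u v a b. u \<in> W \<Longrightarrow> v \<in> W \<Longrightarrow> (\<lambda>x. a * u x + b * v x) \<in> W"
    and complete: "\<And>w :: nat \<Rightarrow> 'x \<Rightarrow> real. (\<And>m. w m \<in> W) \<Longrightarrow>
      (\<And>e. e > 0 \<Longrightarrow> \<exists>N. \<forall>m\<ge>N. \<forall>n\<ge>N. B (\<lambda>x. w m x - w n x) (\<lambda>x. w m x - w n x) < e) \<Longrightarrow>
      \<exists>l\<in>W. (\<lambda>m. B (\<lambda>x. w m x - l x) (\<lambda>x. w m x - l x)) \<longlonglongrightarrow> 0"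
    and u: "u \<in> H"
  shows "\<exists>p\<in>W. \<forall>v\<in>W. B p v = B u v"
proof -
  define Q where "Q v = B v v" for v
  define d where "d = (INF w\<in>W. Q (\<lambda>x. u x - w x))"
  have bdd: "bdd_below ((\<lambda>w. Q (\<lambda>x. u x - w x)) ` W)"
    using WH u by (intro bdd_belowI[of _ 0]) (auto simp: Q_def intro!: B_nonneg H_diff)
  have d_le: "d \<le> Q (\<lambda>x. u x - w x)" if "w \<in> W" for w
    unfolding d_def by (rule cINF_lower[OF bdd that])
  have "\<exists>w\<in>W. Q (\<lambda>x. u x - w x) < d + 1 / (real m + 1)" for m :: nat
    using W0 bdd unfolding d_def by (subst cINF_less_iff[symmetric]) auto
  then obtain w where wW: "\<And>m. w m \<in> W" and w: "\<And>m. Q (\<lambda>x. u x - w m x) < d + 1 / (real m + 1)"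
    by metis
  have wH: "w m \<in> H" for m using wW WH by auto
  have par: "Q (\<lambda>x. w m x - w n x) \<le> 2 / (real m + 1) + 2 / (real n + 1)" for m n
  proof -
    let ?f = "\<lambda>x. u x - w m x" and ?g = "\<lambda>x. u x - w n x"
    have fH: "?f \<in> H" and gH: "?g \<in> H" by (auto intro!: H_diff u wH)
    \<comment> \<open>The midpoint of \<open>w m\<close> and \<open>w n\<close> lies in
      \<open>W\<close>, so its squared distance to \<open>u\<close> is at least \<open>d\<close>;
      the parallelogram identity then shows that the minimising sequence is Cauchy.\<close>
    have "d \<le> Q (\<lambda>x. u x - ((1/2) * w m x + (1/2) * w n x))" by (intro d_le Wlin wW)
    also have "(\<lambda>x. u x - ((1/2) * w m x + (1/2) * w n x)) = (\<lambda>x. (1/2) * ?f x + (1/2) * ?g x)"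
      by (auto simp: field_simps)
    also have "4 * Q \<dots> = Q ?f + 2 * B ?f ?g + Q ?g"
      unfolding Q_def B_quad[OF fH gH] by (simp add: power2_eq_square)
    finally have 1: "4 * d \<le> Q ?f + 2 * B ?f ?g + Q ?g" by simp
    have "(\<lambda>x. w m x - w n x) = (\<lambda>x. (-1) * ?f x + 1 * ?g x)" by auto
    then have "Q (\<lambda>x. w m x - w n x) = Q ?f - 2 * B ?f ?g + Q ?g"
      unfolding Q_def using B_quad[OF fH gH, of "-1" 1] by simp
    with 1 w[of m] w[of n] show ?thesis by linarith
  qed
  have "\<exists>l\<in>W. (\<lambda>m. B (\<lambda>x. w m x - l x) (\<lambda>x. w m x - l x)) \<longlonglongrightarrow> 0"
  proof (rule complete)
    fix e :: real assume e: "e > 0"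
    obtain N :: nat where N: "4 / e < real N" using reals_Archimedean2 by blast
    have "B (\<lambda>x. w m x - w n x) (\<lambda>x. w m x - w n x) < e" if "m \<ge> N" "n \<ge> N" for m n
    proof -
      have N0: "real N > 0" using N e by (smt (verit) divide_pos_pos)
      have *: "2 / (real k + 1) < e / 2" if "k \<ge> N" for k
      proof -
        have "4 / e < real k + 1" using N that by linarith
        then have "4 < (real k + 1) * e" using e by (simp add: pos_divide_less_eq)
        then show ?thesis by (simp add: pos_divide_less_eq algebra_simps)
      qed
      show ?thesis using par[of m n] *[OF that(1)] *[OF that(2)] by (simp add: Q_def)
    qed
    then show "\<exists>N. \<forall>m\<ge>N. \<forall>n\<ge>N. B (\<lambda>x. w m x - w n x) (\<lambda>x. w m x - w n x) < e" by blast
  qed (rule wW)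
  then obtain l where lW: "l \<in> W" and l: "(\<lambda>m. B (\<lambda>x. w m x - l x) (\<lambda>x. w m x - l x)) \<longlonglongrightarrow> 0" by blast
  have lH: "l \<in> H" using lW WH by auto
  have "B l v = B u v" if v: "v \<in> W" for v
  proof -
    have vH: "v \<in> H" using v WH by auto
    \<comment> \<open>Minimality is tested at \<open>w m + t v\<close>, where the defect is at most
      \<open>1 / (m + 1)\<close>; in the limit it becomes the first-order condition at
      \<open>l\<close>.\<close>
    have "2 * t * (B u v - B l v) \<le> t\<^sup>2 * Q v" for t
    proof -
      have "2 * t * (B u v - B (w m) v) \<le> t\<^sup>2 * Q v + 1 / (real m + 1)" for m
      proof -
        let ?f = "\<lambda>x. u x - w m x"
        have fH: "?f \<in> H" by (intro H_diff u wH)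
        have "d \<le> Q (\<lambda>x. u x - (1 * w m x + t * v x))" by (intro d_le Wlin wW v)
        also have "(\<lambda>x. u x - (1 * w m x + t * v x)) = (\<lambda>x. 1 * ?f x + (-t) * v x)" by auto
        also have "Q \<dots> = Q ?f - 2 * t * B ?f v + t\<^sup>2 * Q v"
          unfolding Q_def using B_quad[OF fH vH, of 1 "-t"] by simp
        finally show ?thesis using w[of m] by (simp add: B_diff u wH vH)
      qed
      moreover have "(\<lambda>m. 2 * t * (B u v - B (w m) v)) \<longlonglongrightarrow> 2 * t * (B u v - B l v)"
        by (intro tendsto_intros tendsto_B wH lH vH l)
      moreover have "(\<lambda>m. t\<^sup>2 * Q v + 1 / (real m + 1)) \<longlonglongrightarrow> t\<^sup>2 * Q v + 0"
        using LIMSEQ_inverse_real_of_nat by (intro tendsto_intros) (simp add: inverse_eq_divide add.commute)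
      ultimately show ?thesis using LIMSEQ_le[of _ _ _ "t\<^sup>2 * Q v + 0"] by force
    qed
    from linear_le_quadratic_imp_zero[OF this] show ?thesis by simp
  qed
  then show ?thesis using lW by blast
qed

text \<open>Polarisation, applied to multiples of u and S u.\<close>

lemma norm_symmetric_le:
  assumes SH: "\<And>u. u \<in> H \<Longrightarrow> S u \<in> H"
    and sym: "\<And>u v. u \<in> H \<Longrightarrow> v \<in> H \<Longrightarrow> B (S u) v = B u (S v)"
    and bd: "\<And>u. u \<in> H \<Longrightarrow> \<bar>B (S u) u\<bar> \<le> g * B u u"
    and u: "u \<in> H"
  shows "B (S u) (S u) \<le> g\<^sup>2 * B u u"
proof -
  have gnn: "0 \<le> g * B v v" if "v \<in> H" for v using bd[OF that] by linarith
  \<comment> \<open>The scales \<open>r\<close> and \<open>s\<close> stay free: the left side sees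
    only their product, the right side their squares, which allows \<open>u\<close> and
    \<open>S u\<close> to be balanced afterwards.\<close>
  have key: "4 * (r * s * B (S u) v) \<le> 2 * g * (r\<^sup>2 * B u u + s\<^sup>2 * B v v)" if v: "v \<in> H" for v r s
  proof -
    let ?p = "\<lambda>x. r * u x + s * v x" and ?q = "\<lambda>x. r * u x + (-s) * v x"
    have pH: "?p \<in> H" and qH: "?q \<in> H" by (intro H_lin u v)+
    have e: "B (S (\<lambda>x. r * u x + t * v x)) (\<lambda>x. r * u x + t * v x)
        = r\<^sup>2 * B (S u) u + 2 * r * t * B (S u) v + t\<^sup>2 * B (S v) v" for t
    proof -
      have "B (S (\<lambda>x. r * u x + t * v x)) z = r * B (S u) z + t * B (S v) z" if z: "z \<in> H" for z
        using sym[OF H_lin[OF u v] z] sym[OF u z] sym[OF v z] B_lin[OF u v SH[OF z]] by metis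
      moreover have "B (S v) u = B (S u) v" using sym[OF v u] B_sym[OF v SH[OF u]] by simp
      ultimately show ?thesis
        by (simp add: H_lin u v B_lin_right SH power2_eq_square algebra_simps)
    qed
    have "4 * (r * s * B (S u) v) = B (S ?p) ?p - B (S ?q) ?q"
      using e[of s] e[of "-s"] by simp
    also have "\<dots> \<le> g * B ?p ?p + g * B ?q ?q" using bd[OF pH] bd[OF qH] by linarith
    also have "\<dots> = 2 * g * (r\<^sup>2 * B u u + s\<^sup>2 * B v v)"
      unfolding B_quad[OF u v] by (simp add: power2_eq_square algebra_simps)
    finally show ?thesis .
  qed
  define X where "X = B (S u) (S u)"
  have X0: "X \<ge> 0" unfolding X_def by (intro B_nonneg SH u)
  show ?thesis
  \<comment> \<open>The positivity needed to cancel \<open>g\<close> is available only outside this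
    degenerate case. For a null \<open>u\<close>, symmetry moves one \<open>S\<close> across and
    Cauchy-Schwarz finishes.\<close>
  proof (cases "B u u = 0 \<or> g * B u u = 0")
    case True
    have Y: "(B (S u) (S u))\<^sup>2 \<le> B u u * B (S (S u)) (S (S u))"
      using Cauchy_Schwarz[OF u SH[OF SH[OF u]]] sym[OF u SH[OF u]] by simp
    show ?thesis
    proof (cases "B u u = 0")
      case True then show ?thesis using Y by simp
    next
      case False
      then have "g = 0" using True by simp
      then show ?thesis using key[OF SH[OF u], of 1 1] by simp
    qed
  next
    case False
    then have pos: "B u u > 0" "g > 0"
      using B_nonneg[OF u] gnn[OF u] by (auto simp: zero_le_mult_iff)
    \<comment> \<open>The balanced choice is \<open>r = g\<close>, \<open>s = 1\<close> and
      \<open>v = S u\<close>: after division by \<open>2 * g\<close> one copy of \<open>X\<close> is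
      absorbed and \<open>X \<le> g\<^sup>2 * B u u\<close> remains.\<close>
    have "4 * (g * X) \<le> 2 * g * (g\<^sup>2 * B u u + X)"
      using key[OF SH[OF u], of g 1] by (simp add: X_def)
    then have "g * (2 * X) \<le> g * (g\<^sup>2 * B u u + X)" by (simp add: algebra_simps)
    then have "2 * X \<le> g\<^sup>2 * B u u + X" using pos by (simp only: mult_le_cancel_left_pos)
    then show ?thesis by (simp add: X_def)
  qed
qed

lemma sum_H:
  assumes "finite I" "I \<noteq> {}" "\<And>i. i \<in> I \<Longrightarrow> w i \<in> H"
  shows "(\<lambda>x. \<Sum>i\<in>I. w i x) \<in> H"
  using assms
proof (induction rule: finite_ne_induct)
  case (insert i F)
  then show ?case using H_lin[of "w i" "\<lambda>x. \<Sum>i\<in>F. w i x" 1 1] by simp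
qed simp

lemma B_sum:
  assumes "finite I" "I \<noteq> {}" "\<And>i. i \<in> I \<Longrightarrow> w i \<in> H" "v \<in> H"
  shows "B (\<lambda>x. \<Sum>i\<in>I. w i x) v = (\<Sum>i\<in>I. B (w i) v)"
  using assms
proof (induction rule: finite_ne_induct)
  case (insert i F)
  then show ?case using B_lin[of "w i" "\<lambda>x. \<Sum>i\<in>F. w i x" v 1 1] sum_H[of F w] by simp
qed simp

text \<open>Both bounds rest on the identity
  \<open>B (PP u) u = (\<Sum>i\<in>I. B (P i u) (P i u))\<close>: \<open>overlap\<close> then bounds
  the energy of \<open>PP u\<close>, and the decomposition by \<open>T\<close> is tested against the
  projections. The vector \<open>u0\<close> of positive energy is there to fix the sign of
  \<open>k1\<close>.\<close>

theorem additive_Schwarz: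
  assumes I: "finite I" "I \<noteq> {}"
    and WH: "\<And>i. i \<in> I \<Longrightarrow> W i \<subseteq> H"
    and PW: "\<And>i u. i \<in> I \<Longrightarrow> u \<in> H \<Longrightarrow> P i u \<in> W i"
    and P: "\<And>i u v. i \<in> I \<Longrightarrow> u \<in> H \<Longrightarrow> v \<in> W i \<Longrightarrow> B (P i u) v = B u v"
    and TW: "\<And>i u. i \<in> I \<Longrightarrow> u \<in> H \<Longrightarrow> T i u \<in> W i"
    and T_sum: "\<And>u. u \<in> H \<Longrightarrow> u = (\<lambda>x. \<Sum>i\<in>I. T i u x)"
    and stable: "\<And>u. u \<in> H \<Longrightarrow> (\<Sum>i\<in>I. B (T i u) (T i u)) \<le> k1 * B u u"
    and overlap: "\<And>w. (\<And>i. i \<in> I \<Longrightarrow> w i \<in> W i) \<Longrightarrow>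
      B (\<lambda>x. \<Sum>i\<in>I. w i x) (\<lambda>x. \<Sum>i\<in>I. w i x) \<le> k2 * (\<Sum>i\<in>I. B (w i) (w i))"
    and k2: "k2 > 0"
    and ex: "u0 \<in> H" "B u0 u0 > 0"
  shows "k1 > 0"
    and "u \<in> H \<Longrightarrow> sqrt (B (\<lambda>x. u x - 1 / (k2 + 1 / k1) * (\<Sum>i\<in>I. P i u x))
                          (\<lambda>x. u x - 1 / (k2 + 1 / k1) * (\<Sum>i\<in>I. P i u x)))
            \<le> k2 / (1 / k1 + k2) * sqrt (B u u)"
proof -
  define PP where "PP u = (\<lambda>x. \<Sum>i\<in>I. P i u x)" for u
  have PH: "P i u \<in> H" if "i \<in> I" "u \<in> H" for i u using PW WH that by blast
  have TH: "T i u \<in> H" if "i \<in> I" "u \<in> H" for i u using TW WH that by blast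
  have PPH: "PP u \<in> H" if "u \<in> H" for u unfolding PP_def by (intro sum_H I PH that)
  have PPB: "B (PP u) v = (\<Sum>i\<in>I. B (P i u) v)" if "u \<in> H" "v \<in> H" for u v
    unfolding PP_def by (intro B_sum I PH that)
  have PPs: "B (P i u) v = B (P i u) (P i v)" if "i \<in> I" "u \<in> H" "v \<in> H" for i u v
    using P[OF that(1) that(3) PW[OF that(1) that(2)]] B_sym[of v "P i u"] B_sym[of "P i v" "P i u"] PH that by metis
  have sym: "B (PP u) v = B u (PP v)" if "u \<in> H" "v \<in> H" for u v
  proof -
    have "B (PP u) v = (\<Sum>i\<in>I. B (P i u) (P i v))" using PPB PPs that by simp
    also have "\<dots> = (\<Sum>i\<in>I. B (P i v) (P i u))" using B_sym PH that by (intro sum.cong) auto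
    also have "\<dots> = B (PP v) u" using PPB PPs that by simp
    finally show ?thesis using B_sym[OF that(1) PPH[OF that(2)]] by simp
  qed
  have PPq: "B (PP u) u = (\<Sum>i\<in>I. B (P i u) (P i u))" if "u \<in> H" for u
    using PPB PPs that by simp
  have PPnn: "0 \<le> B (PP u) u" if "u \<in> H" for u
    using that by (auto simp: PPq intro!: sum_nonneg B_nonneg PH)
  have upper: "B (PP u) u \<le> k2 * B u u" if u: "u \<in> H" for u
  proof -
    have "B (PP u) (PP u) \<le> k2 * B (PP u) u"
      unfolding PPq[OF u] unfolding PP_def by (intro overlap PW u)
    then have "B u u * B (PP u) (PP u) \<le> B u u * (k2 * B (PP u) u)"
      by (intro mult_left_mono B_nonneg u)
    moreover have "(B (PP u) u)\<^sup>2 \<le> B (PP u) (PP u) * B u u" by (intro Cauchy_Schwarz PPH u)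
    ultimately have "B (PP u) u * B (PP u) u \<le> B (PP u) u * (k2 * B u u)"
      by (simp add: power2_eq_square algebra_simps)
    then show ?thesis
      using PPnn[OF u] k2 B_nonneg[OF u]
      by (cases "B (PP u) u = 0") (auto simp: mult_le_cancel_left_pos)
  qed
  \<comment> \<open>Kept free of division, since the sign of \<open>k1\<close> is not yet known;
    evaluated at \<open>u0\<close>, this very inequality decides it.\<close>
  have lower: "(B u u)\<^sup>2 \<le> B (PP u) u * (k1 * B u u)" if u: "u \<in> H" for u
  proof -
    have "B u u = B (\<lambda>x. \<Sum>i\<in>I. T i u x) u" using T_sum[OF u] by simp
    also have "\<dots> = (\<Sum>i\<in>I. B (T i u) u)" by (intro B_sum I TH u)
    also have "\<dots> = (\<Sum>i\<in>I. B (P i u) (T i u))"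
      using P[OF _ u TW[OF _ u]] B_sym[OF u TH[OF _ u]] by (intro sum.cong) auto
    also have "\<dots> \<le> (\<Sum>i\<in>I. sqrt (B (P i u) (P i u)) * sqrt (B (T i u) (T i u)))"
    proof (rule sum_mono)
      fix i assume i: "i \<in> I"
      have "(B (P i u) (T i u))\<^sup>2 \<le> (sqrt (B (P i u) (P i u)) * sqrt (B (T i u) (T i u)))\<^sup>2"
        using Cauchy_Schwarz[OF PH[OF i u] TH[OF i u]] B_nonneg[OF PH[OF i u]] B_nonneg[OF TH[OF i u]]
        by (simp add: power_mult_distrib)
      then show "B (P i u) (T i u) \<le> sqrt (B (P i u) (P i u)) * sqrt (B (T i u) (T i u))"
        using B_nonneg[OF PH[OF i u]] B_nonneg[OF TH[OF i u]] by (auto dest: power2_le_imp_le)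
    qed
    finally have le: "B u u \<le> (\<Sum>i\<in>I. sqrt (B (P i u) (P i u)) * sqrt (B (T i u) (T i u)))" .
    have "(B u u)\<^sup>2 \<le> (\<Sum>i\<in>I. sqrt (B (P i u) (P i u)) * sqrt (B (T i u) (T i u)))\<^sup>2"
      by (intro power_mono le B_nonneg u)
    also have "\<dots> \<le> (\<Sum>i\<in>I. (sqrt (B (P i u) (P i u)))\<^sup>2) * (\<Sum>i\<in>I. (sqrt (B (T i u) (T i u)))\<^sup>2)"
      by (rule Cauchy_Schwarz_ineq_sum)
    also have "\<dots> = B (PP u) u * (\<Sum>i\<in>I. B (T i u) (T i u))"
      using B_nonneg PH TH u by (simp add: PPq[OF u] cong: sum.cong)
    also have "\<dots> \<le> B (PP u) u * (k1 * B u u)"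
      by (intro mult_left_mono stable u PPnn)
    finally show ?thesis .
  qed
  show k1: "k1 > 0"
  proof -
    have "0 < (B u0 u0)\<^sup>2" using ex by simp
    then have "0 < B (PP u0) u0 * k1 * B u0 u0" using lower[OF ex(1)] by (simp only: mult.assoc)
    then show ?thesis using PPnn[OF ex(1)] ex by (auto simp: zero_less_mult_iff)
  qed
  have lower': "B u u / k1 \<le> B (PP u) u" if u: "u \<in> H" for u
  proof (cases "B u u = 0")
    case False
    then have "B u u > 0" using B_nonneg[OF u] by simp
    then have "B u u * B u u \<le> B u u * (B (PP u) u * k1)"
      using lower[OF u] by (simp add: power2_eq_square algebra_simps)
    then have "B u u \<le> B (PP u) u * k1" using \<open>B u u > 0\<close> by (simp only: mult_le_cancel_left_pos)
    then show ?thesis using k1 by (simp add: pos_divide_le_eq)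
  qed (use PPnn[OF u] in simp)
  \<comment> \<open>\<open>1 / s\<close> is the damping parameter. Since \<open>k2 \<le> s\<close>,
    the form of \<open>S\<close> stays nonnegative; since \<open>s - 1 / k1 = k2\<close>, its upper
    bound is the contraction factor \<open>k2 / s\<close>.\<close>
  define s where "s = k2 + 1 / k1"
  have s: "s > 0" using k1 k2 by (simp add: s_def add_pos_pos)
  define S where "S u = (\<lambda>x. u x - 1 / s * PP u x)" for u
  have SB: "B (S u) v = B u v - 1 / s * B (PP u) v" if "u \<in> H" "v \<in> H" for u v
    unfolding S_def using B_lin[OF that(1) PPH[OF that(1)] that(2), of 1 "- 1 / s"] by simp
  have SH: "S u \<in> H" if "u \<in> H" for u
    unfolding S_def using H_lin[OF that PPH[OF that], of 1 "- 1 / s"] by simp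
  have Ssym: "B (S u) v = B u (S v)" if "u \<in> H" "v \<in> H" for u v
    using SB[OF that] SB[OF that(2,1)] sym[OF that] B_sym[OF that] B_sym[OF that(1) SH[OF that(2)]]
      B_sym[OF that(1) PPH[OF that(2)]] by simp
  have Sbd: "\<bar>B (S u) u\<bar> \<le> k2 / s * B u u" if u: "u \<in> H" for u
  proof -
    have "1 / s * B (PP u) u \<le> 1 / s * (k2 * B u u)" using s by (intro mult_left_mono upper u) auto
    also have "\<dots> \<le> B u u"
      using s k1 B_nonneg[OF u] by (simp add: pos_divide_le_eq s_def algebra_simps)
    finally have 1: "0 \<le> B (S u) u" using SB[OF u u] by simp
    have "1 / s * (B u u / k1) \<le> 1 / s * B (PP u) u" using s by (intro mult_left_mono lower' u) auto
    then have "B (S u) u \<le> B u u - 1 / s * (B u u / k1)" using SB[OF u u] by simp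
    also have "\<dots> = (s - 1 / k1) / s * B u u" using s by (simp add: field_simps)
    also have "\<dots> = k2 / s * B u u" by (simp add: s_def)
    finally show ?thesis using 1 by simp
  qed
  show "sqrt (B (\<lambda>x. u x - 1 / (k2 + 1 / k1) * (\<Sum>i\<in>I. P i u x))
                          (\<lambda>x. u x - 1 / (k2 + 1 / k1) * (\<Sum>i\<in>I. P i u x)))
            \<le> k2 / (1 / k1 + k2) * sqrt (B u u)" if u: "u \<in> H"
  proof -
    have "B (S u) (S u) \<le> (k2 / s)\<^sup>2 * B u u" by (rule norm_symmetric_le[OF SH Ssym Sbd u])
    then have "sqrt (B (S u) (S u)) \<le> sqrt ((k2 / s)\<^sup>2 * B u u)" by simp
    also have "\<dots> = k2 / s * sqrt (B u u)" using k2 s by (simp add: real_sqrt_mult)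
    finally show ?thesis by (simp add: S_def PP_def s_def add.commute)
  qed
qed

end

subsection \<open>Smooth functions\<close>

text \<open>Smoothness up to a finite order. Partial derivatives of a product are sums of products,
  so stability under products is an induction on the order in which the functions vary
  freely.\<close>

fun Ck_fun :: "nat \<Rightarrow> (real^'d::finite \<Rightarrow> real) \<Rightarrow> bool" where
  "Ck_fun 0 f \<longleftrightarrow> (\<forall>x. f differentiable (at x))"
| "Ck_fun (Suc n) f \<longleftrightarrow> (\<forall>x. f differentiable (at x)) \<and> (\<forall>i. Ck_fun n (pd i f))"

lemma Ck_fun_differentiable: "Ck_fun n f \<Longrightarrow> f differentiable (at x)"
  by (cases n) auto

lemma Ck_fun_SucD: "Ck_fun (Suc n) f \<Longrightarrow> Ck_fun n f"
  by (induction n arbitrary: f) auto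

lemma iter_pd_append: "iter_pd (is @ js) f = iter_pd is (iter_pd js f)"
  by (induction "is") auto

text \<open>\<open>iter_pd\<close> adds a derivative on the outside, \<open>Ck_fun\<close> takes the
  innermost one first; so the list is split at its last entry.\<close>

lemma Ck_fun_iff_iter_pd:
  "Ck_fun n f \<longleftrightarrow> (\<forall>is x. length is \<le> n \<longrightarrow> iter_pd is f differentiable (at x))"
proof (induction n arbitrary: f)
  case (Suc n)
  have "(\<forall>is x. length is \<le> Suc n \<longrightarrow> iter_pd is f differentiable (at x)) \<longleftrightarrow>
      (\<forall>x. f differentiable (at x)) \<and> (\<forall>i is x. length is \<le> n \<longrightarrow> iter_pd is (pd i f) differentiable (at x))"
    (is "?L \<longleftrightarrow> ?R")
  proof
    assume L: ?L
    have "iter_pd is (pd i f) differentiable (at x)" if "length is \<le> n" for i "is" x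
      using L[rule_format, of "is @ [i]" x] that by (simp add: iter_pd_append)
    moreover have "f differentiable (at x)" for x using L[rule_format, of "[]" x] by simp
    ultimately show ?R by blast
  next
    assume R: ?R
    show ?L
    proof (intro allI impI)
      fix "is" :: "'a list" and x assume le: "length is \<le> Suc n"
      show "iter_pd is f differentiable (at x)"
      proof (cases "is" rule: rev_cases)
        case (snoc js i)
        then show ?thesis using R le by (simp add: iter_pd_append)
      qed (use R in simp)
    qed
  qed
  then show ?case using Suc by simp
qed simp

lemma smooth_fun_iff_Ck: "smooth_fun f \<longleftrightarrow> (\<forall>n. Ck_fun n f)"
  unfolding smooth_fun_def Ck_fun_iff_iter_pd by blast

section \<open>Rules for partial derivatives and stability of smoothness\<close>

lemma pd_eqI: "(f has_derivative f') (at x) \<Longrightarrow> pd i f x = f' (axis i 1)"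
  unfolding pd_def by (simp add: frechet_derivative_at[symmetric])

lemma has_derivative_frechet: "f differentiable (at x) \<Longrightarrow> (f has_derivative frechet_derivative f (at x)) (at x)"
  by (simp add: frechet_derivative_works)

lemma pd_lincomb:
  assumes "f differentiable (at x)" "g differentiable (at x)"
  shows "pd i (\<lambda>x. a * f x + b * g x) x = a * pd i f x + b * pd i g x"
  by (subst pd_eqI, rule derivative_intros, rule has_derivative_mult_right, rule has_derivative_frechet[OF assms(1)],
      rule has_derivative_mult_right, rule has_derivative_frechet[OF assms(2)]) (simp add: pd_def)

lemma pd_mult:
  assumes "f differentiable (at x)" "g differentiable (at x)"
  shows "pd i (\<lambda>x. f x * g x) x = pd i f x * g x + f x * pd i g x"
  by (subst pd_eqI, rule has_derivative_mult, rule has_derivative_frechet[OF assms(1)], rule has_derivative_frechet[OF assms(2)])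
    (simp add: pd_def)

lemma Ck_fun_lincomb:
  "Ck_fun n f \<Longrightarrow> Ck_fun n g \<Longrightarrow> Ck_fun n (\<lambda>x. a * f x + b * g x)"
proof (induction n arbitrary: f g)
  case (Suc n)
  have "pd i (\<lambda>x. a * f x + b * g x) = (\<lambda>x. a * pd i f x + b * pd i g x)" for i
    using Suc.prems by (auto intro!: pd_lincomb ext)
  then show ?case using Suc by (auto intro!: derivative_intros)
qed (auto intro!: derivative_intros)

lemma Ck_fun_mult: "Ck_fun n f \<Longrightarrow> Ck_fun n g \<Longrightarrow> Ck_fun n (\<lambda>x. f x * g x)"
proof (induction n arbitrary: f g)
  case (Suc n)
  have e: "pd i (\<lambda>x. f x * g x) = (\<lambda>x. 1 * (pd i f x * g x) + 1 * (f x * pd i g x))" for i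
    using Suc.prems by (auto simp: pd_mult intro!: ext)
  have "Ck_fun n f" "Ck_fun n g" using Suc.prems Ck_fun_SucD by blast+
  then have "Ck_fun n (pd i (\<lambda>x. f x * g x))" for i
    unfolding e using Suc.prems by (intro Ck_fun_lincomb Suc.IH) auto
  then show ?case using Suc.prems by (auto intro!: derivative_intros)
qed (auto intro!: derivative_intros)

lemma smooth_fun_differentiable: "smooth_fun f \<Longrightarrow> f differentiable (at x)"
  using Ck_fun_differentiable unfolding smooth_fun_iff_Ck by blast

lemma smooth_fun_pd: "smooth_fun f \<Longrightarrow> smooth_fun (pd i f)"
  unfolding smooth_fun_iff_Ck using Ck_fun.simps(2) by blast

lemma smooth_fun_lincomb: "smooth_fun f \<Longrightarrow> smooth_fun g \<Longrightarrow> smooth_fun (\<lambda>x. a * f x + b * g x)"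
  unfolding smooth_fun_iff_Ck using Ck_fun_lincomb by blast

lemma smooth_fun_mult: "smooth_fun f \<Longrightarrow> smooth_fun g \<Longrightarrow> smooth_fun (\<lambda>x. f x * g x)"
  unfolding smooth_fun_iff_Ck using Ck_fun_mult by blast

lemma smooth_fun_continuous: "smooth_fun f \<Longrightarrow> continuous_on S f"
  by (meson smooth_fun_differentiable differentiable_imp_continuous_within continuous_at_imp_continuous_on)

text \<open>Reduces smoothness to exhibiting a family closed under partial derivatives, such as the
  multiples of all phase shifts of a wave, or zero and the successive derivatives of a function of
  one coordinate.\<close>

lemma smooth_fun_coinduct:
  assumes "f \<in> S" "\<And>g x. g \<in> S \<Longrightarrow> g differentiable (at x)" "\<And>g i. g \<in> S \<Longrightarrow> pd i g \<in> S"
  shows "smooth_fun f"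
proof -
  have "Ck_fun n g" if "g \<in> S" for n g
    using that assms(2,3) by (induction n arbitrary: g) auto
  then show ?thesis unfolding smooth_fun_iff_Ck using assms(1) by blast
qed

lemma smooth_fun_const: "smooth_fun (\<lambda>x. c)"
proof (rule smooth_fun_coinduct[where S = "range (\<lambda>c x. c)"])
  have "pd i (\<lambda>x. c) = (\<lambda>x. 0)" for i and c :: real
    by (rule ext, subst pd_eqI, rule has_derivative_const) simp
  then show "\<And>g i. g \<in> range (\<lambda>c x. c) \<Longrightarrow> pd i g \<in> range (\<lambda>c x. c)" by auto
qed auto

section \<open>Functions of one coordinate and their products\<close>

lemma has_derivative_coordinate:
  assumes "(h has_real_derivative h') (at (x $ j - a))"
  shows "((\<lambda>x. h (x $ j - a)) has_derivative (\<lambda>v. h' * v $ j)) (at x)"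
proof (rule has_derivative_compose[where f = "\<lambda>x. x $ j - a" and f' = "\<lambda>v. v $ j" and g = h])
  show "((\<lambda>x. x $ j - a) has_derivative (\<lambda>v. v $ j)) (at x)"
    using has_derivative_diff[OF bounded_linear_imp_has_derivative[OF bounded_linear_vec_nth] has_derivative_const]
    by simp
  show "(h has_derivative (*) h') (at (x $ j - a))"
    using assms by (simp add: has_field_derivative_def)
qed

lemma pd_coordinate:
  assumes "(h has_real_derivative h') (at (x $ j - a))"
  shows "pd i (\<lambda>x. h (x $ j - a)) x = (if i = j then h' else 0)"
  using pd_eqI[OF has_derivative_coordinate[OF assms]] by (simp add: axis_def)

lemma differentiable_coordinate:
  assumes "(h has_real_derivative h') (at (x $ j - a))"
  shows "(\<lambda>x. h (x $ j - a)) differentiable (at x)"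
  using has_derivative_coordinate[OF assms] by (auto simp: differentiable_def)

text \<open>The derivatives are carried along as a sequence, \<open>h k\<close> being the k-th
  derivative of \<open>h 0\<close>, so that differentiation is a shift of the index.\<close>

definition smooth1 :: "(nat \<Rightarrow> real \<Rightarrow> real) \<Rightarrow> bool" where
  "smooth1 h \<longleftrightarrow> (\<forall>k t. (h k has_real_derivative h (Suc k) t) (at t))"

lemma smooth_fun_coordinate:
  assumes "smooth1 h"
  shows "smooth_fun (\<lambda>x. h k (x $ j - a))"
proof (rule smooth_fun_coinduct[where S = "insert (\<lambda>x. 0) (range (\<lambda>k x. h k (x $ j - a)))"])
  have h: "(h k has_real_derivative h (Suc k) t) (at t)" for k t using assms by (simp add: smooth1_def)
  show "pd i g \<in> insert (\<lambda>x. 0) (range (\<lambda>k x. h k (x $ j - a)))"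
    if "g \<in> insert (\<lambda>x. 0) (range (\<lambda>k x. h k (x $ j - a)))" for g i
    using that
  proof
    assume g: "g = (\<lambda>x. 0)"
    have "pd i g = (\<lambda>x. 0)"
      unfolding g by (rule ext, subst pd_eqI, rule has_derivative_const) simp
    then show ?thesis by blast
  next
    assume "g \<in> range (\<lambda>k x. h k (x $ j - a))"
    then obtain k where "g = (\<lambda>x. h k (x $ j - a))" by blast
    then have "pd i g = (\<lambda>x. if i = j then h (Suc k) (x $ j - a) else 0)"
      using pd_coordinate[OF h] by blast
    then show ?thesis by (cases "i = j") auto
  qed
  show "g differentiable (at x)" if "g \<in> insert (\<lambda>x. 0) (range (\<lambda>k x. h k (x $ j - a)))" for g x
    using that differentiable_coordinate[OF h] by auto
qed auto

lemma smooth_fun_prod: "(\<And>i. i \<in> I \<Longrightarrow> smooth_fun (f i)) \<Longrightarrow> smooth_fun (\<lambda>x. \<Prod>i\<in>I. f i x)"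
  by (induction I rule: infinite_finite_induct) (auto intro: smooth_fun_mult smooth_fun_const)

lemma pd_prod_coordinate:
  assumes "\<And>j t. (h j has_real_derivative h' j t) (at t)"
  shows "pd i (\<lambda>x. \<Prod>j\<in>UNIV. h j (x $ j)) x = h' i (x $ i) * (\<Prod>j\<in>UNIV - {i}. h j (x $ j))"
proof -
  have d: "(\<lambda>x. h j (x $ j)) differentiable (at x)" for j
    using differentiable_coordinate[of "h j" "h' j (x $ j)" x j 0] assms by simp
  have p: "pd i (\<lambda>x. h j (x $ j)) x = (if i = j then h' j (x $ j) else 0)" for j
    using pd_coordinate[of "h j" "h' j (x $ j)" x j 0] assms by simp
  have "(\<lambda>x. \<Prod>j\<in>J. h j (x $ j)) differentiable (at x) \<and> (i \<notin> J \<longrightarrow> pd i (\<lambda>x. \<Prod>j\<in>J. h j (x $ j)) x = 0)"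
    if "finite J" for J
    using that
  proof (induction J rule: finite_induct)
    case empty
    have "pd i (\<lambda>x. 1) x = 0" by (subst pd_eqI, rule has_derivative_const) simp
    then show ?case by simp
  next
    case (insert j J)
    then show ?case using d p by (auto simp: pd_mult intro!: differentiable_mult)
  qed
  note J = this
  have "(\<lambda>x. \<Prod>j\<in>UNIV. h j (x $ j)) = (\<lambda>x. h i (x $ i) * (\<Prod>j\<in>UNIV - {i}. h j (x $ j)))"
    by (subst prod.remove[of _ i]) auto
  then show ?thesis using J[of "UNIV - {i}"] d[of i] p[of i] by (simp add: pd_mult)
qed

text \<open>\<open>frechet_derivative\<close> is a choice among the derivatives at a point, so
  equality follows from \<open>f\<close> having the same derivatives at a point and at its
  translate.\<close>

lemma periodic_pd:
  assumes "periodic_fun f"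
  shows "periodic_fun (pd i f)"
proof -
  have "pd i f (x + axis j 1) = pd i f x" for x j
  proof -
    have shift: "((\<lambda>y. f (y + c)) has_derivative D) (at x)" if "(f has_derivative D) (at (x + c))" for D x c
      by (rule has_derivative_compose[where f = "\<lambda>y. y + c" and f' = "\<lambda>v. v" and g = f])
        (auto intro!: derivative_eq_intros that)
    have "(\<lambda>y. f (y + - axis j 1)) = f"
    proof
      show "f (y + - axis j 1) = f y" for y
        using assms[unfolded periodic_fun_def, rule_format, of "y - axis j 1" j] by simp
    qed
    then have "(f has_derivative D) (at (x + axis j 1)) \<longleftrightarrow> (f has_derivative D) (at x)" for D
      using shift[of D x "axis j 1"] shift[of D "x + axis j 1" "- axis j 1"] assms
      by (auto simp: periodic_fun_def)
    then show ?thesis by (simp add: pd_def frechet_derivative_def)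
  qed
  then show ?thesis by (simp add: periodic_fun_def)
qed

lemma test_fun_lincomb: "test_fun f \<Longrightarrow> test_fun g \<Longrightarrow> test_fun (\<lambda>x. a * f x + b * g x)"
  by (auto simp: test_fun_def periodic_fun_def intro: smooth_fun_lincomb)

lemma test_fun_mult: "test_fun f \<Longrightarrow> test_fun g \<Longrightarrow> test_fun (\<lambda>x. f x * g x)"
  by (auto simp: test_fun_def periodic_fun_def intro: smooth_fun_mult)

lemma test_fun_pd: "test_fun f \<Longrightarrow> test_fun (pd i f)"
  by (auto simp: test_fun_def smooth_fun_pd periodic_pd)

lemma test_fun_const: "test_fun (\<lambda>x. c)"
  by (auto simp: test_fun_def smooth_fun_const periodic_fun_def)

lemma test_fun_differentiable: "test_fun f \<Longrightarrow> f differentiable (at x)"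
  by (simp add: test_fun_def smooth_fun_differentiable)

lemma test_fun_continuous: "test_fun f \<Longrightarrow> continuous_on S f"
  by (simp add: test_fun_def smooth_fun_continuous)

subsection \<open>Trigonometric waves\<close>

text \<open>The phase treats sine and cosine at once: differentiation keeps the frequency, advances
  the phase by pi/2 and multiplies by a constant.\<close>

definition wave :: "real^'d::finite \<Rightarrow> real \<Rightarrow> real^'d \<Rightarrow> real" where
  "wave k s x = cos (2 * pi * (k \<bullet> x) + s)"

definition int_vec :: "real^'d::finite \<Rightarrow> bool" where
  "int_vec k \<longleftrightarrow> (\<forall>i. k $ i \<in> \<int>)"

lemma has_derivative_wave:
  "(wave k s has_derivative (\<lambda>v. 2 * pi * (k \<bullet> v) * wave k (s + pi / 2) x)) (at x)"
proof -
  have "- sin t = cos (t + pi / 2)" for t by (simp add: cos_add)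
  note * = this[of "2 * pi * (k \<bullet> x) + s"]
  have "(wave k s has_derivative (\<lambda>v. - sin (2 * pi * (k \<bullet> x) + s) * (2 * pi * (k \<bullet> v)))) (at x)"
    unfolding wave_def by (auto intro!: derivative_eq_intros)
  then show ?thesis unfolding * by (simp add: wave_def add.assoc mult.commute)
qed

lemma pd_wave: "pd i (wave k s) = (\<lambda>x. 2 * pi * k $ i * wave k (s + pi / 2) x)"
  by (rule ext, subst pd_eqI[OF has_derivative_wave]) (simp add: inner_axis)

lemma test_fun_wave:
  assumes "int_vec k"
  shows "test_fun (wave k s)"
  unfolding test_fun_def
proof
  show "smooth_fun (wave k s)"
  proof (rule smooth_fun_coinduct[where S = "range (\<lambda>(c, s) x. c * wave k s x)"])
    have "wave k s = (\<lambda>(c, s) x. c * wave k s x) (1, s)" by simp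
    then show "wave k s \<in> range (\<lambda>(c, s) x. c * wave k s x)" by blast
    fix g :: "real^'a \<Rightarrow> real" assume "g \<in> range (\<lambda>(c, s) x. c * wave k s x)"
    then obtain c s where g: "g = (\<lambda>x. c * wave k s x)" by auto
    have d: "(g has_derivative (\<lambda>v. c * (2 * pi * (k \<bullet> v) * wave k (s + pi / 2) x))) (at x)" for x
      unfolding g by (intro has_derivative_mult_right has_derivative_wave)
    then show "g differentiable (at x)" for x by (auto simp: differentiable_def)
    have "pd i g = (\<lambda>(c, s) x. c * wave k s x) (c * 2 * pi * k $ i, s + pi / 2)" for i
      by (rule ext, subst pd_eqI[OF d]) (simp add: inner_axis)
    then show "pd i g \<in> range (\<lambda>(c, s) x. c * wave k s x)" for i by blast
  qed
  show "periodic_fun (wave k s)"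
    unfolding periodic_fun_def
  proof (intro allI)
    fix x :: "real^'a" and i
    obtain m where m: "k $ i = of_int m" using assms by (auto simp: int_vec_def elim: Ints_cases)
    have "wave k s (x + axis i 1) = cos ((2 * pi * (k \<bullet> x) + s) + 2 * pi * of_int m)"
      by (simp add: wave_def inner_add_right inner_axis m algebra_simps)
    also have "\<dots> = wave k s x"
      unfolding wave_def cos_add[of _ "2 * pi * of_int m"] cos_int_2pin sin_int_2pin by simp
    finally show "wave k s (x + axis i 1) = wave k s x" .
  qed
qed

text \<open>This product formula is what makes the span of the waves with integer frequencies an
  algebra.\<close>

lemma wave_mult: "wave k s x * wave l t x = (wave (k + l) (s + t) x + wave (k - l) (s - t) x) / 2"
  unfolding wave_def cos_times_cos by (simp add: inner_add_left inner_diff_left algebra_simps)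

subsection \<open>The unit cube as a probability space\<close>

text \<open>Replaces the set integrals over the open cube by plain integrals for one measure of mass
  1, for which every bounded measurable function is square integrable.\<close>

definition cubeM :: "(real^'d::finite) measure" where
  "cubeM = restrict_space lborel unitD"

lemma unitD_eq_box: "unitD = box 0 (1 :: real^'d::finite)"
  by (auto simp: unitD_def mem_box_cart)

lemma unitD_sets [measurable]: "(unitD :: (real^'d::finite) set) \<in> sets borel"
  by (simp add: unitD_eq_box)

lemma unitD_subset_cbox: "unitD \<subseteq> cbox 0 (1 :: real^'d::finite)"
  unfolding unitD_eq_box by (rule box_subset_cbox)

lemma space_cubeM [simp]: "space (cubeM :: (real^'d::finite) measure) = unitD"
  by (simp add: cubeM_def space_restrict_space)

lemma emeasure_cubeM: "A \<subseteq> unitD \<Longrightarrow> emeasure cubeM (A :: (real^'d::finite) set) = emeasure lborel A"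
  unfolding cubeM_def by (intro emeasure_restrict_space) auto

lemma emeasure_cubeM_unitD: "emeasure cubeM (unitD :: (real^'d::finite) set) = 1"
proof -
  have "(0 :: real^'d) \<bullet> b \<le> 1 \<bullet> b \<and> (1 - 0 :: real^'d) \<bullet> b = 1" if "b \<in> Basis" for b
    using that by (auto simp: Basis_vec_def inner_axis)
  then have "emeasure lborel (box 0 (1 :: real^'d)) = ennreal (\<Prod>b\<in>Basis. 1)"
    by (subst emeasure_lborel_box) (auto intro!: prod.cong)
  then show ?thesis by (simp add: emeasure_cubeM unitD_eq_box)
qed

lemma finite_measure_cubeM: "finite_measure (cubeM :: (real^'d::finite) measure)"
  by (rule finite_measureI) (simp add: emeasure_cubeM_unitD)

lemma measure_cubeM_space [simp]: "measure cubeM (unitD :: (real^'d::finite) set) = 1"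
  by (simp add: measure_def emeasure_cubeM_unitD)

lemma measurable_cubeM: "f \<in> borel_measurable borel \<Longrightarrow> f \<in> borel_measurable cubeM"
  unfolding cubeM_def by (intro measurable_restrict_space1) auto

lemma AE_cubeM_iff: "(AE x in cubeM. P x) \<longleftrightarrow> (AE x in lborel. x \<in> unitD \<longrightarrow> P (x :: real^'d::finite))"
  unfolding cubeM_def by (subst AE_restrict_space_iff) auto

lemma set_integral_unitD: "set_lebesgue_integral lborel unitD (f :: real^'d::finite \<Rightarrow> real) = (\<integral>x. f x \<partial>cubeM)"
  unfolding cubeM_def set_lebesgue_integral_def by (subst integral_restrict_space) auto

lemma set_integrable_unitD: "set_integrable lborel unitD (f :: real^'d::finite \<Rightarrow> real) \<longleftrightarrow> integrable cubeM f"
  unfolding cubeM_def set_integrable_def by (subst integrable_restrict_space) auto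

lemma L2D_iff_sqint: "L2D u \<longleftrightarrow> sqint cubeM u"
  unfolding L2D_def sqint_def set_integrable_unitD set_borel_measurable_def cubeM_def
  by (subst borel_measurable_restrict_space_iff) auto

lemma bounded_on_cube:
  assumes "continuous_on UNIV (f :: real^'d::finite \<Rightarrow> real)"
  obtains C where "\<And>x. x \<in> cbox 0 1 \<Longrightarrow> \<bar>f x\<bar> \<le> C"
proof -
  have "bounded (f ` cbox 0 1)"
    by (intro compact_imp_bounded compact_continuous_image continuous_on_subset[OF assms]) auto
  then show ?thesis using that by (auto simp: bounded_iff)
qed

lemma AE_bounded_cubeM:
  assumes "continuous_on UNIV (f :: real^'d::finite \<Rightarrow> real)"
  obtains C where "AE x in cubeM. \<bar>f x\<bar> \<le> C"
proof -
  obtain C where "\<And>x. x \<in> cbox 0 1 \<Longrightarrow> \<bar>f x\<bar> \<le> C" using bounded_on_cube[OF assms] by blast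
  then have "AE x in cubeM. \<bar>f x\<bar> \<le> C" using unitD_subset_cbox by (intro AE_I2) auto
  then show ?thesis by (rule that)
qed

lemma continuous_measurable_cubeM:
  "continuous_on UNIV (f :: real^'d::finite \<Rightarrow> real) \<Longrightarrow> f \<in> borel_measurable cubeM"
  by (intro measurable_cubeM borel_measurable_continuous_onI)

lemma sqint_continuous:
  assumes "continuous_on UNIV (f :: real^'d::finite \<Rightarrow> real)"
  shows "sqint cubeM f"
  using AE_bounded_cubeM[OF assms] sqint_bounded[OF finite_measure_cubeM continuous_measurable_cubeM[OF assms]]
  by metis

lemma integrable_mult_continuous:
  assumes "integrable cubeM f" "continuous_on UNIV (g :: real^'d::finite \<Rightarrow> real)"
  shows "integrable cubeM (\<lambda>x. f x * g x)"
proof -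
  obtain C where C: "AE x in cubeM. \<bar>g x\<bar> \<le> C" using AE_bounded_cubeM[OF assms(2)] .
  note [measurable] = continuous_measurable_cubeM[OF assms(2)]
  show ?thesis
  proof (rule Bochner_Integration.integrable_bound)
    show "integrable cubeM (\<lambda>x. C * f x)" using assms(1) by simp
    show "AE x in cubeM. norm (f x * g x) \<le> norm (C * f x)"
      using C
    proof eventually_elim
      case (elim x)
      then have "\<bar>f x\<bar> * \<bar>g x\<bar> \<le> \<bar>f x\<bar> * \<bar>C\<bar>" by (intro mult_left_mono) auto
      then show ?case by (simp add: abs_mult mult.commute)
    qed
  qed (use assms(1) in measurable)
qed

subsection \<open>Completeness of the waves\<close>

text \<open>The linear span of the waves, given inductively so that a linear property has to be
  checked on single waves only.\<close>

inductive_set trig :: "(real^'d::finite \<Rightarrow> real) set" where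
  wave: "int_vec k \<Longrightarrow> wave k s \<in> trig"
| lin: "f \<in> trig \<Longrightarrow> g \<in> trig \<Longrightarrow> (\<lambda>x. a * f x + b * g x) \<in> trig"

lemma trig_continuous: "f \<in> trig \<Longrightarrow> continuous_on UNIV f"
  by (induction rule: trig.induct) (auto intro: test_fun_continuous test_fun_wave intro!: continuous_intros)

lemma trig_add: "f \<in> trig \<Longrightarrow> g \<in> trig \<Longrightarrow> (\<lambda>x. f x + g x) \<in> trig"
  using trig.lin[of f g 1 1] by simp

lemma trig_cmult: "f \<in> trig \<Longrightarrow> (\<lambda>x. a * f x) \<in> trig"
  using trig.lin[of f f a 0] by simp

lemma trig_const: "(\<lambda>x. c) \<in> trig"
proof -
  have "(\<lambda>x. c * wave 0 0 x) \<in> trig" by (intro trig_cmult trig.wave) (simp add: int_vec_def)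
  then show ?thesis by (simp add: wave_def)
qed

lemma trig_sum: "(\<And>i. i \<in> I \<Longrightarrow> f i \<in> trig) \<Longrightarrow> (\<lambda>x. \<Sum>i\<in>I. f i x) \<in> trig"
  by (induction I rule: infinite_finite_induct) (auto intro: trig_add trig_const)

lemma trig_mult:
  assumes "f \<in> trig" "g \<in> trig"
  shows "(\<lambda>x. f x * g x) \<in> trig"
  using assms(1)
proof (induction rule: trig.induct)
  case (wave k s)
  show ?case using assms(2)
  proof (induction rule: trig.induct)
    case (wave l t)
    have "int_vec (k + l)" "int_vec (k - l)" using wave \<open>int_vec k\<close> by (auto simp: int_vec_def)
    then have "(\<lambda>x. 1/2 * wave (k + l) (s + t) x + 1/2 * wave (k - l) (s - t) x) \<in> trig"
      by (intro trig.lin trig.wave)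
    then show ?case by (simp add: wave_mult add_divide_distrib)
  next
    case (lin f g a b)
    have "(\<lambda>x. wave k s x * (a * f x + b * g x)) = (\<lambda>x. a * (wave k s x * f x) + b * (wave k s x * g x))"
      by (auto simp: algebra_simps)
    then show ?case using trig.lin[OF lin.IH] by simp
  qed
next
  case (lin f h a b)
  have "(\<lambda>x. (a * f x + b * h x) * g x) = (\<lambda>x. a * (f x * g x) + b * (h x * g x))"
    by (auto simp: algebra_simps)
  then show ?case using trig.lin[OF lin.IH] by simp
qed

text \<open>Maps the torus into a Euclidean space of dimension 2d. Polynomials in the new
  coordinates are trigonometric polynomials, so Stone-Weierstrass on the compact image
  applies.\<close>

definition circle_map :: "real^'d::finite \<Rightarrow> (real^'d) \<times> (real^'d)" where
  "circle_map x = ((\<chi> i. cos (2 * pi * x $ i)), (\<chi> i. sin (2 * pi * x $ i)))"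

lemma continuous_circle_map: "continuous_on S circle_map"
  unfolding circle_map_def by (auto intro!: continuous_intros)

text \<open>The coordinates are waves whose frequency is a unit vector and whose phase is 0 or
  -pi/2; sums and products stay in \<open>trig\<close>.\<close>

lemma real_polynomial_circle_map: "real_polynomial_function p \<Longrightarrow> (\<lambda>x. p (circle_map x)) \<in> trig"
proof (induction rule: real_polynomial_function.induct)
  case (linear L)
  interpret bounded_linear L by fact
  have vec: "u = (\<Sum>i\<in>UNIV. u $ i *\<^sub>R axis i 1)" for u :: "real^'a"
    using basis_expansion[of u] by (simp add: scalar_mult_eq_scaleR)
  have pair: "L (u, v) = (\<Sum>i\<in>UNIV. u $ i * L (axis i 1, 0)) + (\<Sum>i\<in>UNIV. v $ i * L (0, axis i 1))"
    for u v :: "real^'a"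
  proof -
    have l1: "linear (\<lambda>u. L (u, 0))"
    proof (rule linearI)
      show "L (a + b, 0) = L (a, 0) + L (b, 0)" for a b using add[of "(a, 0)" "(b, 0)"] by simp
      show "L (r *\<^sub>R b, 0) = r *\<^sub>R L (b, 0)" for r b using scaleR[of r "(b, 0)"] by simp
    qed
    have l2: "linear (\<lambda>v. L (0, v))"
    proof (rule linearI)
      show "L (0, a + b) = L (0, a) + L (0, b)" for a b using add[of "(0, a)" "(0, b)"] by simp
      show "L (0, r *\<^sub>R b) = r *\<^sub>R L (0, b)" for r b using scaleR[of r "(0, b)"] by simp
    qed
    have "L (u, v) = L (u, 0) + L (0, v)" using add[of "(u, 0)" "(0, v)"] by simp
    also have "L (u, 0) = (\<Sum>i\<in>UNIV. u $ i * L (axis i 1, 0))"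
      by (subst vec[of u]) (simp add: linear_sum[OF l1] linear_cmul[OF l1])
    also have "L (0, v) = (\<Sum>i\<in>UNIV. v $ i * L (0, axis i 1))"
      by (subst vec[of v]) (simp add: linear_sum[OF l2] linear_cmul[OF l2])
    finally show ?thesis .
  qed
  have ax: "int_vec (axis i 1 :: real^'a)" for i by (auto simp: int_vec_def axis_def)
  have "(\<lambda>x :: real^'a. (\<Sum>i\<in>UNIV. L (axis i 1, 0) * wave (axis i 1) 0 x)
            + (\<Sum>i\<in>UNIV. L (0, axis i 1) * wave (axis i 1) (- (pi / 2)) x)) \<in> trig"
    by (intro trig_add trig_sum trig_cmult trig.wave ax)
  also have "(\<lambda>x :: real^'a. (\<Sum>i\<in>UNIV. L (axis i 1, 0) * wave (axis i 1) 0 x)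
            + (\<Sum>i\<in>UNIV. L (0, axis i 1) * wave (axis i 1) (- (pi / 2)) x)) = (\<lambda>x. L (circle_map x))"
    (is "?l = ?r")
  proof
    show "?l x = ?r x" for x
      unfolding circle_map_def by (rule sym, subst pair) (simp add: wave_def inner_axis' cos_diff mult.commute)
  qed
  finally show ?case .
qed (auto intro: trig_const trig_add trig_mult)

text \<open>Opposite faces are glued together, so one point has to be interior: integer differences
  of coordinates then lie strictly between -1 and 1. The other point may lie on the boundary,
  because the argument by compactness uses images of boundary points too.\<close>

lemma circle_map_inj:
  assumes "x \<in> unitD" "y \<in> cbox 0 1" "circle_map x = circle_map y"
  shows "x = y"
proof (subst vec_eq_iff, rule)
  fix i
  have "sin (2 * pi * x $ i) = sin (2 * pi * y $ i) \<and> cos (2 * pi * x $ i) = cos (2 * pi * y $ i)"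
    using assms(3) by (auto simp: circle_map_def vec_eq_iff)
  then obtain n :: int where "2 * pi * x $ i = 2 * pi * y $ i + 2 * pi * of_int n"
    by (auto simp: sin_cos_eq_iff)
  then have "2 * pi * x $ i = 2 * pi * (y $ i + of_int n)" by (simp add: algebra_simps)
  then have n: "x $ i = y $ i + of_int n" by simp
  have "0 < x $ i" "x $ i < 1" "0 \<le> y $ i" "y $ i \<le> 1"
    using assms(1,2) by (auto simp: unitD_def mem_box_cart)
  then have "real_of_int n < 1" "real_of_int n > -1" using n by auto
  then have "n = 0" by linarith
  then show "x $ i = y $ i" using n by simp
qed

text \<open>
  Waves are polynomials in the coordinates of the circle map, so orthogonality extends to all
  continuous functions of it; these approximate indicators of open sets because the
  circle map separates the open cube.
\<close>

theorem wave_complete: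
  fixes f :: "real^'d::finite \<Rightarrow> real"
  assumes f: "integrable cubeM f"
    and orth: "\<And>k s. int_vec k \<Longrightarrow> (\<integral>x. f x * wave k s x \<partial>cubeM) = 0"
  shows "AE x in cubeM. f x = 0"
proof -
  have trig0: "(\<integral>x. f x * g x \<partial>cubeM) = 0" if "g \<in> trig" for g
    using that
  proof (induction rule: trig.induct)
    case (lin g h a b)
    have "(\<integral>x. f x * (a * g x + b * h x) \<partial>cubeM) = (\<integral>x. a * (f x * g x) + b * (f x * h x) \<partial>cubeM)"
      by (simp add: algebra_simps)
    also have "\<dots> = 0"
      using lin integrable_mult_continuous[OF f trig_continuous] by simp
    finally show ?case .
  qed (rule orth)
  have cont0: "(\<integral>x. f x * F (circle_map x) \<partial>cubeM) = 0"
    if F: "continuous_on UNIV (F :: (real^'d) \<times> (real^'d) \<Rightarrow> real)" for F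
  proof (rule ccontr)
    let ?I = "\<integral>x. f x * F (circle_map x) \<partial>cubeM"
    assume "?I \<noteq> 0"
    \<comment> \<open>The summand 1 keeps the denominator positive when \<open>f\<close> is null and
      makes the final comparison strict.\<close>
    define e where "e = \<bar>?I\<bar> / ((\<integral>x. \<bar>f x\<bar> \<partial>cubeM) + 1)"
    have nn: "(\<integral>x. \<bar>f x\<bar> \<partial>cubeM) \<ge> 0" by simp
    have e: "e > 0" unfolding e_def using \<open>?I \<noteq> 0\<close> nn by (intro divide_pos_pos add_nonneg_pos) auto
    have "compact (circle_map ` cbox 0 (1 :: real^'d))"
      by (intro compact_continuous_image continuous_circle_map) auto
    then obtain p where p: "real_polynomial_function p"
      and pF: "\<And>z. z \<in> circle_map ` cbox 0 (1 :: real^'d) \<Longrightarrow> \<bar>F z - p z\<bar> < e"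
      using Stone_Weierstrass_real_polynomial_function[of _ F e] continuous_on_subset[OF F] e by blast
    have Fc: "continuous_on UNIV (\<lambda>x. F (circle_map x))"
      using continuous_on_compose2[OF F continuous_circle_map] by auto
    have pt: "(\<lambda>x. p (circle_map x)) \<in> trig" by (rule real_polynomial_circle_map[OF p])
    note i1 = integrable_mult_continuous[OF f Fc] and i2 = integrable_mult_continuous[OF f trig_continuous[OF pt]]
    have "?I = (\<integral>x. f x * F (circle_map x) - f x * p (circle_map x) \<partial>cubeM)"
      using trig0[OF pt] i1 i2 by simp
    also have "\<bar>\<dots>\<bar> \<le> (\<integral>x. \<bar>f x * F (circle_map x) - f x * p (circle_map x)\<bar> \<partial>cubeM)"
      using integral_norm_bound[of cubeM "\<lambda>x. f x * F (circle_map x) - f x * p (circle_map x)"] by simp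
    also have "\<dots> \<le> (\<integral>x. e * \<bar>f x\<bar> \<partial>cubeM)"
    proof (rule integral_mono)
      fix x :: "real^'d" assume "x \<in> space cubeM"
      then have "x \<in> cbox 0 1" using unitD_subset_cbox by auto
      then have "\<bar>F (circle_map x) - p (circle_map x)\<bar> \<le> e" using pF by (simp add: less_imp_le)
      then have "\<bar>f x\<bar> * \<bar>F (circle_map x) - p (circle_map x)\<bar> \<le> \<bar>f x\<bar> * e" by (intro mult_left_mono) auto
      then show "\<bar>f x * F (circle_map x) - f x * p (circle_map x)\<bar> \<le> e * \<bar>f x\<bar>"
        by (simp add: abs_mult[symmetric] right_diff_distrib mult.commute)
    qed (use f i1 i2 in auto)
    also have "\<dots> = e * (\<integral>x. \<bar>f x\<bar> \<partial>cubeM)" by simp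
    also have "\<dots> < e * ((\<integral>x. \<bar>f x\<bar> \<partial>cubeM) + 1)" using e by simp
    also have "\<dots> = \<bar>?I\<bar>" 
    proof -
      have "(\<integral>x. \<bar>f x\<bar> \<partial>cubeM) + 1 > 0" using nn by (rule add_nonneg_pos) simp
      then show ?thesis unfolding e_def by simp
    qed
    finally show False by simp
  qed
  have open0: "(\<integral>x. f x * indicator U x \<partial>cubeM) = 0" if U: "open U" for U
  proof -
    \<comment> \<open>The complement of \<open>U\<close> is taken in the closed cube, which makes
      its image compact; by injectivity \<open>C\<close> still recognises exactly the points of the
      open cube outside \<open>U\<close>.\<close>
    define C where "C = circle_map ` (cbox 0 1 - U \<inter> unitD)"
    have "compact (cbox 0 1 - U \<inter> unitD :: (real^'d) set)"
      using U by (intro compact_diff) (auto simp: unitD_eq_box)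
    then have C: "closed C" unfolding C_def
      by (intro compact_imp_closed compact_continuous_image continuous_circle_map)
    \<comment> \<open>The corner 0 keeps \<open>C\<close> nonempty. The distance to the empty set is
      0 by convention, and \<open>F\<close> would then vanish instead of tending to the
      indicator.\<close>
    have "(0 :: real^'d) \<in> cbox 0 1 - U \<inter> unitD" by (auto simp: unitD_def mem_box_cart)
    then have C0: "C \<noteq> {}" unfolding C_def by blast
    have mem: "circle_map x \<in> C \<longleftrightarrow> x \<notin> U" if "x \<in> unitD" for x
      unfolding C_def using circle_map_inj[OF that] that unitD_subset_cbox by blast
    \<comment> \<open>Continuous functions that vanish on the closed set \<open>C\<close> and
      increase to 1 off it.\<close>
    define F where "F m z = min 1 (real m * infdist z C)" for m z
    have Fc: "continuous_on UNIV (F m)" for m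
      unfolding F_def by (intro continuous_intros)
    have Fcc: "continuous_on UNIV (\<lambda>x. F m (circle_map x))" for m
      using continuous_on_compose2[OF Fc continuous_circle_map] by auto
    note [measurable] = continuous_measurable_cubeM[OF Fcc]
    have [measurable]: "U \<in> sets borel" using U by simp
    have "(\<lambda>m. \<integral>x. f x * F m (circle_map x) \<partial>cubeM) \<longlonglongrightarrow> (\<integral>x. f x * indicator U x \<partial>cubeM)"
    proof (rule integral_dominated_convergence[where w = "\<lambda>x. \<bar>f x\<bar>"])
      show "(\<lambda>x. f x * indicator U x) \<in> borel_measurable cubeM"
        by (intro borel_measurable_times borel_measurable_integrable[OF f] measurable_cubeM) simp
      show "(\<lambda>x. f x * F m (circle_map x)) \<in> borel_measurable cubeM" for m
        using f by measurable
      show "AE x in cubeM. norm (f x * F m (circle_map x)) \<le> \<bar>f x\<bar>" for m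
      proof (intro AE_I2)
        fix x
        have "0 \<le> F m (circle_map x)" "F m (circle_map x) \<le> 1"
          unfolding F_def by (auto simp: infdist_nonneg)
        then show "norm (f x * F m (circle_map x)) \<le> \<bar>f x\<bar>"
          by (simp add: abs_mult mult_left_le)
      qed
      show "AE x in cubeM. (\<lambda>m. f x * F m (circle_map x)) \<longlonglongrightarrow> f x * indicator U x"
      proof (intro AE_I2 tendsto_mult tendsto_const)
        fix x :: "real^'d" assume "x \<in> space cubeM"
        then have x: "x \<in> unitD" by simp
        show "(\<lambda>m. F m (circle_map x)) \<longlonglongrightarrow> indicator U x"
        proof (cases "x \<in> U")
          case True
          then have "circle_map x \<notin> C" using mem[OF x] by simp
          then have pos: "infdist (circle_map x) C > 0" using C C0 infdist_pos_not_in_closed by blast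
          obtain N :: nat where N: "1 / infdist (circle_map x) C < real N" using reals_Archimedean2 by blast
          have "F m (circle_map x) = 1" if "m \<ge> N" for m
          proof -
            have "1 / infdist (circle_map x) C < real m" using N that by linarith
            then show ?thesis using pos by (simp add: F_def pos_divide_less_eq)
          qed
          then have "(\<lambda>m. F m (circle_map x)) \<longlonglongrightarrow> 1"
            by (intro tendsto_eventually eventually_sequentiallyI[of N])
          then show ?thesis using True by simp
        next
          case False
          then have "infdist (circle_map x) C = 0" using mem[OF x] by simp
          then show ?thesis using False by (simp add: F_def)
        qed
      qed
    qed (use f in auto)
    then have "(\<lambda>m::nat. 0) \<longlonglongrightarrow> (\<integral>x. f x * indicator U x \<partial>cubeM)" using cont0[OF Fc] by simp
    then show ?thesis using LIMSEQ_unique tendsto_const by blast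
  qed
  have fm [measurable]: "f \<in> borel_measurable cubeM" using f by simp
  have ind [measurable]: "indicator A \<in> borel_measurable cubeM" if "A \<in> sets borel" for A :: "(real^'d) set"
    using that by (intro measurable_cubeM) simp
  have fi: "integrable cubeM (\<lambda>x. f x * indicator A x)" if A: "A \<in> sets borel" for A
    by (rule Bochner_Integration.integrable_bound[OF f borel_measurable_times[OF fm ind[OF A]]])
      (auto simp: indicator_def)
  \<comment> \<open>Dynkin's argument: open sets are stable under intersection and generate the
    Borel sets, so the vanishing of the integrals extends from open to all Borel sets.\<close>
  have stable: "Int_stable {S :: (real^'d) set. open S}" and sub: "{S :: (real^'d) set. open S} \<subseteq> Pow UNIV"
    by (auto simp: Int_stable_def)
  have borel0: "(\<integral>x. f x * indicator A x \<partial>cubeM) = 0" if "A \<in> sets borel" for A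
  proof -
    have "A \<in> sigma_sets UNIV {S :: (real^'d) set. open S}" using that by (simp add: sets_borel)
    with stable sub show ?thesis
    proof (induction rule: sigma_sets_induct_disjoint)
      case (basic A)
      then show ?case by (simp add: open0)
    next
      case empty
      show ?case by simp
    next
      case (compl A)
      then have A: "A \<in> sets borel" by (simp add: sets_borel)
      have "(\<integral>x. f x * indicator (UNIV - A) x \<partial>cubeM) = (\<integral>x. f x * indicator UNIV x - f x * indicator A x \<partial>cubeM)"
        by (intro Bochner_Integration.integral_cong) (auto simp: indicator_def)
      also have "\<dots> = 0" using fi[OF A] fi[of UNIV] compl open0[of UNIV] by simp
      finally show ?case .
    next
      case (union A)
      then have A: "A i \<in> sets borel" for i by (auto simp: sets_borel)
      have "(\<lambda>n. \<integral>x. f x * indicator (\<Union>i<n. A i) x \<partial>cubeM) \<longlonglongrightarrow> (\<integral>x. f x * indicator (\<Union>i. A i) x \<partial>cubeM)"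
      proof (rule integral_dominated_convergence[where w = "\<lambda>x. \<bar>f x\<bar>"])
        show "(\<lambda>x. f x * indicator (\<Union>i. A i) x) \<in> borel_measurable cubeM"
          by (intro borel_measurable_times ind fm sets.countable_UN) (use A in auto)
        show "(\<lambda>x. f x * indicator (\<Union>i<n. A i) x) \<in> borel_measurable cubeM" for n
          by (intro borel_measurable_times ind fm sets.countable_UN'') (use A in auto)
        show "AE x in cubeM. (\<lambda>n. f x * indicator (\<Union>i<n. A i) x) \<longlonglongrightarrow> f x * indicator (\<Union>i. A i) x"
          by (intro AE_I2 tendsto_mult tendsto_const LIMSEQ_indicator_UN)
      qed (use f in \<open>auto simp: indicator_def\<close>)
      moreover have "(\<integral>x. f x * indicator (\<Union>i<n. A i) x \<partial>cubeM) = 0" for n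
      proof -
        have "(\<integral>x. f x * indicator (\<Union>i<n. A i) x \<partial>cubeM) = (\<integral>x. (\<Sum>i<n. f x * indicator (A i) x) \<partial>cubeM)"
        proof (intro Bochner_Integration.integral_cong refl)
          fix x
          have "indicator (\<Union>i<n. A i) x = (\<Sum>i<n. indicator (A i) x :: real)"
            using union by (intro indicator_UN_disjoint) (auto intro: disjoint_family_on_mono)
          then show "f x * indicator (\<Union>i<n. A i) x = (\<Sum>i<n. f x * indicator (A i) x)"
            by (simp add: sum_distrib_left)
        qed
        also have "\<dots> = (\<Sum>i<n. \<integral>x. f x * indicator (A i) x \<partial>cubeM)"
          by (rule Bochner_Integration.integral_sum) (rule fi[OF A])
        also have "\<dots> = 0" using union by simp
        finally show ?thesis .
      qed
      ultimately show ?case using LIMSEQ_unique tendsto_const by (metis (no_types, lifting) ext)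
    qed
  qed
  show ?thesis
  proof (rule density_unique_real[OF f, where f' = "\<lambda>x. 0"])
    fix A :: "(real^'d) set" assume "A \<in> sets cubeM"
    then obtain A' where A': "A' \<in> sets borel" "A = unitD \<inter> A'" by (auto simp: cubeM_def sets_restrict_space)
    have "(\<integral>x\<in>A. f x \<partial>cubeM) = (\<integral>x. f x * indicator A' x \<partial>cubeM)"
      unfolding set_lebesgue_integral_def
      by (intro Bochner_Integration.integral_cong) (auto simp: A' indicator_def)
    then show "(\<integral>x\<in>A. f x \<partial>cubeM) = (\<integral>x\<in>A. 0 \<partial>cubeM)" using borel0 A' by (simp add: set_lebesgue_integral_def)
  qed simp
qed

subsection \<open>Weak gradients\<close>

text \<open>The L2 product fits the same abstract setting, which yields passage to the limit in
  integrals against a fixed function.\<close>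

lemma semi_inner_L2: "semi_inner {f. sqint M f} (\<lambda>f g. \<integral>x. f x * g x \<partial>M)"
proof
  fix u v w :: "'a \<Rightarrow> real" and a b :: real
  assume uvw: "u \<in> {f. sqint M f}" "v \<in> {f. sqint M f}" "w \<in> {f. sqint M f}"
  have "(\<integral>x. (a * u x + b * v x) * w x \<partial>M) = (\<integral>x. a * (u x * w x) + b * (v x * w x) \<partial>M)"
    by (simp add: algebra_simps)
  also have "\<dots> = a * (\<integral>x. u x * w x \<partial>M) + b * (\<integral>x. v x * w x \<partial>M)"
    using uvw by (simp add: sqint_mult_integrable)
  finally show "(\<integral>x. (a * u x + b * v x) * w x \<partial>M) = a * (\<integral>x. u x * w x \<partial>M) + b * (\<integral>x. v x * w x \<partial>M)" .
qed (auto simp: sqint_lincomb mult.commute)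

lemma tendsto_L2_integral:
  assumes "\<And>m. sqint M (f m)" "sqint M u" "sqint M v" "(\<lambda>m. \<integral>x. (f m x - u x)\<^sup>2 \<partial>M) \<longlonglongrightarrow> 0"
  shows "(\<lambda>m. \<integral>x. f m x * v x \<partial>M) \<longlonglongrightarrow> (\<integral>x. u x * v x \<partial>M)"
  using semi_inner.tendsto_B[OF semi_inner_L2, of f M u v] assms by (simp add: power2_eq_square)

lemma has_weak_grad_iff:
  "has_weak_grad u g \<longleftrightarrow> (\<forall>i. sqint cubeM (\<lambda>x. g x $ i)) \<and>
    (\<forall>\<phi> i. test_fun \<phi> \<longrightarrow> (\<integral>x. u x * pd i \<phi> x \<partial>cubeM) = - (\<integral>x. g x $ i * \<phi> x \<partial>cubeM))"
  unfolding has_weak_grad_def L2D_iff_sqint set_integral_unitD by blast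

lemma has_weak_gradD:
  assumes "has_weak_grad u g"
  shows "sqint cubeM (\<lambda>x. g x $ i)"
    and "test_fun \<phi> \<Longrightarrow> (\<integral>x. u x * pd i \<phi> x \<partial>cubeM) = - (\<integral>x. g x $ i * \<phi> x \<partial>cubeM)"
  using assms by (auto simp: has_weak_grad_iff)

lemma sqint_test_fun: "test_fun \<phi> \<Longrightarrow> sqint cubeM \<phi>"
  by (intro sqint_continuous test_fun_continuous)

text \<open>Waves are test functions, so the difference of the gradients is orthogonal to all of
  them. This makes the choice in \<open>wgrad\<close> harmless; letting \<open>u\<close> and
  \<open>v\<close> differ on a null set shows also that null functions have null gradients.\<close>

lemma weak_grad_unique:
  assumes g: "has_weak_grad u g" "has_weak_grad v h"
    and u: "sqint cubeM u" "sqint cubeM v" "AE x in cubeM. u x = v x"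
  shows "AE x in cubeM. g x = h x"
proof -
  have "AE x in cubeM. g x $ i - h x $ i = 0" for i
  proof (rule wave_complete)
    note s = has_weak_gradD(1)[OF g(1)] has_weak_gradD(1)[OF g(2)]
    show "integrable cubeM (\<lambda>x. g x $ i - h x $ i)"
      by (intro Bochner_Integration.integrable_diff sqint_integrable finite_measure_cubeM s)
    fix k :: "real^'a" and t assume k: "int_vec k"
    have tw: "test_fun (wave k t)" by (rule test_fun_wave[OF k])
    have sw: "sqint cubeM (wave k t)" "sqint cubeM (pd i (wave k t))"
      by (intro sqint_test_fun tw test_fun_pd)+
    have "(\<integral>x. u x * pd i (wave k t) x \<partial>cubeM) = (\<integral>x. v x * pd i (wave k t) x \<partial>cubeM)"
      by (rule integral_cong_AE) (use u sw in \<open>auto intro!: borel_measurable_times sqint_measurable\<close>)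
    then have "(\<integral>x. g x $ i * wave k t x \<partial>cubeM) = (\<integral>x. h x $ i * wave k t x \<partial>cubeM)"
      using has_weak_gradD(2)[OF g(1) tw] has_weak_gradD(2)[OF g(2) tw] by simp
    moreover have "(\<integral>x. (g x $ i - h x $ i) * wave k t x \<partial>cubeM) =
        (\<integral>x. g x $ i * wave k t x \<partial>cubeM) - (\<integral>x. h x $ i * wave k t x \<partial>cubeM)"
      by (simp add: left_diff_distrib sqint_mult_integrable s sw)
    ultimately show "(\<integral>x. (g x $ i - h x $ i) * wave k t x \<partial>cubeM) = 0" by simp
  qed
  then have "AE x in cubeM. \<forall>i. g x $ i - h x $ i = 0" by (simp add: AE_all_countable)
  then show ?thesis by eventually_elim (simp add: vec_eq_iff)
qed

lemma has_weak_grad_lincomb: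
  assumes u: "sqint cubeM u" "has_weak_grad u g" and v: "sqint cubeM v" "has_weak_grad v h"
  shows "has_weak_grad (\<lambda>x. a * u x + b * v x) (\<lambda>x. a *\<^sub>R g x + b *\<^sub>R h x)"
  unfolding has_weak_grad_iff
proof (intro conjI allI impI)
  note s = has_weak_gradD(1)[OF u(2)] has_weak_gradD(1)[OF v(2)]
  show "sqint cubeM (\<lambda>x. (a *\<^sub>R g x + b *\<^sub>R h x) $ i)" for i
    by (simp add: sqint_lincomb s)
  fix \<phi> :: "real^'a \<Rightarrow> real" and i assume \<phi>: "test_fun \<phi>"
  have sw: "sqint cubeM \<phi>" "sqint cubeM (pd i \<phi>)" by (intro sqint_test_fun \<phi> test_fun_pd)+
  have "(\<integral>x. (a * u x + b * v x) * pd i \<phi> x \<partial>cubeM)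
      = a * (\<integral>x. u x * pd i \<phi> x \<partial>cubeM) + b * (\<integral>x. v x * pd i \<phi> x \<partial>cubeM)"
    using semi_inner.B_lin[OF semi_inner_L2, of u cubeM v "pd i \<phi>" a b] u v sw by simp
  moreover have "(\<integral>x. (a * g x $ i + b * h x $ i) * \<phi> x \<partial>cubeM)
      = a * (\<integral>x. g x $ i * \<phi> x \<partial>cubeM) + b * (\<integral>x. h x $ i * \<phi> x \<partial>cubeM)"
    using semi_inner.B_lin[OF semi_inner_L2, of "\<lambda>x. g x $ i" cubeM "\<lambda>x. h x $ i" "\<phi>" a b] s sw by simp
  ultimately show "(\<integral>x. (a * u x + b * v x) * pd i \<phi> x \<partial>cubeM)
      = - (\<integral>x. (a *\<^sub>R g x + b *\<^sub>R h x) $ i * \<phi> x \<partial>cubeM)"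
    using has_weak_gradD(2)[OF u(2) \<phi>] has_weak_gradD(2)[OF v(2) \<phi>] by simp
qed

section \<open>The space \<open>H1per\<close> and its chosen gradient\<close>

lemma H1per_iff: "H1per u \<longleftrightarrow> sqint cubeM u \<and> (\<exists>g. has_weak_grad u g)"
  by (simp add: H1per_def L2D_iff_sqint)

lemma H1perI: "sqint cubeM u \<Longrightarrow> has_weak_grad u g \<Longrightarrow> H1per u"
  by (auto simp: H1per_iff)

lemma H1per_sqint: "H1per u \<Longrightarrow> sqint cubeM u"
  by (simp add: H1per_iff)

lemma H1per_wgrad: "H1per u \<Longrightarrow> has_weak_grad u (wgrad u)"
  using someI_ex[of "has_weak_grad u"] unfolding wgrad_def H1per_iff by blast

lemma H1per_wgrad_sqint: "H1per u \<Longrightarrow> sqint cubeM (\<lambda>x. wgrad u x $ i)"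
  using has_weak_gradD(1)[OF H1per_wgrad] .

lemma wgrad_AE_eq:
  assumes "sqint cubeM u" "has_weak_grad u g"
  shows "AE x in cubeM. wgrad u x = g x"
  using weak_grad_unique[OF H1per_wgrad[OF H1perI[OF assms]] assms(2) assms(1) assms(1)] by simp

lemma H1per_lincomb: "H1per u \<Longrightarrow> H1per v \<Longrightarrow> H1per (\<lambda>x. a * u x + b * v x)"
  by (rule H1perI[OF sqint_lincomb has_weak_grad_lincomb]) (auto intro: H1per_sqint H1per_wgrad)

lemma wgrad_lincomb:
  assumes "H1per u" "H1per v"
  shows "AE x in cubeM. wgrad (\<lambda>x. a * u x + b * v x) x = a *\<^sub>R wgrad u x + b *\<^sub>R wgrad v x"
  using assms by (intro wgrad_AE_eq has_weak_grad_lincomb sqint_lincomb H1per_sqint H1per_wgrad)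

lemma H1per_diff: "H1per u \<Longrightarrow> H1per v \<Longrightarrow> H1per (\<lambda>x. u x - v x)"
  using H1per_lincomb[of u v 1 "-1"] by simp

lemma wgrad_sum:
  assumes "finite I" "I \<noteq> {}" "\<And>i. i \<in> I \<Longrightarrow> H1per (w i)"
  shows "H1per (\<lambda>x. \<Sum>i\<in>I. w i x) \<and> (AE x in cubeM. wgrad (\<lambda>x. \<Sum>i\<in>I. w i x) x = (\<Sum>i\<in>I. wgrad (w i) x))"
  using assms
proof (induction rule: finite_ne_induct)
  case (insert i F)
  then have IH: "H1per (\<lambda>x. \<Sum>i\<in>F. w i x)" "AE x in cubeM. wgrad (\<lambda>x. \<Sum>i\<in>F. w i x) x = (\<Sum>i\<in>F. wgrad (w i) x)"
    by auto
  have "AE x in cubeM. wgrad (\<lambda>x. 1 * w i x + 1 * (\<Sum>i\<in>F. w i x)) x = 1 *\<^sub>R wgrad (w i) x + 1 *\<^sub>R wgrad (\<lambda>x. \<Sum>i\<in>F. w i x) x"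
    by (rule wgrad_lincomb) (use insert IH in auto)
  then have "AE x in cubeM. wgrad (\<lambda>x. \<Sum>i\<in>insert i F. w i x) x = (\<Sum>i\<in>insert i F. wgrad (w i) x)"
    using IH(2) by eventually_elim (use insert.hyps in simp)
  moreover have "H1per (\<lambda>x. \<Sum>i\<in>insert i F. w i x)"
    using H1per_lincomb[of "w i" "\<lambda>x. \<Sum>i\<in>F. w i x" 1 1] insert IH by simp
  ultimately show ?case by blast
qed auto

subsection \<open>The bilinear form\<close>

text \<open>Covers \<open>V\<close> as well as the constant 1, so the H1 inner product is the energy
  form with coefficient 1 and every lemma serves both.\<close>

definition bounded_coeff :: "real \<Rightarrow> (real^'d::finite \<Rightarrow> real) \<Rightarrow> bool" where
  "bounded_coeff C V \<longleftrightarrow> V \<in> borel_measurable cubeM \<and> (AE x in cubeM. 0 \<le> V x \<and> V x \<le> C)"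

lemma bounded_coeff_one: "bounded_coeff 1 (\<lambda>x. 1)"
  by (simp add: bounded_coeff_def)

lemma integrable_inner_grad:
  assumes "\<And>i. sqint cubeM (\<lambda>x. g x $ i)" "\<And>i. sqint cubeM (\<lambda>x. h x $ i)"
  shows "integrable cubeM (\<lambda>x. g x \<bullet> (h x :: real^'d::finite))"
  unfolding inner_vec_def by (auto intro!: sqint_mult_integrable assms)

lemma integrable_coeff:
  assumes "bounded_coeff C V" "sqint cubeM u" "sqint cubeM v"
  shows "integrable cubeM (\<lambda>x. V x * u x * v x)"
proof -
  have "AE x in cubeM. \<bar>V x\<bar> \<le> C" using assms(1) unfolding bounded_coeff_def by auto
  then have "sqint cubeM (\<lambda>x. V x * u x)"
    using assms by (intro sqint_bounded_mult[where C = C]) (auto simp: bounded_coeff_def)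
  from sqint_mult_integrable[OF this assms(3)] show ?thesis .
qed

lemma aform_cubeM: "aform V u v = (\<integral>x. wgrad u x \<bullet> wgrad v x + V x * u x * v x \<partial>cubeM)"
  unfolding aform_def by (rule set_integral_unitD)

lemma aform_integrable:
  assumes "bounded_coeff C V" "H1per u" "H1per v"
  shows "integrable cubeM (\<lambda>x. wgrad u x \<bullet> wgrad v x + V x * u x * v x)"
  using assms by (intro Bochner_Integration.integrable_add integrable_inner_grad integrable_coeff[OF assms(1)])
    (auto intro: H1per_wgrad_sqint H1per_sqint)

text \<open>Lets any weak gradient stand in for the chosen one, in particular the classical gradient
  of a test function.\<close>

lemma aform_AE_eq:
  assumes V: "bounded_coeff C V" and u: "sqint cubeM u" "has_weak_grad u g" and v: "sqint cubeM v" "has_weak_grad v h"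
  shows "aform V u v = (\<integral>x. g x \<bullet> h x \<partial>cubeM) + (\<integral>x. V x * u x * v x \<partial>cubeM)"
proof -
  have H: "H1per u" "H1per v" using H1perI u v by auto
  note ig = integrable_inner_grad[OF has_weak_gradD(1)[OF u(2)] has_weak_gradD(1)[OF v(2)]]
  have "AE x in cubeM. wgrad u x \<bullet> wgrad v x + V x * u x * v x = g x \<bullet> h x + V x * u x * v x"
    using wgrad_AE_eq[OF u] wgrad_AE_eq[OF v] by eventually_elim simp
  then have "aform V u v = (\<integral>x. g x \<bullet> h x + V x * u x * v x \<partial>cubeM)"
    unfolding aform_cubeM
    by (rule integral_cong_AE[rotated 2])
      (use aform_integrable[OF V H] ig integrable_coeff[OF V u(1) v(1)] in
        \<open>auto intro!: borel_measurable_integrable Bochner_Integration.integrable_add\<close>)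
  also have "\<dots> = (\<integral>x. g x \<bullet> h x \<partial>cubeM) + (\<integral>x. V x * u x * v x \<partial>cubeM)"
    by (intro Bochner_Integration.integral_add ig integrable_coeff[OF V] u v)
  finally show ?thesis .
qed

lemma semi_inner_aform:
  assumes V: "bounded_coeff C V"
  shows "semi_inner {u. H1per u} (aform V)"
proof
  fix u v :: "real^'a \<Rightarrow> real" and a b :: real
  assume "u \<in> {u. H1per u}" "v \<in> {u. H1per u}"
  then have uv: "H1per u" "H1per v" by auto
  show "(\<lambda>x. a * u x + b * v x) \<in> {u. H1per u}" using uv by (simp add: H1per_lincomb)
  show "aform V u v = aform V v u" by (simp add: aform_cubeM inner_commute mult.assoc mult.left_commute mult.commute)
  fix w :: "real^'a \<Rightarrow> real" assume "w \<in> {u. H1per u}"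
  then have w: "H1per w" by simp
  have "AE x in cubeM. wgrad (\<lambda>x. a * u x + b * v x) x \<bullet> wgrad w x + V x * (a * u x + b * v x) * w x
      = a * (wgrad u x \<bullet> wgrad w x + V x * u x * w x) + b * (wgrad v x \<bullet> wgrad w x + V x * v x * w x)"
    using wgrad_lincomb[OF uv, of a b] by eventually_elim (simp add: inner_add_left algebra_simps)
  then have "aform V (\<lambda>x. a * u x + b * v x) w
      = (\<integral>x. a * (wgrad u x \<bullet> wgrad w x + V x * u x * w x) + b * (wgrad v x \<bullet> wgrad w x + V x * v x * w x) \<partial>cubeM)"
    unfolding aform_cubeM
    by (rule integral_cong_AE[rotated 2])
      (intro borel_measurable_integrable[OF aform_integrable[OF V H1per_lincomb[OF uv] w]]
        borel_measurable_integrable Bochner_Integration.integrable_add integrable_mult_right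
        aform_integrable[OF V uv(1) w] aform_integrable[OF V uv(2) w])+
  also have "\<dots> = a * aform V u w + b * aform V v w"
    unfolding aform_cubeM using aform_integrable[OF V] uv w by simp
  finally show "aform V (\<lambda>x. a * u x + b * v x) w = a * aform V u w + b * aform V v w" .
next
  fix u :: "real^'a \<Rightarrow> real"
  have "AE x in cubeM. 0 \<le> wgrad u x \<bullet> wgrad u x + V x * u x * u x"
    using V unfolding bounded_coeff_def by (auto simp: mult.assoc)
  then show "0 \<le> aform V u u" unfolding aform_cubeM by (rule integral_nonneg_AE)
qed

section \<open>The H1 norm as an energy, and completeness\<close>

lemma h1sq_eq_aform: "h1sq u = aform (\<lambda>x. 1) u u"
  unfolding h1sq_def set_integral_unitD aform_cubeM by (simp add: power2_eq_square add.commute)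

lemma semi_inner_h1: "semi_inner {u. H1per u} (aform (\<lambda>x. 1))"
  by (rule semi_inner_aform[OF bounded_coeff_one])

lemma h1sq_eq:
  assumes "sqint cubeM u" "has_weak_grad u g"
  shows "h1sq u = (\<integral>x. (u x)\<^sup>2 \<partial>cubeM) + (\<Sum>i\<in>UNIV. \<integral>x. (g x $ i)\<^sup>2 \<partial>cubeM)"
proof -
  have "(\<integral>x. g x \<bullet> g x \<partial>cubeM) = (\<Sum>i\<in>UNIV. \<integral>x. (g x $ i)\<^sup>2 \<partial>cubeM)"
    unfolding inner_vec_def using has_weak_gradD(1)[OF assms(2)]
    by (subst Bochner_Integration.integral_sum) (auto simp: sqint_def power2_eq_square)
  then show ?thesis
    unfolding h1sq_eq_aform aform_AE_eq[OF bounded_coeff_one assms assms] by (simp add: power2_eq_square)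
qed

lemma h1sq_zero: "h1sq (\<lambda>x :: real^'d::finite. 0) = 0"
proof -
  have "has_weak_grad (\<lambda>x :: real^'d. 0) (\<lambda>x. 0)" by (simp add: has_weak_grad_iff sqint_zero)
  from h1sq_eq[OF sqint_zero this] show ?thesis by simp
qed

lemma h1sq_nonneg: "0 \<le> h1sq u"
  unfolding h1sq_def set_integral_unitD by (intro Bochner_Integration.integral_nonneg) auto

lemma aform_le_h1sq:
  assumes V: "bounded_coeff C V" and u: "H1per u"
  shows "aform V u u \<le> max 1 C * h1sq u"
proof -
  have "aform V u u \<le> (\<integral>x. max 1 C * (wgrad u x \<bullet> wgrad u x + 1 * u x * u x) \<partial>cubeM)"
    unfolding aform_cubeM
  proof (rule integral_mono_AE)
    show "AE x in cubeM. wgrad u x \<bullet> wgrad u x + V x * u x * u x \<le> max 1 C * (wgrad u x \<bullet> wgrad u x + 1 * u x * u x)"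
      using V[unfolded bounded_coeff_def, THEN conjunct2]
    proof eventually_elim
      case (elim x)
      have "1 * (wgrad u x \<bullet> wgrad u x) \<le> max 1 C * (wgrad u x \<bullet> wgrad u x)"
        by (intro mult_right_mono) auto
      moreover have "V x * (u x * u x) \<le> max 1 C * (u x * u x)"
        using elim by (intro mult_right_mono) auto
      ultimately show ?case by (simp add: distrib_left mult.assoc)
    qed
  qed (use aform_integrable[OF V u u] aform_integrable[OF bounded_coeff_one u u] in auto)
  also have "\<dots> = max 1 C * h1sq u" unfolding h1sq_eq_aform aform_cubeM by simp
  finally show ?thesis .
qed

text \<open>The factors 2 come from the parallelogram identity after dropping the energy of the
  difference of the two increments.\<close>

lemma h1_triangle:
  assumes "H1per u" "H1per v" "H1per w"
  shows "h1sq (\<lambda>x. u x - w x) \<le> 2 * h1sq (\<lambda>x. u x - v x) + 2 * h1sq (\<lambda>x. v x - w x)"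
proof -
  interpret semi_inner "{u. H1per u}" "aform (\<lambda>x. 1)" by (rule semi_inner_h1)
  let ?p = "\<lambda>x. u x - v x" and ?q = "\<lambda>x. v x - w x"
  have H: "?p \<in> {u. H1per u}" "?q \<in> {u. H1per u}" using assms by (auto intro: H1per_diff)
  have "0 \<le> h1sq ?p - 2 * aform (\<lambda>x. 1) ?p ?q + h1sq ?q"
    using B_nonneg[OF H_diff[OF H]] B_quad[OF H, of 1 "-1"] by (simp add: h1sq_eq_aform)
  moreover have "h1sq (\<lambda>x. u x - w x) = h1sq ?p + 2 * aform (\<lambda>x. 1) ?p ?q + h1sq ?q"
    using B_quad[OF H, of 1 1] by (simp add: h1sq_eq_aform)
  ultimately show ?thesis by simp
qed

text \<open>The weak gradient is a closed operator: in its defining identity the test function is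
  fixed, so both integrals follow the L2 limits.\<close>

lemma h1_limit:
  assumes f: "\<And>m. sqint cubeM (f m)" "\<And>m. has_weak_grad (f m) (g m)"
    and u: "sqint cubeM u" "\<And>i. sqint cubeM (\<lambda>x. G x $ i)"
    and lim: "(\<lambda>m. \<integral>x. (f m x - u x)\<^sup>2 \<partial>cubeM) \<longlonglongrightarrow> 0"
      "\<And>i. (\<lambda>m. \<integral>x. (g m x $ i - G x $ i)\<^sup>2 \<partial>cubeM) \<longlonglongrightarrow> 0"
  shows "has_weak_grad u G" "(\<lambda>m. h1sq (\<lambda>x. f m x - u x)) \<longlonglongrightarrow> 0"
proof -
  show *: "has_weak_grad u G"
    unfolding has_weak_grad_iff
  proof (intro conjI allI impI u)
    fix \<phi> :: "real^'a \<Rightarrow> real" and i assume \<phi>: "test_fun \<phi>"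
    have "(\<lambda>m. \<integral>x. f m x * pd i \<phi> x \<partial>cubeM) \<longlonglongrightarrow> (\<integral>x. u x * pd i \<phi> x \<partial>cubeM)"
      by (intro tendsto_L2_integral f u lim sqint_test_fun test_fun_pd \<phi>)
    moreover have "(\<lambda>m. - (\<integral>x. g m x $ i * \<phi> x \<partial>cubeM)) \<longlonglongrightarrow> - (\<integral>x. G x $ i * \<phi> x \<partial>cubeM)"
      by (intro tendsto_minus tendsto_L2_integral has_weak_gradD(1)[OF f(2)] u lim sqint_test_fun \<phi>)
    ultimately show "(\<integral>x. u x * pd i \<phi> x \<partial>cubeM) = - (\<integral>x. G x $ i * \<phi> x \<partial>cubeM)"
      using has_weak_gradD(2)[OF f(2) \<phi>] by (simp add: LIMSEQ_unique)
  qed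
  have "h1sq (\<lambda>x. f m x - u x) = (\<integral>x. (f m x - u x)\<^sup>2 \<partial>cubeM) + (\<Sum>i\<in>UNIV. \<integral>x. (g m x $ i - G x $ i)\<^sup>2 \<partial>cubeM)" for m
    using h1sq_eq[OF sqint_lincomb[OF f(1) u(1)] has_weak_grad_lincomb[OF f(1) f(2) u(1) *], of 1 m "-1"] by simp
  then show "(\<lambda>m. h1sq (\<lambda>x. f m x - u x)) \<longlonglongrightarrow> 0"
    using tendsto_add[OF lim(1) tendsto_sum[where I = UNIV, OF lim(2)]] by simp
qed

text \<open>The function and the components of its gradient converge separately in L2;
  \<open>h1_limit\<close> recognises the limit of the gradients as the gradient of the
  limit.\<close>

lemma H1_complete:
  fixes w :: "nat \<Rightarrow> real^'d::finite \<Rightarrow> real"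
  assumes w: "\<And>m. H1per (w m)"
    and C: "\<And>e. e > 0 \<Longrightarrow> \<exists>N. \<forall>m\<ge>N. \<forall>n\<ge>N. h1sq (\<lambda>x. w m x - w n x) < e"
  shows "\<exists>u. H1per u \<and> (\<lambda>m. h1sq (\<lambda>x. w m x - u x)) \<longlonglongrightarrow> 0"
proof -
  have h: "h1sq (\<lambda>x. w m x - w n x) = (\<integral>x. (w m x - w n x)\<^sup>2 \<partial>cubeM)
      + (\<Sum>i\<in>UNIV. \<integral>x. (wgrad (w m) x $ i - wgrad (w n) x $ i)\<^sup>2 \<partial>cubeM)" for m n
    using h1sq_eq[OF sqint_lincomb[OF H1per_sqint[OF w] H1per_sqint[OF w]]
      has_weak_grad_lincomb[OF H1per_sqint[OF w] H1per_wgrad[OF w] H1per_sqint[OF w] H1per_wgrad[OF w]], of 1 m "-1" n]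
    by simp
  have le1: "(\<integral>x. (w m x - w n x)\<^sup>2 \<partial>cubeM) \<le> h1sq (\<lambda>x. w m x - w n x)" for m n
    unfolding h by (simp add: sum_nonneg)
  have le2: "(\<integral>x. (wgrad (w m) x $ i - wgrad (w n) x $ i)\<^sup>2 \<partial>cubeM) \<le> h1sq (\<lambda>x. w m x - w n x)" for m n i
    unfolding h by (intro add_increasing member_le_sum) auto
  have Cle: "\<exists>N. \<forall>m\<ge>N. \<forall>n\<ge>N. X m n < e"
    if "\<And>m n. X m n \<le> h1sq (\<lambda>x. w m x - w n x)" "e > 0" for X and e :: real
    using C[OF that(2)] le_less_trans[OF that(1)] by meson
  have "\<exists>u. sqint cubeM u \<and> (\<lambda>m. \<integral>x. (w m x - u x)\<^sup>2 \<partial>cubeM) \<longlonglongrightarrow> 0"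
    by (rule L2_complete[OF H1per_sqint[OF w]]) (rule Cle[OF le1])
  then obtain u where u: "sqint cubeM u" "(\<lambda>m. \<integral>x. (w m x - u x)\<^sup>2 \<partial>cubeM) \<longlonglongrightarrow> 0" by blast
  have "\<exists>G. sqint cubeM G \<and> (\<lambda>m. \<integral>x. (wgrad (w m) x $ i - G x)\<^sup>2 \<partial>cubeM) \<longlonglongrightarrow> 0" for i
    by (rule L2_complete[OF H1per_wgrad_sqint[OF w]]) (rule Cle[OF le2])
  then have "\<forall>i. \<exists>G. sqint cubeM G \<and> (\<lambda>m. \<integral>x. (wgrad (w m) x $ i - G x)\<^sup>2 \<partial>cubeM) \<longlonglongrightarrow> 0" by blast
  from choice[OF this] obtain G where G: "\<And>i. sqint cubeM (G i)" "\<And>i. (\<lambda>m. \<integral>x. (wgrad (w m) x $ i - G i x)\<^sup>2 \<partial>cubeM) \<longlonglongrightarrow> 0"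
    by blast
  note lim = h1_limit[of w "\<lambda>m. wgrad (w m)" u "\<lambda>x. \<chi> i. G i x", OF H1per_sqint[OF w] H1per_wgrad[OF w] u(1)]
  show ?thesis using lim u G H1perI[OF u(1)] by auto
qed

subsection \<open>Closed subspaces\<close>

text \<open>One notion for two purposes: \<open>Vz\<close> is the closure of the local test
  functions, and density means that the closure of all test functions exhausts
  \<open>H1per\<close>.\<close>

definition H1_closure :: "(real^'d::finite \<Rightarrow> real) set \<Rightarrow> (real^'d \<Rightarrow> real) set" where
  "H1_closure T = {u. H1per u \<and> (\<exists>\<phi>. (\<forall>m. \<phi> m \<in> T) \<and> (\<lambda>m. h1sq (\<lambda>x. \<phi> m x - u x)) \<longlonglongrightarrow> 0)}"

lemma H1_closure_H1per: "u \<in> H1_closure T \<Longrightarrow> H1per u"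
  by (simp add: H1_closure_def)

text \<open>The epsilon form spares a diagonal sequence when the closure is shown to be
  closed.\<close>

lemma H1_closure_iff:
  "u \<in> H1_closure T \<longleftrightarrow> H1per u \<and> (\<forall>e>0. \<exists>\<phi>\<in>T. h1sq (\<lambda>x. \<phi> x - u x) < e)"
proof (intro iffI conjI allI impI)
  fix e :: real assume u: "u \<in> H1_closure T" and "e > 0"
  then obtain \<phi> where \<phi>: "\<And>m. \<phi> m \<in> T" "(\<lambda>m. h1sq (\<lambda>x. \<phi> m x - u x)) \<longlonglongrightarrow> 0"
    by (auto simp: H1_closure_def)
  from order_tendstoD(2)[OF \<phi>(2) \<open>e > 0\<close>] show "\<exists>\<phi>\<in>T. h1sq (\<lambda>x. \<phi> x - u x) < e"
    using \<phi>(1) by (auto simp: eventually_sequentially)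
next
  assume u: "H1per u \<and> (\<forall>e>0. \<exists>\<phi>\<in>T. h1sq (\<lambda>x. \<phi> x - u x) < e)"
  then have "\<exists>\<phi>\<in>T. h1sq (\<lambda>x. \<phi> x - u x) < 1 / (real m + 1)" for m :: nat by simp
  then obtain \<phi> where \<phi>: "\<And>m. \<phi> m \<in> T" "\<And>m. h1sq (\<lambda>x. \<phi> m x - u x) < 1 / (real m + 1)" by metis
  have "(\<lambda>m. h1sq (\<lambda>x. \<phi> m x - u x)) \<longlonglongrightarrow> 0"
  proof (rule tendsto_sandwich[OF _ _ tendsto_const])
    show "(\<lambda>m. 1 / (real m + 1)) \<longlonglongrightarrow> 0"
      using LIMSEQ_inverse_real_of_nat by (simp add: inverse_eq_divide add.commute)
  qed (auto intro!: always_eventually h1sq_nonneg less_imp_le \<phi>)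
  then show "u \<in> H1_closure T" using u \<phi>(1) unfolding H1_closure_def by blast
qed (auto simp: H1_closure_H1per)

lemma H1_closure_closed:
  assumes T: "\<And>\<phi>. \<phi> \<in> T \<Longrightarrow> H1per \<phi>" and w: "\<And>m. w m \<in> H1_closure T" and u: "H1per u"
    and lim: "(\<lambda>m. h1sq (\<lambda>x. w m x - u x)) \<longlonglongrightarrow> 0"
  shows "u \<in> H1_closure T"
  unfolding H1_closure_iff
proof (intro conjI u allI impI)
  fix e :: real assume "e > 0"
  then have e4: "e / 4 > 0" by simp
  from order_tendstoD(2)[OF lim e4] obtain m where m: "h1sq (\<lambda>x. w m x - u x) < e / 4"
    by (auto simp: eventually_sequentially)
  from w[of m] e4 obtain \<phi> where \<phi>: "\<phi> \<in> T" "h1sq (\<lambda>x. \<phi> x - w m x) < e / 4"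
    unfolding H1_closure_iff by blast
  have "h1sq (\<lambda>x. \<phi> x - u x) < e"
    using h1_triangle[OF T[OF \<phi>(1)] H1_closure_H1per[OF w[of m]] u] m \<phi>(2) by linarith
  then show "\<exists>\<phi>\<in>T. h1sq (\<lambda>x. \<phi> x - u x) < e" using \<phi>(1) by blast
qed

lemma H1_closure_lincomb:
  assumes T: "\<And>\<phi>. \<phi> \<in> T \<Longrightarrow> H1per \<phi>"
    and lin: "\<And>\<phi> \<psi> a b. \<phi> \<in> T \<Longrightarrow> \<psi> \<in> T \<Longrightarrow> (\<lambda>x. a * \<phi> x + b * \<psi> x) \<in> T"
    and uv: "u \<in> H1_closure T" "v \<in> H1_closure T"
  shows "(\<lambda>x. a * u x + b * v x) \<in> H1_closure T"
proof -
  interpret semi_inner "{u. H1per u}" "aform (\<lambda>x. 1)" by (rule semi_inner_h1)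
  obtain \<phi> \<psi> where \<phi>: "\<And>m. \<phi> m \<in> T" "(\<lambda>m. h1sq (\<lambda>x. \<phi> m x - u x)) \<longlonglongrightarrow> 0"
    and \<psi>: "\<And>m. \<psi> m \<in> T" "(\<lambda>m. h1sq (\<lambda>x. \<psi> m x - v x)) \<longlonglongrightarrow> 0"
    using uv unfolding H1_closure_def by blast
  have H: "H1per u" "H1per v" using uv by (auto intro: H1_closure_H1per)
  have "(\<lambda>m. h1sq (\<lambda>x. (a * \<phi> m x + b * \<psi> m x) - (a * u x + b * v x))) \<longlonglongrightarrow> 0"
  proof (rule tendsto_sandwich[OF _ _ tendsto_const])
    show "(\<lambda>m. 2 * a\<^sup>2 * h1sq (\<lambda>x. \<phi> m x - u x) + 2 * b\<^sup>2 * h1sq (\<lambda>x. \<psi> m x - v x)) \<longlonglongrightarrow> 0"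
      using tendsto_add[OF tendsto_mult_right_zero[OF \<phi>(2)] tendsto_mult_right_zero[OF \<psi>(2)]] by simp
    show "\<forall>\<^sub>F m in sequentially. h1sq (\<lambda>x. (a * \<phi> m x + b * \<psi> m x) - (a * u x + b * v x))
        \<le> 2 * a\<^sup>2 * h1sq (\<lambda>x. \<phi> m x - u x) + 2 * b\<^sup>2 * h1sq (\<lambda>x. \<psi> m x - v x)"
    proof (intro always_eventually allI)
      fix m
      let ?p = "\<lambda>x. \<phi> m x - u x" and ?q = "\<lambda>x. \<psi> m x - v x"
      have pq: "?p \<in> {u. H1per u}" "?q \<in> {u. H1per u}" using T \<phi>(1) \<psi>(1) H by (auto intro: H1per_diff)
      have "0 \<le> a\<^sup>2 * h1sq ?p - 2 * a * b * aform (\<lambda>x. 1) ?p ?q + b\<^sup>2 * h1sq ?q"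
        using B_nonneg[OF H_lin[OF pq, of a "-b"]] B_quad[OF pq, of a "-b"] by (simp add: h1sq_eq_aform)
      moreover have "h1sq (\<lambda>x. (a * \<phi> m x + b * \<psi> m x) - (a * u x + b * v x))
          = a\<^sup>2 * h1sq ?p + 2 * a * b * aform (\<lambda>x. 1) ?p ?q + b\<^sup>2 * h1sq ?q"
        using B_quad[OF pq, of a b] by (simp add: h1sq_eq_aform algebra_simps)
      ultimately show "h1sq (\<lambda>x. (a * \<phi> m x + b * \<psi> m x) - (a * u x + b * v x))
          \<le> 2 * a\<^sup>2 * h1sq ?p + 2 * b\<^sup>2 * h1sq ?q" by linarith
    qed
  qed (auto intro!: always_eventually h1sq_nonneg)
  then show ?thesis
    unfolding H1_closure_def using H1per_lincomb[OF H] lin[OF \<phi>(1) \<psi>(1)]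
    by (auto intro!: exI[of _ "\<lambda>m x. a * \<phi> m x + b * \<psi> m x"])
qed

text \<open>Coercivity turns a Cauchy sequence for the energy into one for H1, and the bound on
  \<open>V\<close> turns H1 convergence back into energy convergence; so the closure is complete for
  the energy.\<close>

lemma H1_closure_projection:
  assumes V: "bounded_coeff C V"
    and coercive: "\<And>u. H1per u \<Longrightarrow> h1sq u \<le> K * aform V u u"
    and T: "\<And>\<phi>. \<phi> \<in> T \<Longrightarrow> H1per \<phi>" "T \<noteq> {}"
    and lin: "\<And>\<phi> \<psi> a b. \<phi> \<in> T \<Longrightarrow> \<psi> \<in> T \<Longrightarrow> (\<lambda>x. a * \<phi> x + b * \<psi> x) \<in> T"
    and u: "H1per u"
  shows "\<exists>p\<in>H1_closure T. \<forall>v\<in>H1_closure T. aform V p v = aform V u v"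
proof -
  interpret semi_inner "{u. H1per u}" "aform V" by (rule semi_inner_aform[OF V])
  show ?thesis
  proof (rule ex_projection)
    show "H1_closure T \<subseteq> {u. H1per u}" by (auto intro: H1_closure_H1per)
    obtain \<phi> where "\<phi> \<in> T" using T(2) by blast
    then have "\<phi> \<in> H1_closure T"
      unfolding H1_closure_def using T(1) by (auto intro!: exI[of _ "\<lambda>_. \<phi>"] simp: h1sq_zero)
    then show "H1_closure T \<noteq> {}" by blast
    show "\<exists>l\<in>H1_closure T. (\<lambda>m. aform V (\<lambda>x. w m x - l x) (\<lambda>x. w m x - l x)) \<longlonglongrightarrow> 0"
      if w: "\<And>m. w m \<in> H1_closure T"
        and Cy: "\<And>e. e > 0 \<Longrightarrow> \<exists>N. \<forall>m\<ge>N. \<forall>n\<ge>N. aform V (\<lambda>x. w m x - w n x) (\<lambda>x. w m x - w n x) < e" for w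
    proof -
      have wH: "H1per (w m)" for m using w by (rule H1_closure_H1per)
      have "\<exists>l. H1per l \<and> (\<lambda>m. h1sq (\<lambda>x. w m x - l x)) \<longlonglongrightarrow> 0"
      proof (rule H1_complete[OF wH])
        fix e :: real assume e: "e > 0"
        \<comment> \<open>\<open>K\<close> comes without a sign, so the positive number
          \<open>\<bar>K\<bar> + 1\<close> takes its place.\<close>
        define e' where "e' = e / (\<bar>K\<bar> + 1)"
        have "e' > 0" using e by (simp add: e'_def add_nonneg_pos)
        from Cy[OF this] obtain N where N: "\<And>m n. m \<ge> N \<Longrightarrow> n \<ge> N \<Longrightarrow> aform V (\<lambda>x. w m x - w n x) (\<lambda>x. w m x - w n x) < e'"
          by blast
        have "h1sq (\<lambda>x. w m x - w n x) < e" if "m \<ge> N" "n \<ge> N" for m n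
        proof -
          let ?a = "aform V (\<lambda>x. w m x - w n x) (\<lambda>x. w m x - w n x)"
          have a0: "?a \<ge> 0" using wH by (intro B_nonneg) (auto intro: H1per_diff)
          have "h1sq (\<lambda>x. w m x - w n x) \<le> K * ?a" by (intro coercive H1per_diff wH)
          also have "\<dots> \<le> (\<bar>K\<bar> + 1) * ?a" using a0 by (intro mult_right_mono) auto
          also have "\<dots> < (\<bar>K\<bar> + 1) * e'" using N[OF that] by (intro mult_strict_left_mono) (auto simp: add_nonneg_pos)
          also have "\<dots> = e" unfolding e'_def by (simp add: add_nonneg_pos less_imp_neq[symmetric])
          finally show ?thesis .
        qed
        then show "\<exists>N. \<forall>m\<ge>N. \<forall>n\<ge>N. h1sq (\<lambda>x. w m x - w n x) < e" by blast
      qed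
      then obtain l where l: "H1per l" "(\<lambda>m. h1sq (\<lambda>x. w m x - l x)) \<longlonglongrightarrow> 0" by blast
      have "(\<lambda>m. aform V (\<lambda>x. w m x - l x) (\<lambda>x. w m x - l x)) \<longlonglongrightarrow> 0"
      proof (rule tendsto_sandwich[OF _ _ tendsto_const])
        show "(\<lambda>m. max 1 C * h1sq (\<lambda>x. w m x - l x)) \<longlonglongrightarrow> 0"
          using tendsto_mult_right_zero[OF l(2)] .
      qed (auto intro!: always_eventually B_nonneg aform_le_h1sq[OF V] H1per_diff wH l)
      moreover have "l \<in> H1_closure T" by (rule H1_closure_closed[OF T(1) w l])
      ultimately show ?thesis by blast
    qed
    show "(\<lambda>x. a * v x + b * w x) \<in> H1_closure T" if "v \<in> H1_closure T" "w \<in> H1_closure T" for v w a b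
      by (rule H1_closure_lincomb[OF T(1) lin that])
  qed (use u in simp)
qed

subsection \<open>Integration by parts on the torus\<close>

lemma AE_lborel_nth_neq: "AE x in lborel. (x :: real^'d::finite) $ i \<noteq> c"
proof -
  have "negligible {x :: real^'d. x $ i = c}" by (simp add: cart_eq_inner_axis negligible_standard_hyperplane)
  then have "AE x in lebesgue. x \<notin> {x :: real^'d. x $ i = c}"
    by (intro AE_not_in) (simp add: negligible_iff_null_sets)
  then show ?thesis by (simp add: AE_completion_iff)
qed

lemma lborel_integral_shift:
  assumes "f \<in> borel_measurable borel"
  shows "(\<integral>x. f (x + c) \<partial>lborel) = (\<integral>x. (f x :: real) \<partial>(lborel :: 'a::euclidean_space measure))"
proof -
  have "(\<integral>x. f x \<partial>lborel) = (\<integral>x. f x \<partial>distr lborel borel ((+) c))" by (simp add: lborel_distr_plus)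
  also have "\<dots> = (\<integral>x. f (c + x) \<partial>lborel)" using assms by (intro integral_distr) auto
  finally show ?thesis by (simp add: add.commute)
qed

lemma integrable_indicator_continuous:
  fixes f :: "'a::euclidean_space \<Rightarrow> real"
  assumes "continuous_on UNIV f" "S \<in> sets borel" "S \<subseteq> cbox a b"
  shows "integrable lborel (\<lambda>x. indicator S x * f x)"
proof (rule Bochner_Integration.integrable_bound)
  show "integrable lborel (\<lambda>x. indicator (cbox a b) x *\<^sub>R f x)"
    by (intro borel_integrable_compact continuous_on_subset[OF assms(1)]) auto
  show "(\<lambda>x. indicator S x * f x) \<in> borel_measurable lborel"
    using assms borel_measurable_continuous_onI[OF assms(1)] by (intro borel_measurable_times) auto
  show "AE x in lborel. norm (indicator S x * f x) \<le> norm (indicator (cbox a b) x *\<^sub>R f x)"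
    using assms(3) by (auto simp: indicator_def)
qed

lemma integral_cubeM_eq: "(\<integral>x. f x \<partial>cubeM) = (\<integral>x. indicator unitD x * (f x :: real) \<partial>lborel)"
  using set_integral_unitD[of f] by (simp add: set_lebesgue_integral_def)

text \<open>The translated cube loses the slab \<open>x $ i < t\<close> and gains the translate of
  that slab by one period, on which \<open>f\<close> takes the same values. The cut hyperplanes are
  null.\<close>

lemma unit_shift_integral:
  fixes f :: "real^'d::finite \<Rightarrow> real"
  assumes f: "continuous_on UNIV f" "periodic_fun f" and t: "0 < t" "t < 1"
  shows "(\<integral>x. f (x + axis i t) \<partial>cubeM) = (\<integral>x. f x \<partial>cubeM)"
proof -
  define A where "A = {x \<in> unitD. t < (x :: real^'d) $ i}"
  define B where "B = {x \<in> unitD. (x :: real^'d) $ i < t}"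
  define c where "c = (axis i 1 :: real^'d)"
  have fm [measurable]: "f \<in> borel_measurable borel" by (rule borel_measurable_continuous_onI[OF f(1)])
  have [measurable]: "A \<in> sets borel" "B \<in> sets borel" unfolding A_def B_def by measurable
  have AB: "A \<subseteq> cbox 0 1" "B \<subseteq> cbox 0 1" using unitD_subset_cbox by (auto simp: A_def B_def)
  have intA: "integrable lborel (\<lambda>x. indicator A x * f x)" and intB: "integrable lborel (\<lambda>x. indicator B x * f x)"
    by (rule integrable_indicator_continuous[OF f(1) _ AB(1)], simp, rule integrable_indicator_continuous[OF f(1) _ AB(2)], simp)
  have per: "f (x + c) = f x" for x using f(2) by (simp add: periodic_fun_def c_def)
  have per': "f (x - c) = f x" for x using per[of "x - c"] by simp
  have split: "(\<integral>x. f x \<partial>cubeM) = (\<integral>x. indicator A x * f x \<partial>lborel) + (\<integral>x. indicator B x * f x \<partial>lborel)"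
  proof -
    have "(\<integral>x. f x \<partial>cubeM) = (\<integral>x. indicator A x * f x + indicator B x * f x \<partial>lborel)"
      unfolding integral_cubeM_eq
    proof (rule integral_cong_AE)
      show "AE x in lborel. indicator unitD x * f x = indicator A x * f x + indicator B x * f x"
        using AE_lborel_nth_neq[of i t] by eventually_elim (auto simp: A_def B_def indicator_def)
    qed measurable
    then show ?thesis using intA intB by simp
  qed
  have "(\<integral>x. f (x + axis i t) \<partial>cubeM) = (\<integral>x. indicator unitD ((x + axis i t) - axis i t) * f (x + axis i t) \<partial>lborel)"
    unfolding integral_cubeM_eq by simp
  also have "\<dots> = (\<integral>x. indicator unitD (x - axis i t) * f x \<partial>lborel)"
    by (rule lborel_integral_shift[where f = "\<lambda>x. indicator unitD (x - axis i t) * f x"]) measurable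
  also have "\<dots> = (\<integral>x. indicator A x * f x + indicator B (x - c) * f (x - c) \<partial>lborel)"
  proof (rule integral_cong_AE)
    show "AE x in lborel. indicator unitD (x - axis i t) * f x = indicator A x * f x + indicator B (x - c) * f (x - c)"
      using AE_lborel_nth_neq[of i 1]
    proof eventually_elim
      case (elim x)
      have 1: "x - axis i t \<in> unitD \<longleftrightarrow> (\<forall>j. j \<noteq> i \<longrightarrow> 0 < x $ j \<and> x $ j < 1) \<and> t < x $ i \<and> x $ i < 1 + t"
        by (auto simp: unitD_def axis_def split: if_splits)
      have 2: "x \<in> A \<longleftrightarrow> (\<forall>j. j \<noteq> i \<longrightarrow> 0 < x $ j \<and> x $ j < 1) \<and> t < x $ i \<and> x $ i < 1"
        unfolding A_def unitD_def using t by (auto, (metis less_trans)+)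
      have 3: "x - c \<in> B \<longleftrightarrow> (\<forall>j. j \<noteq> i \<longrightarrow> 0 < x $ j \<and> x $ j < 1) \<and> 1 < x $ i \<and> x $ i < 1 + t"
        unfolding B_def unitD_def c_def using t by (auto simp: axis_def split: if_splits)
      show ?case unfolding per' using elim t by (auto simp: indicator_def 1 2 3)
    qed
  qed measurable
  also have "\<dots> = (\<integral>x. indicator A x * f x \<partial>lborel) + (\<integral>x. indicator B (x - c) * f (x - c) \<partial>lborel)"
  proof (rule Bochner_Integration.integral_add[OF intA])
    show "integrable lborel (\<lambda>x. indicator B (x - c) * f (x - c))"
    proof -
      have "integrable (distr lborel borel ((+) (- c))) (\<lambda>x. indicator B x * f x)"
        using intB by (simp add: lborel_distr_plus)
      then have "integrable lborel (\<lambda>x. indicator B (- c + x) * f (- c + x))"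
        by (subst (asm) integrable_distr_eq) auto
      then show ?thesis by simp
    qed
  qed
  also have "(\<integral>x. indicator B (x - c) * f (x - c) \<partial>lborel) = (\<integral>x. indicator B x * f x \<partial>lborel)"
    using lborel_integral_shift[of "\<lambda>x. indicator B x * f x" "- c"] by simp
  finally show ?thesis using split by simp
qed

lemma frechet_eq_sum_pd:
  fixes f :: "real^'d::finite \<Rightarrow> real"
  assumes "f differentiable (at z)"
  shows "frechet_derivative f (at z) v = (\<Sum>i\<in>UNIV. v $ i * pd i f z)"
proof -
  interpret linear "frechet_derivative f (at z)" by (rule linear_frechet_derivative[OF assms])
  have "v = (\<Sum>i\<in>UNIV. v $ i *\<^sub>R axis i 1)"
    using basis_expansion[of v] by (simp add: scalar_mult_eq_scaleR)
  then have "frechet_derivative f (at z) v = frechet_derivative f (at z) (\<Sum>i\<in>UNIV. v $ i *\<^sub>R axis i 1)" by simp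
  also have "\<dots> = (\<Sum>i\<in>UNIV. v $ i * pd i f z)" by (simp add: sum scale pd_def)
  finally show ?thesis .
qed

lemma DERIV_along_line:
  fixes f :: "real^'d::finite \<Rightarrow> real"
  assumes "\<And>z. f differentiable (at z)"
  shows "((\<lambda>s. f (x + s *\<^sub>R v)) has_real_derivative (\<Sum>i\<in>UNIV. v $ i * pd i f (x + s *\<^sub>R v))) (at s)"
proof -
  have "((\<lambda>s. f (x + s *\<^sub>R v)) has_derivative (\<lambda>h. frechet_derivative f (at (x + s *\<^sub>R v)) (h *\<^sub>R v))) (at s)"
    by (rule has_derivative_compose[where f = "\<lambda>s. x + s *\<^sub>R v" and g = f])
      (auto intro!: derivative_eq_intros has_derivative_frechet assms)
  then show ?thesis
    unfolding has_field_derivative_def frechet_eq_sum_pd[OF assms]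
    by (rule has_derivative_eq_rhs) (auto simp: sum_distrib_left mult.assoc mult.commute mult.left_commute)
qed

text \<open>Difference quotients integrate to zero by translation invariance, and the mean value
  theorem bounds them uniformly; dominated convergence carries this over to the derivative.\<close>

lemma integral_pd_eq_0:
  fixes f :: "real^'d::finite \<Rightarrow> real"
  assumes f: "test_fun f"
  shows "(\<integral>x. pd i f x \<partial>cubeM) = 0"
proof -
  \<comment> \<open>The shifts must lie strictly between 0 and 1, already for \<open>m = 0\<close>;
    hence the summand 2.\<close>
  define t where "t m = 1 / (real m + 2)" for m :: nat
  have t: "0 < t m" "t m < 1" for m by (auto simp: t_def field_simps)
  have t0: "t \<longlonglongrightarrow> 0"
    unfolding t_def using LIMSEQ_ignore_initial_segment[OF LIMSEQ_inverse_real_of_nat, of 1]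
    by (simp add: inverse_eq_divide add.commute)
  have axis_0: "axis i (0 :: real) = 0" by (simp add: axis_def vec_eq_iff)
  define q where "q m x = (f (x + axis i (t m)) - f x) / t m" for m x
  have D: "((\<lambda>s. f (x + axis i s)) has_real_derivative pd i f (x + axis i s)) (at s)" for x s
  proof -
    have "s *\<^sub>R axis i (1::real) = axis i s" for s by (auto simp: axis_def vec_eq_iff)
    moreover have "(\<Sum>j\<in>UNIV. axis i 1 $ j * pd j f z) = pd i f z" for z
      by (subst sum.remove[of _ i]) (auto simp: axis_def intro!: sum.neutral)
    ultimately show ?thesis
      using DERIV_along_line[OF test_fun_differentiable[OF f], of x "axis i 1" s] by simp
  qed
  \<comment> \<open>The cube of side 2 contains all points of the unit cube shifted by less than 1,
    hence all intermediate points of the mean value theorem.\<close>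
  have "bounded (pd i f ` cbox 0 2)"
    by (intro compact_imp_bounded compact_continuous_image test_fun_continuous test_fun_pd f) auto
  then obtain C where C: "\<And>x. x \<in> cbox 0 2 \<Longrightarrow> \<bar>pd i f x\<bar> \<le> C" by (auto simp: bounded_iff)
  have fc: "continuous_on UNIV f" by (rule test_fun_continuous[OF f])
  have fcs: "continuous_on UNIV (\<lambda>x. f (x + axis i s))" for s
    by (rule continuous_on_compose2[OF fc]) (auto intro!: continuous_intros)
  have qc: "continuous_on UNIV (q m)" for m
    unfolding q_def using t(1)[of m] by (intro continuous_intros fc fcs) auto
  have "(\<lambda>m. \<integral>x. q m x \<partial>cubeM) \<longlonglongrightarrow> (\<integral>x. pd i f x \<partial>cubeM)"
  proof (rule integral_dominated_convergence[where w = "\<lambda>x. C"])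
    show "pd i f \<in> borel_measurable cubeM" "q m \<in> borel_measurable cubeM" for m
      by (intro continuous_measurable_cubeM qc test_fun_continuous test_fun_pd f)+
    show "integrable cubeM (\<lambda>x :: real^'d. C)"
      using finite_measure.integrable_const[OF finite_measure_cubeM] .
    show "AE x in cubeM. (\<lambda>m. q m x) \<longlonglongrightarrow> pd i f x"
    proof (rule AE_I2)
      fix x :: "real^'d"
      have "(\<lambda>s. (f (x + axis i s) - f x) / s) \<midarrow>0\<rightarrow> pd i f x"
        using D[of x 0] by (simp add: DERIV_def axis_0)
      moreover have "filterlim t (at 0) sequentially"
        using t(1) t0 unfolding filterlim_at by (auto intro!: always_eventually less_imp_neq[symmetric])
      ultimately show "(\<lambda>m. q m x) \<longlonglongrightarrow> pd i f x"
        unfolding q_def by (rule filterlim_compose)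
    qed
    show "AE x in cubeM. norm (q m x) \<le> C" for m
    proof (rule AE_I2)
      fix x :: "real^'d" assume "x \<in> space cubeM"
      then have x: "0 < x $ j" "x $ j < 1" for j by (auto simp: unitD_def)
      obtain s where s: "0 < s" "s < t m" "f (x + axis i (t m)) - f (x + axis i 0) = (t m - 0) * pd i f (x + axis i s)"
        using MVT2[of 0 "t m" "\<lambda>s. f (x + axis i s)", OF t(1) D] by blast
      have "x + axis i s \<in> cbox 0 2"
        unfolding mem_box_cart
      proof
        fix j
        have "0 \<le> axis i s $ j" "axis i s $ j \<le> 1" using s t(2)[of m] by (auto simp: axis_def)
        then show "(0 :: real^'d) $ j \<le> (x + axis i s) $ j \<and> (x + axis i s) $ j \<le> 2 $ j"
          using x[of j] by simp
      qed
      then show "norm (q m x) \<le> C" using s t(1)[of m] C by (simp add: q_def axis_0)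
    qed
  qed
  moreover have "(\<integral>x. q m x \<partial>cubeM) = 0" for m
  proof -
    have i: "integrable cubeM f" "integrable cubeM (\<lambda>x. f (x + axis i (t m)))"
      by (intro sqint_integrable finite_measure_cubeM sqint_continuous fc fcs)+
    have "(\<integral>x. q m x \<partial>cubeM) = ((\<integral>x. f (x + axis i (t m)) \<partial>cubeM) - (\<integral>x. f x \<partial>cubeM)) / t m"
      unfolding q_def using i by simp
    then show ?thesis using unit_shift_integral[OF fc _ t, of i m] f by (simp add: test_fun_def)
  qed
  ultimately show ?thesis by (simp add: LIMSEQ_const_iff)
qed

text \<open>The torus has no boundary, so the derivative of a product of test functions integrates
  to zero; the product rule turns this into integration by parts.\<close>

lemma has_weak_grad_test_fun:
  assumes "test_fun \<phi>"
  shows "has_weak_grad \<phi> (\<lambda>x. \<chi> i. pd i \<phi> x)"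
  unfolding has_weak_grad_iff
proof (intro conjI allI impI)
  show "sqint cubeM (\<lambda>x. (\<chi> i. pd i \<phi> x) $ i)" for i
    using sqint_test_fun[OF test_fun_pd[OF assms]] by simp
  fix \<psi> :: "real^'a \<Rightarrow> real" and i assume \<psi>: "test_fun \<psi>"
  note s = sqint_test_fun[OF assms] sqint_test_fun[OF test_fun_pd[OF assms]] sqint_test_fun[OF \<psi>] sqint_test_fun[OF test_fun_pd[OF \<psi>]]
  have "0 = (\<integral>x. pd i (\<lambda>x. \<phi> x * \<psi> x) x \<partial>cubeM)"
    by (rule integral_pd_eq_0[symmetric]) (rule test_fun_mult[OF assms \<psi>])
  also have "\<dots> = (\<integral>x. pd i \<phi> x * \<psi> x + \<phi> x * pd i \<psi> x \<partial>cubeM)"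
    by (simp add: pd_mult test_fun_differentiable assms \<psi>)
  also have "\<dots> = (\<integral>x. pd i \<phi> x * \<psi> x \<partial>cubeM) + (\<integral>x. \<phi> x * pd i \<psi> x \<partial>cubeM)"
    by (intro Bochner_Integration.integral_add sqint_mult_integrable s)
  finally show "(\<integral>x. \<phi> x * pd i \<psi> x \<partial>cubeM) = - (\<integral>x. (\<chi> i. pd i \<phi> x) $ i * \<psi> x \<partial>cubeM)" by simp
qed

lemma H1per_test_fun: "test_fun \<phi> \<Longrightarrow> H1per \<phi>"
  by (rule H1perI[OF sqint_test_fun has_weak_grad_test_fun])

subsection \<open>Density of test functions\<close>

lemma h1sq_AE_eq_0:
  assumes "H1per u" "AE x in cubeM. u x = 0"
  shows "h1sq u = 0"
proof -
  have 0: "has_weak_grad (\<lambda>x :: real^'a. 0) (\<lambda>x. 0)" by (simp add: has_weak_grad_iff sqint_zero)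
  have "AE x in cubeM. wgrad u x = 0"
    by (rule weak_grad_unique[OF H1per_wgrad[OF assms(1)] 0 H1per_sqint[OF assms(1)] sqint_zero assms(2)])
  with assms(2) have "AE x in cubeM. (u x)\<^sup>2 + wgrad u x \<bullet> wgrad u x = 0" by eventually_elim simp
  then show ?thesis unfolding h1sq_def set_integral_unitD by (rule integral_eq_zero_AE)
qed

text \<open>Two phase shifts by pi/2 change the sign of a wave, so moving the gradient from
  \<open>r\<close> onto the wave turns the H1 product into 1 plus the sum of the
  \<open>(2 * pi * k $ i)\<^sup>2\<close> times the L2 product. This factor is positive, and the L2
  product vanishes.\<close>

lemma orthogonal_to_waves:
  assumes r: "H1per r" and orth: "\<And>k s. int_vec k \<Longrightarrow> aform (\<lambda>x. 1) r (wave k s) = 0"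
  shows "AE x in cubeM. r x = 0"
proof (rule wave_complete)
  show "integrable cubeM r" by (intro sqint_integrable finite_measure_cubeM H1per_sqint r)
  fix k :: "real^'a" and s assume k: "int_vec k"
  note tw = test_fun_wave[OF k]
  let ?I = "\<integral>x. r x * wave k s x \<partial>cubeM"
  have sq: "sqint cubeM (\<lambda>x. wgrad r x $ i)" "sqint cubeM (wave k t)" for i t
    by (intro H1per_wgrad_sqint r sqint_test_fun tw)+
  have "0 = aform (\<lambda>x. 1) r (wave k s)" using orth[OF k] by simp
  also have "\<dots> = (\<integral>x. wgrad r x \<bullet> (\<chi> i. pd i (wave k s) x) \<partial>cubeM) + ?I"
    using aform_AE_eq[OF bounded_coeff_one H1per_sqint[OF r] H1per_wgrad[OF r] sqint_test_fun[OF tw] has_weak_grad_test_fun[OF tw]]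
    by simp
  also have "(\<integral>x. wgrad r x \<bullet> (\<chi> i. pd i (wave k s) x) \<partial>cubeM)
      = (\<integral>x. (\<Sum>i\<in>UNIV. 2 * pi * k $ i * (wgrad r x $ i * wave k (s + pi / 2) x)) \<partial>cubeM)"
    by (simp add: inner_vec_def pd_wave algebra_simps)
  also have "\<dots> = (\<Sum>i\<in>UNIV. 2 * pi * k $ i * (\<integral>x. wgrad r x $ i * wave k (s + pi / 2) x \<partial>cubeM))"
    by (subst Bochner_Integration.integral_sum) (auto intro!: sqint_mult_integrable sq)
  also have "\<dots> = (\<Sum>i\<in>UNIV. (2 * pi * k $ i)\<^sup>2 * ?I)"
  proof (rule sum.cong[OF refl])
    fix i
    have w: "wave k (s + pi / 2 + pi / 2) x = - wave k s x" for x
    proof -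
      have "wave k (s + pi / 2 + pi / 2) x = cos ((2 * pi * (k \<bullet> x) + s) + pi)"
        by (simp add: wave_def add_ac)
      then show ?thesis unfolding cos_periodic_pi by (simp add: wave_def)
    qed
    have "(\<integral>x. wgrad r x $ i * wave k (s + pi / 2) x \<partial>cubeM) = - (\<integral>x. r x * pd i (wave k (s + pi / 2)) x \<partial>cubeM)"
      using has_weak_gradD(2)[OF H1per_wgrad[OF r] tw[of "s + pi / 2"], of i] by simp
    also have "\<dots> = (\<integral>x. (2 * pi * k $ i) * (r x * wave k s x) \<partial>cubeM)"
      unfolding pd_wave w by (simp add: algebra_simps)
    also have "\<dots> = (2 * pi * k $ i) * ?I" by simp
    finally show "2 * pi * k $ i * (\<integral>x. wgrad r x $ i * wave k (s + pi / 2) x \<partial>cubeM) = (2 * pi * k $ i)\<^sup>2 * ?I"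
      by (simp add: power2_eq_square)
  qed
  also have "\<dots> + ?I = ((\<Sum>i\<in>UNIV. (2 * pi * k $ i)\<^sup>2) + 1) * ?I"
    by (simp add: sum_distrib_right distrib_right)
  finally have "((\<Sum>i\<in>UNIV. (2 * pi * k $ i)\<^sup>2) + 1) * ?I = 0" by simp
  moreover have "(\<Sum>i\<in>UNIV. (2 * pi * k $ i)\<^sup>2) + 1 > 0" by (intro add_nonneg_pos sum_nonneg) auto
  ultimately show "?I = 0" by simp
qed

lemma test_fun_in_closure: "\<phi> \<in> T \<Longrightarrow> H1per \<phi> \<Longrightarrow> \<phi> \<in> H1_closure T"
  unfolding H1_closure_def by (auto intro!: exI[of _ "\<lambda>_. \<phi>"] simp: h1sq_zero)

text \<open>The H1-orthogonal complement of the closure is orthogonal to all waves, hence null.\<close>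

theorem test_fun_dense:
  assumes u: "H1per u"
  shows "u \<in> H1_closure (Collect test_fun)"
proof -
  have "\<exists>p\<in>H1_closure (Collect test_fun). \<forall>v\<in>H1_closure (Collect test_fun). aform (\<lambda>x. 1) p v = aform (\<lambda>x. 1) u v"
    by (rule H1_closure_projection[OF bounded_coeff_one, where K = 1])
      (auto simp: h1sq_eq_aform u intro: H1per_test_fun test_fun_lincomb test_fun_const)
  then obtain p where p: "p \<in> H1_closure (Collect test_fun)"
    and pv: "\<And>v. v \<in> H1_closure (Collect test_fun) \<Longrightarrow> aform (\<lambda>x. 1) p v = aform (\<lambda>x. 1) u v" by blast
  have pH: "H1per p" using p by (rule H1_closure_H1per)
  interpret semi_inner "{u. H1per u}" "aform (\<lambda>x. 1)" by (rule semi_inner_h1)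
  have "AE x in cubeM. p x - u x = 0"
  proof (rule orthogonal_to_waves[OF H1per_diff[OF pH u]])
    fix k :: "real^'a" and s assume k: "int_vec k"
    have w: "H1per (wave k s)" "wave k s \<in> H1_closure (Collect test_fun)"
      using test_fun_wave[OF k] by (auto intro: H1per_test_fun test_fun_in_closure)
    show "aform (\<lambda>x. 1) (\<lambda>x. p x - u x) (wave k s) = 0"
      using B_diff[of p u "wave k s"] pv[OF w(2)] pH u w(1) by simp
  qed
  then have "h1sq (\<lambda>x. p x - u x) = 0" by (rule h1sq_AE_eq_0[OF H1per_diff[OF pH u]])
  then show ?thesis
    by (intro H1_closure_closed[where w = "\<lambda>_. p" and u = u] p u) (auto intro: H1per_test_fun)
qed

subsection \<open>A Poincare inequality\<close>

text \<open>The substitution costs the inverse of the Jacobian \<open>s ^ DIM('a)\<close>, which is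
  at most \<open>2 ^ DIM('a)\<close> for \<open>s \<ge> 1/2\<close>.\<close>

lemma nn_integral_affine_le:
  fixes g :: "'a::euclidean_space \<Rightarrow> ennreal"
  assumes g [measurable]: "g \<in> borel_measurable borel" and s: "1/2 \<le> s"
  shows "(\<integral>\<^sup>+x. g (c + s *\<^sub>R x) \<partial>lborel) \<le> ennreal (2 ^ DIM('a)) * (\<integral>\<^sup>+x. g x \<partial>lborel)"
proof -
  have s0: "s > 0" using s by simp
  have "(\<integral>\<^sup>+x. g x \<partial>lborel) = (\<integral>\<^sup>+x. g x \<partial>density (distr lborel borel (\<lambda>x. c + s *\<^sub>R x)) (\<lambda>_. ennreal (\<bar>s\<bar> ^ DIM('a))))"
    using lborel_affine[of s c] s0 by (metis less_irrefl)
  also have "\<dots> = ennreal (s ^ DIM('a)) * (\<integral>\<^sup>+x. g (c + s *\<^sub>R x) \<partial>lborel)"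
    using s0 by (simp add: nn_integral_density nn_integral_distr nn_integral_cmult)
  finally have e: "(\<integral>\<^sup>+x. g x \<partial>lborel) = ennreal (s ^ DIM('a)) * (\<integral>\<^sup>+x. g (c + s *\<^sub>R x) \<partial>lborel)" .
  have "1 \<le> (2 * s) ^ DIM('a)" using s by (intro one_le_power) simp
  then have "1 \<le> ennreal (2 ^ DIM('a)) * ennreal (s ^ DIM('a))"
    using s0 by (simp add: ennreal_mult[symmetric] power_mult_distrib ennreal_1[symmetric] del: ennreal_1)
  then have "1 * (\<integral>\<^sup>+x. g (c + s *\<^sub>R x) \<partial>lborel)
      \<le> ennreal (2 ^ DIM('a)) * ennreal (s ^ DIM('a)) * (\<integral>\<^sup>+x. g (c + s *\<^sub>R x) \<partial>lborel)"
    by (intro mult_right_mono) auto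
  then show ?thesis unfolding e by (simp add: mult.assoc)
qed

lemma convex_unitD: "x \<in> unitD \<Longrightarrow> y \<in> unitD \<Longrightarrow> 0 \<le> t \<Longrightarrow> t \<le> 1 \<Longrightarrow> y + t *\<^sub>R (x - y) \<in> unitD"
proof -
  assume *: "x \<in> unitD" "y \<in> unitD" "0 \<le> t" "t \<le> 1"
  have "convex (unitD :: (real^'a) set)" unfolding unitD_eq_box by (rule convex_box)
  from convexD[OF this *(2,1), of "1 - t" t] * show ?thesis by (simp add: algebra_simps)
qed

lemma nn_integral_cubeM: "f \<in> borel_measurable borel \<Longrightarrow>
    (\<integral>\<^sup>+x. f x \<partial>cubeM) = (\<integral>\<^sup>+x. f x * indicator unitD x \<partial>(lborel :: (real^'d::finite) measure))"
  unfolding cubeM_def by (subst nn_integral_restrict_space) auto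

text \<open>
  Substituting along the segment costs a Jacobian; integrating over x when t is at least 1/2 and over
  y otherwise keeps it below 2^d.
\<close>

lemma segment_average_le:
  fixes G :: "real^'d::finite \<Rightarrow> ennreal"
  assumes G [measurable]: "G \<in> borel_measurable borel" and t: "0 \<le> t" "t \<le> 1"
  shows "(\<integral>\<^sup>+x. \<integral>\<^sup>+y. indicator unitD x * indicator unitD y * G (y + t *\<^sub>R (x - y)) \<partial>lborel \<partial>lborel)
    \<le> ennreal (2 ^ CARD('d)) * (\<integral>\<^sup>+x. G x \<partial>cubeM)"
proof -
  define g where "g z = G z * indicator unitD z" for z
  have [measurable]: "g \<in> borel_measurable borel" unfolding g_def by measurable
  have gI: "(\<integral>\<^sup>+x. G x \<partial>cubeM) = (\<integral>\<^sup>+z. g z \<partial>lborel)" unfolding g_def by (rule nn_integral_cubeM) measurable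
  have D1: "(\<integral>\<^sup>+x. indicator unitD (x :: real^'d) \<partial>lborel) = 1"
    using emeasure_cubeM_unitD by (simp add: emeasure_cubeM)
  \<comment> \<open>The segment stays in the convex cube, so \<open>G\<close> may be cut off to the
    cube; this frees one of the two variables to range over the whole space for the
    substitution.\<close>
  have le: "indicator unitD x * indicator unitD y * G (y + t *\<^sub>R (x - y)) \<le> indicator unitD x * g (y + t *\<^sub>R (x - y))"
    "indicator unitD x * indicator unitD y * G (y + t *\<^sub>R (x - y)) \<le> indicator unitD y * g (y + t *\<^sub>R (x - y))" for x y
    using convex_unitD[OF _ _ t, of x y] by (auto simp: g_def indicator_def)
  let ?F = "\<lambda>x y. indicator unitD x * indicator unitD y * G (y + t *\<^sub>R (x - y))"
  show ?thesis
  proof (cases "t \<le> 1/2")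
    case True
    have "(\<integral>\<^sup>+x. \<integral>\<^sup>+y. ?F x y \<partial>lborel \<partial>lborel) \<le> (\<integral>\<^sup>+x. indicator unitD (x :: real^'d) * (ennreal (2 ^ CARD('d)) * (\<integral>\<^sup>+z. g z \<partial>lborel)) \<partial>lborel)"
    proof (rule nn_integral_mono)
      fix x :: "real^'d"
      have "(\<integral>\<^sup>+y. ?F x y \<partial>lborel) \<le> (\<integral>\<^sup>+y. indicator unitD x * g (t *\<^sub>R x + (1 - t) *\<^sub>R y) \<partial>lborel)"
        using le(1)[of x] by (intro nn_integral_mono) (simp add: algebra_simps)
      also have "\<dots> = indicator unitD x * (\<integral>\<^sup>+y. g (t *\<^sub>R x + (1 - t) *\<^sub>R y) \<partial>lborel)"
        by (rule nn_integral_cmult) measurable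
      also have "\<dots> \<le> indicator unitD x * (ennreal (2 ^ CARD('d)) * (\<integral>\<^sup>+z. g z \<partial>lborel))"
        using nn_integral_affine_le[of g "1 - t" "t *\<^sub>R x"] True by (intro mult_left_mono) auto
      finally show "(\<integral>\<^sup>+y. ?F x y \<partial>lborel) \<le> indicator unitD x * (ennreal (2 ^ CARD('d)) * (\<integral>\<^sup>+z. g z \<partial>lborel))" .
    qed
    also have "\<dots> = ennreal (2 ^ CARD('d)) * (\<integral>\<^sup>+z. g z \<partial>lborel)"
      by (subst nn_integral_multc) (auto simp: D1)
    finally show ?thesis by (simp add: gI)
  next
    case False
    have "(\<integral>\<^sup>+x. \<integral>\<^sup>+y. ?F x y \<partial>lborel \<partial>lborel) = (\<integral>\<^sup>+y. \<integral>\<^sup>+x. ?F x y \<partial>lborel \<partial>lborel)"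
      by (rule lborel_pair.Fubini') (measurable)
    also have "\<dots> \<le> (\<integral>\<^sup>+y. indicator unitD (y :: real^'d) * (ennreal (2 ^ CARD('d)) * (\<integral>\<^sup>+z. g z \<partial>lborel)) \<partial>lborel)"
    proof (rule nn_integral_mono)
      fix y :: "real^'d"
      have "(\<integral>\<^sup>+x. ?F x y \<partial>lborel) \<le> (\<integral>\<^sup>+x. indicator unitD y * g ((1 - t) *\<^sub>R y + t *\<^sub>R x) \<partial>lborel)"
        using le(2)[of _ y] by (intro nn_integral_mono) (simp add: algebra_simps)
      also have "\<dots> = indicator unitD y * (\<integral>\<^sup>+x. g ((1 - t) *\<^sub>R y + t *\<^sub>R x) \<partial>lborel)"
        by (rule nn_integral_cmult) measurable
      also have "\<dots> \<le> indicator unitD y * (ennreal (2 ^ CARD('d)) * (\<integral>\<^sup>+z. g z \<partial>lborel))"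
        using nn_integral_affine_le[of g t "(1 - t) *\<^sub>R y"] False by (intro mult_left_mono) auto
      finally show "(\<integral>\<^sup>+x. ?F x y \<partial>lborel) \<le> indicator unitD y * (ennreal (2 ^ CARD('d)) * (\<integral>\<^sup>+z. g z \<partial>lborel))" .
    qed
    also have "\<dots> = ennreal (2 ^ CARD('d)) * (\<integral>\<^sup>+z. g z \<partial>lborel)"
      by (subst nn_integral_multc) (auto simp: D1)
    finally show ?thesis by (simp add: gI)
  qed
qed

text \<open>The fundamental theorem of calculus along the segment, then Cauchy-Schwarz in
  \<open>t\<close> and over the coordinates. Each coordinate of \<open>x - y\<close> has modulus at
  most 1, which produces the factor \<open>CARD('d)\<close>.\<close>

lemma square_diff_le_segment:
  fixes \<phi> :: "real^'d::finite \<Rightarrow> real"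
  assumes \<phi>: "test_fun \<phi>" and xy: "x \<in> unitD" "y \<in> unitD"
  shows "ennreal ((\<phi> x - \<phi> y)\<^sup>2) \<le>
    (\<integral>\<^sup>+t. ennreal (CARD('d) * (\<Sum>i\<in>UNIV. (pd i \<phi> (y + t *\<^sub>R (x - y)))\<^sup>2)) * indicator {0..1} t \<partial>lborel)"
proof -
  define k where "k t = (\<Sum>i\<in>UNIV. (x - y) $ i * pd i \<phi> (y + t *\<^sub>R (x - y)))" for t
  define K where "K t = CARD('d) * (\<Sum>i\<in>UNIV. (pd i \<phi> (y + t *\<^sub>R (x - y)))\<^sup>2)" for t
  have pc: "continuous_on UNIV (\<lambda>t. pd i \<phi> (y + t *\<^sub>R (x - y)))" for i
    by (rule continuous_on_compose2[OF test_fun_continuous[OF test_fun_pd[OF \<phi>]]]) (auto intro!: continuous_intros)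
  have kc: "continuous_on UNIV k" unfolding k_def by (intro continuous_intros pc)
  have Kc: "continuous_on UNIV K" unfolding K_def by (intro continuous_intros pc)
  have D: "((\<lambda>t. \<phi> (y + t *\<^sub>R (x - y))) has_real_derivative k t) (at t)" for t
    unfolding k_def by (rule DERIV_along_line[OF test_fun_differentiable[OF \<phi>]])
  define I where "I = {0..1::real}"
  have I: "I \<in> sets borel" "I \<subseteq> cbox 0 1" "finite_measure (restrict_space lborel I)"
    by (auto simp: I_def intro!: finite_measureI simp: emeasure_restrict_space space_restrict_space)
  have ik: "integrable lborel (\<lambda>t. indicator I t * k t)" "integrable lborel (\<lambda>t. indicator I t * (k t)\<^sup>2)"
    "integrable lborel (\<lambda>t. indicator I t * K t)"
    by (intro integrable_indicator_continuous[OF _ I(1,2)] continuous_intros kc Kc)+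
  have Ii: "integrable lborel (\<lambda>t. indicator I t * 1 :: real)"
    by (intro integrable_indicator_continuous[OF _ I(1,2)] continuous_intros)
  have FTC: "(\<integral>t. indicator I t * k t \<partial>lborel) = \<phi> x - \<phi> y"
    using integral_FTC_Icc_real[of 0 1 "\<lambda>t. \<phi> (y + t *\<^sub>R (x - y))" k] D kc
    by (simp add: I_def mult.commute continuous_on_eq_continuous_at)
  define a where "a = \<phi> x - \<phi> y"
  \<comment> \<open>Cauchy-Schwarz on the unit interval in the form of a nonnegative variance:
    \<open>a\<close> is the mean of \<open>k\<close>.\<close>
  have "0 \<le> (\<integral>t. indicator I t * (k t - a)\<^sup>2 \<partial>lborel)" by (intro Bochner_Integration.integral_nonneg) auto
  also have "\<dots> = (\<integral>t. indicator I t * (k t)\<^sup>2 - 2 * a * (indicator I t * k t) + a\<^sup>2 * (indicator I t * 1) \<partial>lborel)"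
    by (intro Bochner_Integration.integral_cong) (auto simp: power2_eq_square algebra_simps)
  also have "\<dots> = (\<integral>t. indicator I t * (k t)\<^sup>2 \<partial>lborel) - 2 * a * a + a\<^sup>2 * (\<integral>t. indicator I t * 1 \<partial>lborel)"
    using ik Ii FTC by (simp add: a_def)
  also have "(\<integral>t. indicator I t * 1 \<partial>lborel) = (1::real)" by (simp add: I_def)
  finally have "a\<^sup>2 \<le> (\<integral>t. indicator I t * (k t)\<^sup>2 \<partial>lborel)" by (simp add: power2_eq_square)
  also have "\<dots> \<le> (\<integral>t. indicator I t * K t \<partial>lborel)"
  proof (rule integral_mono[OF ik(2,3)])
    fix t
    have "(k t)\<^sup>2 \<le> (\<Sum>i\<in>UNIV. ((x - y) $ i)\<^sup>2) * (\<Sum>i\<in>UNIV. (pd i \<phi> (y + t *\<^sub>R (x - y)))\<^sup>2)"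
      unfolding k_def by (rule Cauchy_Schwarz_ineq_sum)
    also have "\<dots> \<le> CARD('d) * (\<Sum>i\<in>UNIV. (pd i \<phi> (y + t *\<^sub>R (x - y)))\<^sup>2)"
    proof (intro mult_right_mono sum_nonneg)
      have "((x - y) $ i)\<^sup>2 \<le> 1" for i
      proof -
        have "\<bar>(x - y) $ i\<bar> \<le> 1" using xy by (auto simp: unitD_def abs_le_iff) (smt (verit))+
        then show ?thesis by (simp add: abs_square_le_1)
      qed
      then have "(\<Sum>i\<in>UNIV. ((x - y) $ i)\<^sup>2) \<le> (\<Sum>i\<in>(UNIV::'d set). 1)" by (intro sum_mono) auto
      then show "(\<Sum>i\<in>UNIV. ((x - y) $ i)\<^sup>2) \<le> real CARD('d)" by simp
    qed auto
    finally show "indicator I t * (k t)\<^sup>2 \<le> indicator I t * K t"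
      unfolding K_def by (intro mult_left_mono) auto
  qed
  finally have "ennreal (a\<^sup>2) \<le> ennreal (\<integral>t. indicator I t * K t \<partial>lborel)" by (rule ennreal_leI)
  also have "\<dots> = (\<integral>\<^sup>+t. ennreal (indicator I t * K t) \<partial>lborel)"
    by (rule nn_integral_eq_integral[symmetric, OF ik(3)]) (auto simp: K_def sum_nonneg)
  also have "\<dots> = (\<integral>\<^sup>+t. ennreal (K t) * indicator {0..1} t \<partial>lborel)"
    by (intro nn_integral_cong) (auto simp: I_def indicator_def)
  finally show ?thesis by (simp add: a_def K_def)
qed

text \<open>Fubini moves the segment parameter outermost; at each fixed \<open>t\<close> the segment
  bound holds with the same constant, and \<open>t\<close> runs over an interval of length
  1.\<close>

lemma double_integral_square_diff_le:
  fixes \<phi> :: "real^'d::finite \<Rightarrow> real"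
  assumes \<phi>: "test_fun \<phi>"
  shows "(\<integral>\<^sup>+x. \<integral>\<^sup>+y. indicator unitD x * indicator unitD y * ennreal ((\<phi> x - \<phi> y)\<^sup>2) \<partial>lborel \<partial>lborel)
    \<le> ennreal (2 ^ CARD('d)) * (\<integral>\<^sup>+x. ennreal (CARD('d) * (\<Sum>i\<in>UNIV. (pd i \<phi> x)\<^sup>2)) \<partial>cubeM)" (is "?L \<le> ?R")
proof -
  define G where "G z = ennreal (CARD('d) * (\<Sum>i\<in>UNIV. (pd i \<phi> z)\<^sup>2))" for z
  have [measurable]: "pd i \<phi> \<in> borel_measurable borel" for i
    by (intro borel_measurable_continuous_onI test_fun_continuous test_fun_pd \<phi>)
  have G [measurable]: "G \<in> borel_measurable borel" unfolding G_def by measurable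
  define F where "F x y t = indicator unitD x * indicator unitD y * G (y + t *\<^sub>R (x - y)) * indicator {0..1} t"
    for x y :: "real^'d" and t :: real
  have "?L \<le> (\<integral>\<^sup>+x. \<integral>\<^sup>+y. \<integral>\<^sup>+t. F x y t \<partial>lborel \<partial>lborel \<partial>lborel)"
  proof (intro nn_integral_mono)
    fix x y :: "real^'d"
    have "(\<integral>\<^sup>+t. F x y t \<partial>lborel) = indicator unitD x * indicator unitD y * (\<integral>\<^sup>+t. G (y + t *\<^sub>R (x - y)) * indicator {0..1} t \<partial>lborel)"
      unfolding F_def by (subst nn_integral_cmult[symmetric]) (auto simp: mult.assoc)
    then show "indicator unitD x * indicator unitD y * ennreal ((\<phi> x - \<phi> y)\<^sup>2) \<le> (\<integral>\<^sup>+t. F x y t \<partial>lborel)"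
      using square_diff_le_segment[OF \<phi>, of x y] by (auto simp: G_def indicator_def)
  qed
  also have "\<dots> = (\<integral>\<^sup>+x. \<integral>\<^sup>+t. \<integral>\<^sup>+y. F x y t \<partial>lborel \<partial>lborel \<partial>lborel)"
    by (intro nn_integral_cong lborel_pair.Fubini') (simp add: F_def, measurable)
  also have "\<dots> = (\<integral>\<^sup>+t. \<integral>\<^sup>+x. \<integral>\<^sup>+y. F x y t \<partial>lborel \<partial>lborel \<partial>lborel)"
    by (intro lborel_pair.Fubini') (simp add: F_def, measurable)
  also have "\<dots> \<le> (\<integral>\<^sup>+t. ?R * indicator {0..1::real} t \<partial>lborel)"
  proof (rule nn_integral_mono)
    fix t :: real
    have "(\<integral>\<^sup>+x. \<integral>\<^sup>+y. F x y t \<partial>lborel \<partial>lborel) =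
      (\<integral>\<^sup>+x. \<integral>\<^sup>+y. indicator unitD x * indicator unitD y * G (y + t *\<^sub>R (x - y)) \<partial>lborel \<partial>lborel) * indicator {0..1} t"
      unfolding F_def by (cases "t \<in> {0..1}") auto
    also have "\<dots> \<le> ?R * indicator {0..1} t"
    proof (cases "t \<in> {0..1}")
      case True
      then show ?thesis using segment_average_le[OF G, of t] by (simp add: G_def)
    qed simp
    finally show "(\<integral>\<^sup>+x. \<integral>\<^sup>+y. F x y t \<partial>lborel \<partial>lborel) \<le> ?R * indicator {0..1} t" .
  qed
  also have "\<dots> = ?R" by (subst nn_integral_cmult_indicator) auto
  finally show ?thesis .
qed

text \<open>The inequality \<open>(\<phi> x)\<^sup>2 \<le> 2 * (\<phi> x - \<phi> y)\<^sup>2 + 2 *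
  (\<phi> y)\<^sup>2\<close> is integrated over \<open>x\<close> in the cube and \<open>y\<close> in
  \<open>E\<close>. Thus values on \<open>E\<close> play the part of the mean, and the constant is
  explicit, without a compactness argument.\<close>

lemma Poincare_test_fun:
  fixes \<phi> :: "real^'d::finite \<Rightarrow> real"
  assumes \<phi>: "test_fun \<phi>" and E: "E \<in> sets borel" "E \<subseteq> unitD"
  shows "measure lborel E * (\<integral>x. (\<phi> x)\<^sup>2 \<partial>cubeM)
    \<le> 2 ^ (CARD('d) + 1) * CARD('d) * (\<Sum>i\<in>UNIV. \<integral>x. (pd i \<phi> x)\<^sup>2 \<partial>cubeM)
      + 2 * (\<integral>x. indicator E x * (\<phi> x)\<^sup>2 \<partial>cubeM)"
proof -
  note [measurable] = E(1)
  have [measurable]: "\<phi> \<in> borel_measurable borel"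
    by (intro borel_measurable_continuous_onI test_fun_continuous \<phi>)
  have D1: "(\<integral>\<^sup>+x. indicator unitD (x :: real^'d) \<partial>lborel) = 1"
    using emeasure_cubeM_unitD by (simp add: emeasure_cubeM)
  have Efin: "emeasure lborel E \<noteq> \<infinity>"
    using emeasure_mono[OF E(2), of lborel] D1 by (auto simp: top_unique)
  have int_phi: "integrable cubeM (\<lambda>x. (\<phi> x)\<^sup>2)" using sqint_test_fun[OF \<phi>] by (simp add: sqint_def)
  have int_E: "integrable cubeM (\<lambda>x. indicator E x * (\<phi> x)\<^sup>2)"
    by (rule Bochner_Integration.integrable_bound[OF int_phi])
      (auto simp: indicator_def intro!: borel_measurable_times measurable_cubeM)
  have int_pd: "integrable cubeM (\<lambda>x. (pd i \<phi> x)\<^sup>2)" for i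
    using sqint_test_fun[OF test_fun_pd[OF \<phi>]] by (simp add: sqint_def)
  let ?d = "\<lambda>x y. indicator unitD x * indicator unitD y * ennreal ((\<phi> x - \<phi> y)\<^sup>2)"
  let ?e = "\<lambda>(x :: real^'d) y. indicator unitD x * (indicator E y * ennreal ((\<phi> y)\<^sup>2))"
  have "(\<integral>\<^sup>+x. \<integral>\<^sup>+y. indicator unitD x * ennreal ((\<phi> x)\<^sup>2) * indicator E y \<partial>lborel \<partial>lborel)
     \<le> (\<integral>\<^sup>+x. \<integral>\<^sup>+y. 2 * ?d x y + 2 * ?e x y \<partial>lborel \<partial>lborel)"
  proof (intro nn_integral_mono)
    fix x y :: "real^'d"
    have "(\<phi> x)\<^sup>2 \<le> 2 * (\<phi> x - \<phi> y)\<^sup>2 + 2 * (\<phi> y)\<^sup>2"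
      using square_lincomb_le[of 1 "\<phi> x - \<phi> y" 1 "\<phi> y"] by simp
    then have "ennreal ((\<phi> x)\<^sup>2) \<le> ennreal (2 * (\<phi> x - \<phi> y)\<^sup>2 + 2 * (\<phi> y)\<^sup>2)" by (rule ennreal_leI)
    also have "\<dots> = 2 * ennreal ((\<phi> x - \<phi> y)\<^sup>2) + 2 * ennreal ((\<phi> y)\<^sup>2)" by (simp add: ennreal_plus ennreal_mult)
    finally show "indicator unitD x * ennreal ((\<phi> x)\<^sup>2) * indicator E y \<le> 2 * ?d x y + 2 * ?e x y"
      using E(2) by (auto simp: indicator_def)
  qed
  also have "\<dots> = 2 * (\<integral>\<^sup>+x. \<integral>\<^sup>+y. ?d x y \<partial>lborel \<partial>lborel) + 2 * (\<integral>\<^sup>+x. \<integral>\<^sup>+y. ?e x y \<partial>lborel \<partial>lborel)"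
    by (simp add: nn_integral_add nn_integral_cmult)
  also have "(\<integral>\<^sup>+x. \<integral>\<^sup>+y. ?e x y \<partial>lborel \<partial>lborel) = (\<integral>\<^sup>+y. indicator E y * ennreal ((\<phi> y)\<^sup>2) \<partial>lborel)"
    using D1 by (simp add: nn_integral_cmult nn_integral_multc)
  also have "(\<integral>\<^sup>+x. \<integral>\<^sup>+y. indicator unitD x * ennreal ((\<phi> x)\<^sup>2) * indicator E y \<partial>lborel \<partial>lborel)
      = (\<integral>\<^sup>+x. indicator unitD x * ennreal ((\<phi> x)\<^sup>2) \<partial>lborel) * emeasure lborel E"
    by (simp add: nn_integral_cmult nn_integral_multc)
  also have "(\<integral>\<^sup>+x. indicator unitD x * ennreal ((\<phi> x)\<^sup>2) \<partial>lborel) = (\<integral>\<^sup>+x. ennreal ((\<phi> x)\<^sup>2) \<partial>cubeM)"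
    by (subst nn_integral_cubeM) (auto simp: mult.commute)
  also have "\<dots> = ennreal (\<integral>x. (\<phi> x)\<^sup>2 \<partial>cubeM)"
    by (rule nn_integral_eq_integral[OF int_phi]) auto
  also have "(\<integral>\<^sup>+y. indicator E y * ennreal ((\<phi> y)\<^sup>2) \<partial>lborel) = (\<integral>\<^sup>+y. ennreal (indicator E y * (\<phi> y)\<^sup>2) \<partial>cubeM)"
    using E(2) by (subst nn_integral_cubeM) (auto intro!: nn_integral_cong simp: indicator_def)
  also have "\<dots> = ennreal (\<integral>y. indicator E y * (\<phi> y)\<^sup>2 \<partial>cubeM)"
    by (rule nn_integral_eq_integral[OF int_E]) auto
  also have "emeasure lborel E = ennreal (measure lborel E)"
    using Efin by (simp add: emeasure_eq_ennreal_measure)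
  finally have 1: "ennreal (\<integral>x. (\<phi> x)\<^sup>2 \<partial>cubeM) * ennreal (measure lborel E)
      \<le> 2 * (\<integral>\<^sup>+x. \<integral>\<^sup>+y. ?d x y \<partial>lborel \<partial>lborel) + 2 * ennreal (\<integral>y. indicator E y * (\<phi> y)\<^sup>2 \<partial>cubeM)" .
  have "(\<integral>\<^sup>+x. ennreal (CARD('d) * (\<Sum>i\<in>UNIV. (pd i \<phi> x)\<^sup>2)) \<partial>cubeM)
      = ennreal (\<integral>x. CARD('d) * (\<Sum>i\<in>UNIV. (pd i \<phi> x)\<^sup>2) \<partial>cubeM)"
    by (rule nn_integral_eq_integral) (auto intro!: int_pd sum_nonneg AE_I2 mult_nonneg_nonneg)
  also have "(\<integral>x. CARD('d) * (\<Sum>i\<in>UNIV. (pd i \<phi> x)\<^sup>2) \<partial>cubeM) = CARD('d) * (\<Sum>i\<in>UNIV. \<integral>x. (pd i \<phi> x)\<^sup>2 \<partial>cubeM)"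
    using int_pd by (simp add: Bochner_Integration.integral_sum)
  finally have 2: "(\<integral>\<^sup>+x. \<integral>\<^sup>+y. ?d x y \<partial>lborel \<partial>lborel)
      \<le> ennreal (2 ^ CARD('d)) * ennreal (CARD('d) * (\<Sum>i\<in>UNIV. \<integral>x. (pd i \<phi> x)\<^sup>2 \<partial>cubeM))"
    using double_integral_square_diff_le[OF \<phi>] by simp
  let ?S = "\<Sum>i\<in>UNIV. \<integral>x. (pd i \<phi> x)\<^sup>2 \<partial>cubeM" and ?T = "\<integral>y. indicator E y * (\<phi> y)\<^sup>2 \<partial>cubeM"
  have S0: "?S \<ge> 0" by (intro sum_nonneg Bochner_Integration.integral_nonneg) auto
  have T0: "?T \<ge> 0" by (intro Bochner_Integration.integral_nonneg) auto
  have P0: "(\<integral>x. (\<phi> x)\<^sup>2 \<partial>cubeM) \<ge> 0" by (intro Bochner_Integration.integral_nonneg) auto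
  have "ennreal ((\<integral>x. (\<phi> x)\<^sup>2 \<partial>cubeM) * measure lborel E) = ennreal (\<integral>x. (\<phi> x)\<^sup>2 \<partial>cubeM) * ennreal (measure lborel E)"
    using P0 by (simp add: ennreal_mult)
  also have "\<dots> \<le> 2 * (ennreal (2 ^ CARD('d)) * ennreal (CARD('d) * ?S)) + 2 * ennreal ?T"
    using 1 2 by (meson order_trans add_mono mult_left_mono order_refl zero_le)
  also have "\<dots> = ennreal (2 * (2 ^ CARD('d) * (CARD('d) * ?S)) + 2 * ?T)"
    using S0 T0 by (simp add: ennreal_plus ennreal_mult)
  finally have "(\<integral>x. (\<phi> x)\<^sup>2 \<partial>cubeM) * measure lborel E \<le> 2 * (2 ^ CARD('d) * (CARD('d) * ?S)) + 2 * ?T"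
    using S0 T0 by (subst (asm) ennreal_le_iff) (auto intro!: add_nonneg_nonneg mult_nonneg_nonneg)
  then show ?thesis by (simp add: mult.commute mult.left_commute)
qed

lemma aform_tendsto_diag:
  assumes V: "bounded_coeff C V" and f: "\<And>m. H1per (f m)" and u: "H1per u"
    and lim: "(\<lambda>m. h1sq (\<lambda>x. f m x - u x)) \<longlonglongrightarrow> 0"
  shows "(\<lambda>m. aform V (f m) (f m)) \<longlonglongrightarrow> aform V u u"
proof -
  interpret semi_inner "{u. H1per u}" "aform V" by (rule semi_inner_aform[OF V])
  have l0: "(\<lambda>m. aform V (\<lambda>x. f m x - u x) (\<lambda>x. f m x - u x)) \<longlonglongrightarrow> 0"
  proof (rule tendsto_sandwich[OF _ _ tendsto_const])
    show "(\<lambda>m. max 1 C * h1sq (\<lambda>x. f m x - u x)) \<longlonglongrightarrow> 0" using tendsto_mult_right_zero[OF lim] .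
  qed (auto intro!: always_eventually B_nonneg aform_le_h1sq[OF V] H1per_diff f u)
  have e: "aform V (f m) (f m) = aform V (\<lambda>x. f m x - u x) (\<lambda>x. f m x - u x) + 2 * aform V (f m) u - aform V u u" for m
    using f[of m] u by (simp add: B_diff B_diff_right H1per_diff B_sym[of u "f m"])
  have "(\<lambda>m. aform V (\<lambda>x. f m x - u x) (\<lambda>x. f m x - u x) + 2 * aform V (f m) u - aform V u u)
      \<longlonglongrightarrow> 0 + 2 * aform V u u - aform V u u"
    using f u by (intro tendsto_intros l0 tendsto_B) auto
  then show ?thesis unfolding e by simp
qed

text \<open>The Poincare inequality controls the L2 part by the gradient and the values on
  \<open>E\<close>, and there \<open>V\<close> is at least \<open>b\<close>. Both sides are
  continuous in H1, so test functions suffice.\<close>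

theorem aform_coercive:
  fixes V :: "real^'d::finite \<Rightarrow> real"
  assumes V: "bounded_coeff C V" and E: "E \<in> sets borel" "E \<subseteq> unitD" "measure lborel E > 0"
    and b: "b > 0" "AE x in cubeM. x \<in> E \<longrightarrow> b \<le> V x"
  shows "\<exists>K. \<forall>u. H1per u \<longrightarrow> h1sq u \<le> K * aform V u u"
proof -
  define e where "e = measure lborel E"
  \<comment> \<open>\<open>A\<close> is the Poincare constant for the gradient, and
    \<open>2 / (e * b)\<close> comes from bounding the integral over \<open>E\<close> by
    \<open>1 / b\<close> times the potential term. The summand 1 in \<open>K\<close> pays for the
    gradient part of the H1 norm.\<close>
  define A where "A = 2 ^ (CARD('d) + 1) * CARD('d) / e"
  define K where "K = 1 + A + 2 / (e * b)"
  have e: "e > 0" using E(3) by (simp add: e_def)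
  have A: "A \<ge> 0" using e by (simp add: A_def)
  have test: "h1sq \<phi> \<le> K * aform V \<phi> \<phi>" if \<phi>: "test_fun \<phi>" for \<phi>
  proof -
    let ?S = "\<Sum>i\<in>UNIV. \<integral>x. (pd i \<phi> x)\<^sup>2 \<partial>cubeM" and ?T = "\<integral>x. indicator E x * (\<phi> x)\<^sup>2 \<partial>cubeM"
      and ?P = "\<integral>x. (\<phi> x)\<^sup>2 \<partial>cubeM" and ?W = "\<integral>x. V x * \<phi> x * \<phi> x \<partial>cubeM"
    have S0: "?S \<ge> 0" by (intro sum_nonneg Bochner_Integration.integral_nonneg) auto
    have T0: "?T \<ge> 0" by (intro Bochner_Integration.integral_nonneg) auto
    note sq = sqint_test_fun[OF \<phi>] and wg = has_weak_grad_test_fun[OF \<phi>]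
    have h: "h1sq \<phi> = ?P + ?S" using h1sq_eq[OF sq wg] by simp
    have "(\<integral>x. (\<chi> i. pd i \<phi> x) \<bullet> (\<chi> i. pd i \<phi> x) \<partial>cubeM) = ?S"
      unfolding inner_vec_def using sqint_test_fun[OF test_fun_pd[OF \<phi>]]
      by (subst Bochner_Integration.integral_sum) (auto simp: sqint_def power2_eq_square)
    then have a: "aform V \<phi> \<phi> = ?S + ?W" using aform_AE_eq[OF V sq wg sq wg] by simp
    have iE: "integrable cubeM (\<lambda>x. indicator E x * (\<phi> x)\<^sup>2)"
    proof (rule Bochner_Integration.integrable_bound)
      show "integrable cubeM (\<lambda>x. (\<phi> x)\<^sup>2)" using sq by (simp add: sqint_def)
      show "(\<lambda>x. indicator E x * (\<phi> x)\<^sup>2) \<in> borel_measurable cubeM"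
        using sqint_measurable[OF sq] measurable_cubeM[of "indicator E"] E(1)
        by (intro borel_measurable_times borel_measurable_power) auto
    qed (auto simp: indicator_def)
    have "b * ?T = (\<integral>x. b * (indicator E x * (\<phi> x)\<^sup>2) \<partial>cubeM)" by simp
    also have "\<dots> \<le> ?W"
    proof (rule integral_mono_AE)
      show "integrable cubeM (\<lambda>x. b * (indicator E x * (\<phi> x)\<^sup>2))" using iE by simp
      show "integrable cubeM (\<lambda>x. V x * \<phi> x * \<phi> x)" by (rule integrable_coeff[OF V sq sq])
      show "AE x in cubeM. b * (indicator E x * (\<phi> x)\<^sup>2) \<le> V x * \<phi> x * \<phi> x"
        using b(2) V[unfolded bounded_coeff_def, THEN conjunct2]
      proof eventually_elim
        case (elim x)
        then have "b * indicator E x \<le> V x" by (auto simp: indicator_def)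
        then have "b * indicator E x * (\<phi> x)\<^sup>2 \<le> V x * (\<phi> x)\<^sup>2" by (intro mult_right_mono) auto
        then show ?case by (simp add: power2_eq_square mult.assoc)
      qed
    qed
    finally have TW: "b * ?T \<le> ?W" .
    then have W0: "?W \<ge> 0" using T0 b(1) by (meson mult_nonneg_nonneg less_imp_le order_trans)
    have "e * ?P \<le> e * (A * ?S) + 2 * ?T"
      using Poincare_test_fun[OF \<phi> E(1,2)] e by (simp add: A_def e_def)
    also have "2 * ?T \<le> e * (2 / (e * b) * ?W)" using TW b(1) e by (simp add: field_simps)
    finally have "e * ?P \<le> e * (A * ?S + 2 / (e * b) * ?W)" by (simp add: distrib_left)
    then have P: "?P \<le> A * ?S + 2 / (e * b) * ?W" using e by (simp only: mult_le_cancel_left_pos)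
    have "A * ?S + 2 / (e * b) * ?W + ?S \<le> K * (?S + ?W)"
    proof -
      have "0 \<le> (1 + A) * ?W" "0 \<le> 2 / (e * b) * ?S" using A W0 S0 e b(1) by auto
      then show ?thesis by (simp add: K_def algebra_simps)
    qed
    then show ?thesis using P unfolding h a by linarith
  qed
  have "h1sq u \<le> K * aform V u u" if u: "H1per u" for u
  proof -
    obtain \<phi> where \<phi>: "\<And>m. test_fun (\<phi> m)" "(\<lambda>m. h1sq (\<lambda>x. \<phi> m x - u x)) \<longlonglongrightarrow> 0"
      using test_fun_dense[OF u] unfolding H1_closure_def by auto
    have "(\<lambda>m. h1sq (\<phi> m)) \<longlonglongrightarrow> h1sq u"
      unfolding h1sq_eq_aform
      by (rule aform_tendsto_diag[OF bounded_coeff_one H1per_test_fun[OF \<phi>(1)] u \<phi>(2)])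
    moreover have "(\<lambda>m. K * aform V (\<phi> m) (\<phi> m)) \<longlonglongrightarrow> K * aform V u u"
      by (intro tendsto_intros aform_tendsto_diag[OF V H1per_test_fun[OF \<phi>(1)] u \<phi>(2)])
    ultimately show ?thesis by (rule LIMSEQ_le) (use test[OF \<phi>(1)] in auto)
  qed
  then show ?thesis by blast
qed

subsection \<open>Multipliers that are limits of test functions\<close>

lemma L2_dominated:
  fixes f :: "nat \<Rightarrow> real^'d::finite \<Rightarrow> real"
  assumes f: "\<And>m. f m \<in> borel_measurable cubeM" and u: "u \<in> borel_measurable cubeM"
    and bd: "\<And>m. AE x in cubeM. \<bar>f m x\<bar> \<le> C" and lim: "AE x in cubeM. (\<lambda>m. f m x) \<longlonglongrightarrow> u x"
  shows "AE x in cubeM. \<bar>u x\<bar> \<le> C" "sqint cubeM u" "(\<lambda>m. \<integral>x. (f m x - u x)\<^sup>2 \<partial>cubeM) \<longlonglongrightarrow> 0"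
proof -
  have bd': "AE x in cubeM. \<forall>m. \<bar>f m x\<bar> \<le> C" using bd by (simp add: AE_all_countable)
  show ubd: "AE x in cubeM. \<bar>u x\<bar> \<le> C" using bd' lim
  proof eventually_elim
    case (elim x)
    show ?case
      by (rule LIMSEQ_le_const2[OF tendsto_rabs[OF elim(2)]]) (use elim(1) in auto)
  qed
  show "sqint cubeM u" by (rule sqint_bounded[OF finite_measure_cubeM u ubd])
  have "(\<lambda>m. \<integral>x. (f m x - u x)\<^sup>2 \<partial>cubeM) \<longlonglongrightarrow> (\<integral>x. (0::real) \<partial>(cubeM :: (real^'d) measure))"
  proof (rule integral_dominated_convergence[where w = "\<lambda>x. (2 * C)\<^sup>2"])
    show "integrable cubeM (\<lambda>x :: real^'d. (2 * C)\<^sup>2)"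
      using finite_measure.integrable_const[OF finite_measure_cubeM] .
    show "AE x in cubeM. (\<lambda>m. (f m x - u x)\<^sup>2) \<longlonglongrightarrow> 0"
      using lim
    proof eventually_elim
      case (elim x)
      have "(\<lambda>m. (f m x - u x)\<^sup>2) \<longlonglongrightarrow> (u x - u x)\<^sup>2" by (intro tendsto_intros elim)
      then show ?case by simp
    qed
    show "AE x in cubeM. norm ((f m x - u x)\<^sup>2) \<le> (2 * C)\<^sup>2" for m
      using bd[of m] ubd
    proof eventually_elim
      case (elim x)
      then have "\<bar>f m x - u x\<bar> \<le> 2 * C" by linarith
      then have "\<bar>f m x - u x\<bar>\<^sup>2 \<le> (2 * C)\<^sup>2" by (intro power_mono) auto
      then show ?case by simp
    qed
  qed (use f u in auto)
  then show "(\<lambda>m. \<integral>x. (f m x - u x)\<^sup>2 \<partial>cubeM) \<longlonglongrightarrow> 0" by simp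
qed

lemma L2_bounded_mult_le:
  assumes "sqint M f" "h \<in> borel_measurable M" "AE x in M. \<bar>h x\<bar> \<le> C"
  shows "(\<integral>x. (h x * f x)\<^sup>2 \<partial>M) \<le> C\<^sup>2 * (\<integral>x. (f x)\<^sup>2 \<partial>M)"
proof -
  have "(\<integral>x. (h x * f x)\<^sup>2 \<partial>M) \<le> (\<integral>x. C\<^sup>2 * (f x)\<^sup>2 \<partial>M)"
  proof (rule integral_mono_AE)
    show "integrable M (\<lambda>x. (h x * f x)\<^sup>2)" using sqint_bounded_mult[OF assms] by (simp add: sqint_def)
    show "integrable M (\<lambda>x. C\<^sup>2 * (f x)\<^sup>2)" using assms(1) by (simp add: sqint_def)
    show "AE x in M. (h x * f x)\<^sup>2 \<le> C\<^sup>2 * (f x)\<^sup>2"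
      using assms(3)
    proof eventually_elim
      case (elim x)
      then have "\<bar>h x\<bar>\<^sup>2 \<le> C\<^sup>2" by (intro power_mono) auto
      then show ?case by (simp add: power_mult_distrib mult_right_mono)
    qed
  qed
  then show ?thesis by simp
qed

lemma h1sq_test_diff_ge:
  assumes "test_fun \<phi>" "H1per u"
  shows "(\<integral>x. (\<phi> x - u x)\<^sup>2 \<partial>cubeM) \<le> h1sq (\<lambda>x. \<phi> x - u x)"
    and "(\<integral>x. (pd i \<phi> x - wgrad u x $ i)\<^sup>2 \<partial>cubeM) \<le> h1sq (\<lambda>x. \<phi> x - u x)"
proof -
  have h: "h1sq (\<lambda>x. \<phi> x - u x) = (\<integral>x. (\<phi> x - u x)\<^sup>2 \<partial>cubeM)
      + (\<Sum>i\<in>UNIV. \<integral>x. (pd i \<phi> x - wgrad u x $ i)\<^sup>2 \<partial>cubeM)"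
    using h1sq_eq[OF sqint_lincomb[OF sqint_test_fun[OF assms(1)] H1per_sqint[OF assms(2)]]
      has_weak_grad_lincomb[OF sqint_test_fun[OF assms(1)] has_weak_grad_test_fun[OF assms(1)]
        H1per_sqint[OF assms(2)] H1per_wgrad[OF assms(2)]], of 1 "-1"]
    by simp
  show "(\<integral>x. (\<phi> x - u x)\<^sup>2 \<partial>cubeM) \<le> h1sq (\<lambda>x. \<phi> x - u x)"
    unfolding h by (simp add: sum_nonneg)
  show "(\<integral>x. (pd i \<phi> x - wgrad u x $ i)\<^sup>2 \<partial>cubeM) \<le> h1sq (\<lambda>x. \<phi> x - u x)"
    unfolding h by (intro add_increasing member_le_sum) auto
qed

text \<open>For a test function, the products with \<open>\<eta> m\<close> lie in \<open>T\<close>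
  and converge in H1 by dominated convergence. A general \<open>u\<close> needs a second limit,
  because \<open>\<eta> m\<close> times \<open>u\<close> need not be smooth and hence need not lie
  in \<open>T\<close>.\<close>

theorem multiplier_H1_closure:
  fixes \<eta> :: "nat \<Rightarrow> real^'d::finite \<Rightarrow> real"
  assumes \<eta>: "\<And>m. test_fun (\<eta> m)" and l: "l \<in> borel_measurable cubeM"
    and bd: "\<And>m. AE x in cubeM. \<bar>\<eta> m x\<bar> \<le> C" "\<And>m i. AE x in cubeM. \<bar>pd i (\<eta> m) x\<bar> \<le> C"
    and lim: "AE x in cubeM. (\<lambda>m. \<eta> m x) \<longlonglongrightarrow> l x"
    and conv: "\<And>i. AE x in cubeM. convergent (\<lambda>m. pd i (\<eta> m) x)"
    and T: "T \<subseteq> Collect test_fun" "\<And>m \<phi>. test_fun \<phi> \<Longrightarrow> (\<lambda>x. \<eta> m x * \<phi> x) \<in> T"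
    and u: "H1per u"
  shows "(\<lambda>x. l x * u x) \<in> H1_closure T"
proof -
  \<comment> \<open>The pointwise limit of the smooth gradients acts as the gradient of
    \<open>l\<close>: \<open>h1_limit\<close> inserts it into the product rule, and no derivative of
    \<open>l\<close> has to be computed.\<close>
  define g where "g i x = lim (\<lambda>m. pd i (\<eta> m) x)" for i x
  have em: "\<eta> m \<in> borel_measurable cubeM" "pd i (\<eta> m) \<in> borel_measurable cubeM" for i m
    by (intro continuous_measurable_cubeM test_fun_continuous test_fun_pd \<eta>)+
  have gm: "g i \<in> borel_measurable cubeM" for i
    unfolding g_def by (intro borel_measurable_lim_metric em)
  have glim: "AE x in cubeM. (\<lambda>m. pd i (\<eta> m) x) \<longlonglongrightarrow> g i x" for i
    using conv[of i] by eventually_elim (simp add: g_def convergent_LIMSEQ_iff)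
  have lbd: "AE x in cubeM. \<bar>l x\<bar> \<le> C" by (rule L2_dominated(1)[OF em(1) l bd(1) lim])
  have gbd: "AE x in cubeM. \<bar>g i x\<bar> \<le> C" for i by (rule L2_dominated(1)[OF em(2) gm bd(2) glim])
  have TH: "H1per \<phi>" if "\<phi> \<in> T" for \<phi> using T(1) that by (auto intro: H1per_test_fun)
  have test: "has_weak_grad (\<lambda>x. l x * \<phi> x) (\<lambda>x. \<chi> i. g i x * \<phi> x + l x * pd i \<phi> x)"
    "(\<lambda>x. l x * \<phi> x) \<in> H1_closure T" "sqint cubeM (\<lambda>x. l x * \<phi> x)" if \<phi>: "test_fun \<phi>" for \<phi>
  proof -
    define G where "G = (\<lambda>x. \<chi> i. g i x * \<phi> x + l x * pd i \<phi> x)"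
    define f where "f m = (\<lambda>x. \<eta> m x * \<phi> x)" for m
    have f: "test_fun (f m)" for m unfolding f_def by (rule test_fun_mult[OF \<eta> \<phi>])
    note sq = sqint_test_fun[OF \<phi>] sqint_test_fun[OF test_fun_pd[OF \<phi>]]
    obtain B where B: "AE x in cubeM. \<bar>\<phi> x\<bar> \<le> B" using AE_bounded_cubeM[OF test_fun_continuous[OF \<phi>]] .
    have "\<exists>B. AE x in cubeM. \<bar>pd i \<phi> x\<bar> \<le> B" for i
      using AE_bounded_cubeM[OF test_fun_continuous[OF test_fun_pd[OF \<phi>]]] by metis
    then obtain B' where B': "\<And>i. AE x in cubeM. \<bar>pd i \<phi> x\<bar> \<le> B' i" by metis
    have mult_le: "\<bar>a * b\<bar> \<le> A * D" if "\<bar>a\<bar> \<le> A" "\<bar>b\<bar> \<le> D" for a b A D :: real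
      unfolding abs_mult using that by (intro mult_mono) auto
    have sG: "sqint cubeM (\<lambda>x. G x $ i)" for i
      unfolding G_def using sq by (auto intro!: sqint_add sqint_bounded_mult[OF _ gm gbd] sqint_bounded_mult[OF _ l lbd])
    show sl: "sqint cubeM (\<lambda>x. l x * \<phi> x)" by (rule sqint_bounded_mult[OF sq(1) l lbd])
    have lim1: "(\<lambda>m. \<integral>x. (f m x - l x * \<phi> x)\<^sup>2 \<partial>cubeM) \<longlonglongrightarrow> 0"
    proof (rule L2_dominated(3))
      show "f m \<in> borel_measurable cubeM" for m by (rule sqint_measurable[OF sqint_test_fun[OF f]])
      show "(\<lambda>x. l x * \<phi> x) \<in> borel_measurable cubeM" by (rule sqint_measurable[OF sl])
      show "AE x in cubeM. \<bar>f m x\<bar> \<le> C * B" for m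
        using bd(1)[of m] B by eventually_elim (simp add: f_def mult_le)
      show "AE x in cubeM. (\<lambda>m. f m x) \<longlonglongrightarrow> l x * \<phi> x"
        using lim by eventually_elim (auto simp: f_def intro!: tendsto_intros)
    qed
    have pdf: "pd i (f m) x = pd i (\<eta> m) x * \<phi> x + \<eta> m x * pd i \<phi> x" for i m x
      unfolding f_def by (rule pd_mult[OF test_fun_differentiable[OF \<eta>] test_fun_differentiable[OF \<phi>]])
    have lim2: "(\<lambda>m. \<integral>x. ((\<chi> i. pd i (f m) x) $ i - G x $ i)\<^sup>2 \<partial>cubeM) \<longlonglongrightarrow> 0" for i
    proof (rule L2_dominated(3))
      show "(\<lambda>x. (\<chi> i. pd i (f m) x) $ i) \<in> borel_measurable cubeM" for m
        using sqint_measurable[OF sqint_test_fun[OF test_fun_pd[OF f]]] by simp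
      show "(\<lambda>x. G x $ i) \<in> borel_measurable cubeM" by (rule sqint_measurable[OF sG])
      show "AE x in cubeM. \<bar>(\<chi> i. pd i (f m) x) $ i\<bar> \<le> C * B + C * B' i" for m
        using bd(1)[of m] bd(2)[of i m] B B'[of i]
      proof eventually_elim
        case (elim x)
        have "\<bar>pd i (f m) x\<bar> \<le> \<bar>pd i (\<eta> m) x * \<phi> x\<bar> + \<bar>\<eta> m x * pd i \<phi> x\<bar>" unfolding pdf by (rule abs_triangle_ineq)
        also have "\<dots> \<le> C * B + C * B' i" using elim by (intro add_mono mult_le)
        finally show ?case by simp
      qed
      show "AE x in cubeM. (\<lambda>m. (\<chi> i. pd i (f m) x) $ i) \<longlonglongrightarrow> G x $ i"
        using lim glim[of i] by eventually_elim (auto simp: pdf G_def intro!: tendsto_intros)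
    qed
    note h1l = h1_limit[of f "\<lambda>m x. \<chi> i. pd i (f m) x" "\<lambda>x. l x * \<phi> x" G]
    have L: "has_weak_grad (\<lambda>x. l x * \<phi> x) G" "(\<lambda>m. h1sq (\<lambda>x. f m x - l x * \<phi> x)) \<longlonglongrightarrow> 0"
      by (rule h1l(1), rule sqint_test_fun[OF f], rule has_weak_grad_test_fun[OF f], rule sl, rule sG, rule lim1, rule lim2)
        (rule h1l(2), rule sqint_test_fun[OF f], rule has_weak_grad_test_fun[OF f], rule sl, rule sG, rule lim1, rule lim2)
    show *: "has_weak_grad (\<lambda>x. l x * \<phi> x) (\<lambda>x. \<chi> i. g i x * \<phi> x + l x * pd i \<phi> x)"
      using L(1) by (simp add: G_def)
    show "(\<lambda>x. l x * \<phi> x) \<in> H1_closure T"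
      unfolding H1_closure_def using H1perI[OF sl *] L(2) T(2)[OF \<phi>] by (auto simp: f_def intro!: exI[of _ f])
  qed
  \<comment> \<open>The second limit: multiplication by \<open>l\<close> is bounded in H1 because
    \<open>l\<close> and \<open>g\<close> are bounded, so the approximation of \<open>u\<close> by
    test functions is carried along.\<close>
  obtain \<phi> where \<phi>: "\<And>m. test_fun (\<phi> m)" "(\<lambda>m. h1sq (\<lambda>x. \<phi> m x - u x)) \<longlonglongrightarrow> 0"
    using test_fun_dense[OF u] unfolding H1_closure_def by auto
  note su = H1per_sqint[OF u] H1per_wgrad_sqint[OF u]
  define G where "G = (\<lambda>x. \<chi> i. g i x * u x + l x * wgrad u x $ i)"
  have sl: "sqint cubeM (\<lambda>x. l x * u x)" by (rule sqint_bounded_mult[OF su(1) l lbd])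
  have sG: "sqint cubeM (\<lambda>x. G x $ i)" for i
    unfolding G_def using su by (auto intro!: sqint_add sqint_bounded_mult[OF _ gm gbd] sqint_bounded_mult[OF _ l lbd])
  have sd: "sqint cubeM (\<lambda>x. \<phi> m x - u x)" "sqint cubeM (\<lambda>x. pd i (\<phi> m) x - wgrad u x $ i)" for m i
    by (intro sqint_diff sqint_test_fun test_fun_pd \<phi>(1) su)+
  note h1 = h1sq_test_diff_ge(1)[OF \<phi>(1) u] and h2 = h1sq_test_diff_ge(2)[OF \<phi>(1) u]
  have lim1: "(\<lambda>m. \<integral>x. (l x * \<phi> m x - l x * u x)\<^sup>2 \<partial>cubeM) \<longlonglongrightarrow> 0"
  proof (rule tendsto_sandwich[OF _ _ tendsto_const])
    show "(\<lambda>m. C\<^sup>2 * h1sq (\<lambda>x. \<phi> m x - u x)) \<longlonglongrightarrow> 0" by (rule tendsto_mult_right_zero[OF \<phi>(2)])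
    show "\<forall>\<^sub>F m in sequentially. (\<integral>x. (l x * \<phi> m x - l x * u x)\<^sup>2 \<partial>cubeM) \<le> C\<^sup>2 * h1sq (\<lambda>x. \<phi> m x - u x)"
    proof (intro always_eventually allI)
      fix m
      have "(\<integral>x. (l x * \<phi> m x - l x * u x)\<^sup>2 \<partial>cubeM) \<le> C\<^sup>2 * (\<integral>x. (\<phi> m x - u x)\<^sup>2 \<partial>cubeM)"
        using L2_bounded_mult_le[OF sd(1) l lbd] by (simp add: right_diff_distrib)
      also have "\<dots> \<le> C\<^sup>2 * h1sq (\<lambda>x. \<phi> m x - u x)" by (intro mult_left_mono h1) auto
      finally show "(\<integral>x. (l x * \<phi> m x - l x * u x)\<^sup>2 \<partial>cubeM) \<le> C\<^sup>2 * h1sq (\<lambda>x. \<phi> m x - u x)" .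
    qed
  qed (auto intro!: always_eventually Bochner_Integration.integral_nonneg)
  have lim2: "(\<lambda>m. \<integral>x. ((\<chi> i. g i x * \<phi> m x + l x * pd i (\<phi> m) x) $ i - G x $ i)\<^sup>2 \<partial>cubeM) \<longlonglongrightarrow> 0" for i
  proof (rule tendsto_sandwich[OF _ _ tendsto_const])
    show "(\<lambda>m. (4 * C\<^sup>2) * h1sq (\<lambda>x. \<phi> m x - u x)) \<longlonglongrightarrow> 0" by (rule tendsto_mult_right_zero[OF \<phi>(2)])
    show "\<forall>\<^sub>F m in sequentially. (\<integral>x. ((\<chi> i. g i x * \<phi> m x + l x * pd i (\<phi> m) x) $ i - G x $ i)\<^sup>2 \<partial>cubeM)
        \<le> (4 * C\<^sup>2) * h1sq (\<lambda>x. \<phi> m x - u x)"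
    proof (intro always_eventually allI)
      fix m
      let ?p = "\<lambda>x. g i x * (\<phi> m x - u x)" and ?q = "\<lambda>x. l x * (pd i (\<phi> m) x - wgrad u x $ i)"
      have sp: "sqint cubeM ?p" "sqint cubeM ?q"
        by (intro sqint_bounded_mult[OF sd(1) gm gbd] sqint_bounded_mult[OF sd(2) l lbd])+
      have "(\<integral>x. ((\<chi> i. g i x * \<phi> m x + l x * pd i (\<phi> m) x) $ i - G x $ i)\<^sup>2 \<partial>cubeM) = (\<integral>x. (?p x + ?q x)\<^sup>2 \<partial>cubeM)"
        by (simp add: G_def algebra_simps)
      also have "\<dots> \<le> (\<integral>x. 2 * (?p x)\<^sup>2 + 2 * (?q x)\<^sup>2 \<partial>cubeM)"
      proof (rule integral_mono)
        show "integrable cubeM (\<lambda>x. (?p x + ?q x)\<^sup>2)" using sqint_add[OF sp] by (simp add: sqint_def)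
        show "integrable cubeM (\<lambda>x. 2 * (?p x)\<^sup>2 + 2 * (?q x)\<^sup>2)" using sp by (simp add: sqint_def)
        show "(?p x + ?q x)\<^sup>2 \<le> 2 * (?p x)\<^sup>2 + 2 * (?q x)\<^sup>2" for x
          using square_lincomb_le[of 1 "?p x" 1 "?q x"] by simp
      qed
      also have "\<dots> = 2 * (\<integral>x. (?p x)\<^sup>2 \<partial>cubeM) + 2 * (\<integral>x. (?q x)\<^sup>2 \<partial>cubeM)"
        using sp by (simp add: sqint_def)
      also have "(\<integral>x. (?p x)\<^sup>2 \<partial>cubeM) \<le> C\<^sup>2 * h1sq (\<lambda>x. \<phi> m x - u x)"
        by (rule order_trans[OF L2_bounded_mult_le[OF sd(1) gm gbd]]) (intro mult_left_mono h1, simp)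
      also have "(\<integral>x. (?q x)\<^sup>2 \<partial>cubeM) \<le> C\<^sup>2 * h1sq (\<lambda>x. \<phi> m x - u x)"
        by (rule order_trans[OF L2_bounded_mult_le[OF sd(2) l lbd]]) (intro mult_left_mono h2, simp)
      finally show "(\<integral>x. ((\<chi> i. g i x * \<phi> m x + l x * pd i (\<phi> m) x) $ i - G x $ i)\<^sup>2 \<partial>cubeM)
        \<le> (4 * C\<^sup>2) * h1sq (\<lambda>x. \<phi> m x - u x)" by simp
    qed
  qed (auto intro!: always_eventually Bochner_Integration.integral_nonneg)
  note h1l = h1_limit[of "\<lambda>m x. l x * \<phi> m x" "\<lambda>m x. \<chi> i. g i x * \<phi> m x + l x * pd i (\<phi> m) x" "\<lambda>x. l x * u x" G]
  have L: "has_weak_grad (\<lambda>x. l x * u x) G" "(\<lambda>m. h1sq (\<lambda>x. l x * \<phi> m x - l x * u x)) \<longlonglongrightarrow> 0"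
    by (rule h1l(1), rule test(3)[OF \<phi>(1)], rule test(1)[OF \<phi>(1)], rule sl, rule sG, rule lim1, rule lim2)
      (rule h1l(2), rule test(3)[OF \<phi>(1)], rule test(1)[OF \<phi>(1)], rule sl, rule sG, rule lim1, rule lim2)
  show ?thesis by (rule H1_closure_closed[OF TH test(2)[OF \<phi>(1)] H1perI[OF sl L(1)] L(2)])
qed

subsection \<open>Smooth functions of one variable\<close>

text \<open>Order 0 imposes no condition, which trivialises the base cases below; having the
  property for every \<open>n\<close> still means smoothness.\<close>

fun Ck :: "nat \<Rightarrow> (real \<Rightarrow> real) \<Rightarrow> bool" where
  "Ck 0 f \<longleftrightarrow> True"
| "Ck (Suc n) f \<longleftrightarrow> (\<exists>f'. (\<forall>t. (f has_real_derivative f' t) (at t)) \<and> Ck n f')"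

lemma Ck_SucD: "Ck (Suc n) f \<Longrightarrow> Ck n f"
proof (induction n arbitrary: f)
  case (Suc n)
  from Suc.prems obtain f' where f': "\<forall>t. (f has_real_derivative f' t) (at t)" "Ck (Suc n) f'"
    unfolding Ck.simps(2)[of "Suc n" f] by blast
  then show ?case using Suc.IH[of f'] unfolding Ck.simps(2)[of n f] by blast
qed simp

lemma Ck_SucI: "(\<And>t. (f has_real_derivative f' t) (at t)) \<Longrightarrow> Ck n f' \<Longrightarrow> Ck (Suc n) f"
  unfolding Ck.simps(2) by blast

lemma Ck_SucE:
  assumes "Ck (Suc n) f"
  obtains f' where "\<And>t. (f has_real_derivative f' t) (at t)" "Ck n f'"
  using assms unfolding Ck.simps(2) by blast

declare Ck.simps(2) [simp del]

lemma Ck_const: "Ck n (\<lambda>t. c)"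
proof (induction n arbitrary: c)
  case (Suc n)
  show ?case by (rule Ck_SucI[OF DERIV_const Suc])
qed simp

lemma Ck_id: "Ck n (\<lambda>t. t)"
proof (cases n)
  case (Suc m)
  show ?thesis unfolding Suc by (rule Ck_SucI[OF DERIV_ident Ck_const])
qed simp

lemma Ck_add: "Ck n f \<Longrightarrow> Ck n g \<Longrightarrow> Ck n (\<lambda>t. f t + g t)"
proof (induction n arbitrary: f g)
  case (Suc n)
  obtain f' where f': "\<And>t. (f has_real_derivative f' t) (at t)" "Ck n f'" using Suc.prems(1) by (rule Ck_SucE) blast
  obtain g' where g': "\<And>t. (g has_real_derivative g' t) (at t)" "Ck n g'" using Suc.prems(2) by (rule Ck_SucE) blast
  show ?case by (rule Ck_SucI[OF DERIV_add[OF f'(1) g'(1)] Suc.IH[OF f'(2) g'(2)]])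
qed simp

lemma Ck_mult: "Ck n f \<Longrightarrow> Ck n g \<Longrightarrow> Ck n (\<lambda>t. f t * g t)"
proof (induction n arbitrary: f g)
  case (Suc n)
  obtain f' where f': "\<And>t. (f has_real_derivative f' t) (at t)" "Ck n f'" using Suc.prems(1) by (rule Ck_SucE) blast
  obtain g' where g': "\<And>t. (g has_real_derivative g' t) (at t)" "Ck n g'" using Suc.prems(2) by (rule Ck_SucE) blast
  have "Ck n (\<lambda>t. f' t * g t + g' t * f t)"
    by (rule Ck_add[OF Suc.IH[OF f'(2) Ck_SucD[OF Suc.prems(2)]] Suc.IH[OF g'(2) Ck_SucD[OF Suc.prems(1)]]])
  then show ?case by (rule Ck_SucI[OF DERIV_mult[OF f'(1) g'(1)]])
qed simp

lemma Ck_compose: "Ck n f \<Longrightarrow> Ck n g \<Longrightarrow> Ck n (\<lambda>t. f (g t))"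
proof (induction n arbitrary: f g)
  case (Suc n)
  obtain f' where f': "\<And>t. (f has_real_derivative f' t) (at t)" "Ck n f'" using Suc.prems(1) by (rule Ck_SucE) blast
  obtain g' where g': "\<And>t. (g has_real_derivative g' t) (at t)" "Ck n g'" using Suc.prems(2) by (rule Ck_SucE) blast
  have "Ck n (\<lambda>t. f' (g t) * g' t)"
    by (rule Ck_mult[OF Suc.IH[OF f'(2) Ck_SucD[OF Suc.prems(2)]] g'(2)])
  then show ?case by (rule Ck_SucI[OF DERIV_chain2[OF f'(1) g'(1)]])
qed simp

text \<open>\<open>Ck\<close> asserts only some derivative at each order. Uniqueness identifies it
  with \<open>deriv f\<close> at all orders, so the step can be iterated.\<close>

lemma smooth1_derivs:
  assumes "\<And>n. Ck n f"
  shows "smooth1 (\<lambda>k. (deriv ^^ k) f)"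
proof -
  have step: "(\<forall>t. (f has_real_derivative deriv f t) (at t)) \<and> (\<forall>n. Ck n (deriv f))" if f: "\<And>n. Ck n f" for f
  proof -
    have "\<exists>f'. (\<forall>t. (f has_real_derivative f' t) (at t)) \<and> Ck n f'" for n using f[of "Suc n"] unfolding Ck.simps(2) .
    moreover have "f' = deriv f" if "\<forall>t. (f has_real_derivative f' t) (at t)" for f'
      using that by (intro ext DERIV_imp_deriv[symmetric]) simp
    ultimately show ?thesis by metis
  qed
  have "\<forall>n. Ck n ((deriv ^^ k) f)" for k
    by (induction k) (use assms step in auto)
  then show ?thesis unfolding smooth1_def using step by simp
qed

text \<open>Serves to make all derivatives of a smoothed hat vanish outside its support, as its
  periodisation requires.\<close>

lemma smooth1_eq_0:
  assumes h: "smooth1 h" and S: "open S" "\<And>t. t \<in> S \<Longrightarrow> h 0 t = 0" and t: "t \<in> S"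
  shows "h k t = 0"
  using t
proof (induction k arbitrary: t)
  case (Suc k)
  have "((\<lambda>t. 0) has_real_derivative h (Suc k) t) (at t)"
    by (rule has_field_derivative_transform_within_open[of "h k" _ t S])
      (use h Suc S in \<open>auto simp: smooth1_def\<close>)
  then show ?case using DERIV_unique[OF _ DERIV_const] by blast
qed (rule S(2))

text \<open>The classical flat function is the member \<open>j = 0\<close>; the powers of
  \<open>1 / t\<close> are added so that the derivative of each member is a combination of
  members.\<close>

definition flat :: "nat \<Rightarrow> real \<Rightarrow> real" where
  "flat j t = (if t > 0 then exp (- (1 / t)) / t ^ j else 0)"

lemma DERIV_flat: "(flat j has_real_derivative flat (j + 2) t + - real j * flat (j + 1) t) (at t)"
proof -
  consider "t > 0" | "t < 0" | "t = 0" by linarith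
  then show ?thesis
  proof cases
    case 1
    have "((\<lambda>t. exp (- (1 / t)) / t ^ j) has_real_derivative flat (j + 2) t + - real j * flat (j + 1) t) (at t)"
    proof (cases j)
      case 0
      then show ?thesis using 1
        by (auto simp: flat_def power2_eq_square intro!: derivative_eq_intros)
    next
      case (Suc i)
      have e: "((\<lambda>t. exp (- (1 / t))) has_real_derivative exp (- (1 / t)) * (1 / (t * t))) (at t)"
        using 1 by (auto intro!: derivative_eq_intros)
      have p: "((\<lambda>t. t ^ Suc i) has_real_derivative (1 + real i) * (1 * t ^ i)) (at t)"
        using DERIV_power_Suc[OF DERIV_ident, of i t UNIV] by simp
      have "((\<lambda>t. exp (- (1 / t)) / t ^ Suc i) has_real_derivative
          (exp (- (1 / t)) * (1 / (t * t)) * t ^ Suc i - exp (- (1 / t)) * ((1 + real i) * (1 * t ^ i))) / (t ^ Suc i * t ^ Suc i)) (at t)"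
        by (rule DERIV_divide[OF e p]) (use 1 in simp)
      moreover have "(exp (- (1 / t)) * (1 / (t * t)) * t ^ Suc i - exp (- (1 / t)) * ((1 + real i) * (1 * t ^ i))) / (t ^ Suc i * t ^ Suc i)
          = flat (j + 2) t + - real j * flat (j + 1) t"
        using 1 by (simp add: flat_def Suc field_simps)
      ultimately show ?thesis by (simp add: Suc)
    qed
    then show ?thesis
      by (rule has_field_derivative_transform_within_open[where S = "{0<..}"]) (use 1 in \<open>auto simp: flat_def\<close>)
  next
    case 2
    have "((\<lambda>t. 0) has_real_derivative 0) (at t)" by simp
    then have "(flat j has_real_derivative 0) (at t)"
      by (rule has_field_derivative_transform_within_open[where S = "{..<0}"]) (use 2 in \<open>auto simp: flat_def\<close>)
    then show ?thesis using 2 by (simp add: flat_def)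
  next
    case 3
    \<comment> \<open>With \<open>y\<close> for \<open>1 / h\<close>, flatness at the origin is the
      dominance of the exponential over powers at infinity.\<close>
    have "((\<lambda>y. y ^ (j + 1) / exp (y :: real)) \<longlongrightarrow> 0) at_top" by (rule tendsto_power_div_exp_0)
    from filterlim_compose[OF this filterlim_inverse_at_top_right]
    have "((\<lambda>h. inverse h ^ (j + 1) / exp (inverse h)) \<longlongrightarrow> 0) (at_right (0::real))" .
    then have r: "((\<lambda>h. flat j h / h) \<longlongrightarrow> 0) (at_right 0)"
      by (rule Lim_transform_eventually)
        (auto simp: eventually_at_right_field flat_def exp_minus field_simps intro!: exI[of _ 1])
    have "((\<lambda>h. flat j h / h) \<longlongrightarrow> 0) (at_left 0)"
      by (rule tendsto_eventually) (auto simp: eventually_at_left_field flat_def intro!: exI[of _ "-1"])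
    with r have "((\<lambda>h. flat j h / h) \<longlongrightarrow> 0) (at 0)" by (simp add: filterlim_split_at)
    then show ?thesis using 3 by (simp add: DERIV_def flat_def)
  qed
qed

lemma Ck_flat: "Ck n (flat j)"
proof (induction n arbitrary: j)
  case (Suc n)
  have "Ck n (\<lambda>t. flat (j + 2) t + - real j * flat (j + 1) t)"
    by (intro Ck_add Ck_mult Ck_const Suc.IH)
  then show ?case by (rule Ck_SucI[OF DERIV_flat])
qed simp

text \<open>For t > 0 this is t exp(-s/t), a smooth approximation of the positive part of t from below.\<close>

definition soft_pos :: "real \<Rightarrow> real \<Rightarrow> real" where
  "soft_pos s t = t * flat 0 (t * (1 / s))"

definition soft_pos' :: "real \<Rightarrow> real \<Rightarrow> real" where
  "soft_pos' s t = (if t > 0 then exp (- (s / t)) * (1 + s / t) else 0)"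

lemma soft_pos_eq: "s > 0 \<Longrightarrow> soft_pos s t = (if t > 0 then t * exp (- (s / t)) else 0)"
  by (auto simp: soft_pos_def flat_def zero_less_divide_iff)

lemma Ck_soft_pos: "Ck n (soft_pos s)"
  unfolding soft_pos_def by (rule Ck_mult[OF Ck_id Ck_compose[OF Ck_flat Ck_mult[OF Ck_id Ck_const]]])

lemma DERIV_soft_pos:
  assumes s: "s > 0"
  shows "(soft_pos s has_real_derivative soft_pos' s t) (at t)"
proof -
  have "(soft_pos s has_real_derivative (flat 0 (t * (1 / s)) + t * (flat 2 (t * (1 / s)) * (1 / s)))) (at t)"
  proof -
    have f: "(flat 0 has_real_derivative flat 2 z) (at z)" for z using DERIV_flat[of 0 z] by (simp add: numeral_2_eq_2)
    have "((\<lambda>t. flat 0 (t * (1 / s))) has_real_derivative flat 2 (t * (1 / s)) * (1 / s)) (at t)"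
      by (rule DERIV_chain2[OF f]) (use DERIV_cmult_right[OF DERIV_ident, of "1 / s"] in simp)
    from DERIV_mult[OF DERIV_ident this] show ?thesis
      unfolding soft_pos_def by (simp add: algebra_simps)
  qed
  moreover have "flat 0 (t * (1 / s)) + t * (flat 2 (t * (1 / s)) * (1 / s)) = soft_pos' s t"
    using s by (auto simp: flat_def soft_pos'_def zero_less_divide_iff power2_eq_square field_simps)
  ultimately show ?thesis by simp
qed

text \<open>For \<open>t > 0\<close> and x = s/t the upper bound is exp(-x) (1 + x) \<le> 1. It is
  uniform in \<open>s\<close>, which keeps the gradients of the approximations bounded.\<close>

lemma soft_pos'_bounds:
  assumes "s > 0"
  shows "0 \<le> soft_pos' s t" "soft_pos' s t \<le> 1"
proof -
  have "exp (- (s / t)) * (1 + s / t) \<le> exp (- (s / t)) * exp (s / t)"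
    by (intro mult_left_mono exp_ge_add_one_self) auto
  also have "\<dots> = 1" by (simp add: exp_minus)
  finally show "soft_pos' s t \<le> 1" by (simp add: soft_pos'_def)
  show "0 \<le> soft_pos' s t" using assms by (auto simp: soft_pos'_def intro!: mult_nonneg_nonneg add_nonneg_nonneg)
qed

text \<open>From exp(-x) \<ge> 1 - x with x = s/t: the error is at most \<open>s\<close>, uniformly
  in \<open>t\<close>.\<close>

lemma soft_pos_bounds:
  assumes s: "s > 0"
  shows "0 \<le> soft_pos s t" "soft_pos s t \<le> max 0 t" "max 0 t - s \<le> soft_pos s t"
proof -
  show "0 \<le> soft_pos s t" using s by (auto simp: soft_pos_eq)
  show "soft_pos s t \<le> max 0 t" using s by (auto simp: soft_pos_eq mult_left_le)
  show "max 0 t - s \<le> soft_pos s t"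
  proof (cases "t > 0")
    case True
    have "1 - s / t \<le> exp (- (s / t))" using exp_ge_add_one_self[of "- (s / t)"] by simp
    then have "t * (1 - s / t) \<le> t * exp (- (s / t))" using True by (intro mult_left_mono) auto
    then show ?thesis using True s by (simp add: soft_pos_eq right_diff_distrib)
  qed (use s in \<open>auto simp: soft_pos_eq\<close>)
qed

lemma tendsto_soft_pos:
  assumes s: "\<And>m. s m > 0" "s \<longlonglongrightarrow> 0" and a: "a \<longlonglongrightarrow> b"
  shows "(\<lambda>m. soft_pos (s m) (a m)) \<longlonglongrightarrow> max 0 b"
proof (rule tendsto_sandwich)
  show "(\<lambda>m. max 0 (a m) - s m) \<longlonglongrightarrow> max 0 b"
    using tendsto_diff[OF tendsto_max[OF tendsto_const a, of 0] s(2)] by simp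
  show "(\<lambda>m. max 0 (a m)) \<longlonglongrightarrow> max 0 b" by (intro tendsto_max tendsto_const a)
qed (auto intro!: always_eventually soft_pos_bounds s)

text \<open>At the kink \<open>b = 0\<close> the behaviour would depend on the ratio of
  \<open>s m\<close> to \<open>a m\<close>; away from it the limit is 1 or 0.\<close>

lemma convergent_soft_pos':
  assumes s: "\<And>m. s m > 0" "s \<longlonglongrightarrow> 0" and a: "a \<longlonglongrightarrow> b" and b: "b \<noteq> 0"
  shows "convergent (\<lambda>m. soft_pos' (s m) (a m))"
proof (cases "b > 0")
  case True
  have "(\<lambda>m. exp (- (s m / a m)) * (1 + s m / a m)) \<longlonglongrightarrow> exp (- (0 / b)) * (1 + 0 / b)"
    by (intro tendsto_intros s a) (use True in auto)
  then have "(\<lambda>m. soft_pos' (s m) (a m)) \<longlonglongrightarrow> exp (- (0 / b)) * (1 + 0 / b)"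
    by (rule Lim_transform_eventually)
      (use order_tendstoD(1)[OF a True] in \<open>auto simp: soft_pos'_def elim: eventually_mono\<close>)
  then show ?thesis by (rule convergentI)
next
  case False
  then have "b < 0" using b by simp
  have "(\<lambda>m. soft_pos' (s m) (a m)) \<longlonglongrightarrow> 0"
    by (rule tendsto_eventually)
      (use order_tendstoD(2)[OF a \<open>b < 0\<close>] in \<open>auto simp: soft_pos'_def elim: eventually_mono\<close>)
  then show ?thesis by (rule convergentI)
qed

subsection \<open>Smoothed hat functions\<close>

text \<open>If \<open>f\<close> vanishes for \<open>\<bar>t\<bar> \<ge> 1\<close>, these are the
  only two integer translates that can be nonzero at \<open>t\<close>, so this is the full
  periodisation, in the shape used by \<open>hat\<close>.\<close>

definition per :: "(real \<Rightarrow> real) \<Rightarrow> real \<Rightarrow> real" where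
  "per f t = f (t - of_int \<lfloor>t\<rfloor>) + f (t - of_int \<lfloor>t\<rfloor> - 1)"

lemma per_plus_1: "per f (t + 1) = per f t"
  by (simp add: per_def)

text \<open>The floor in \<open>per\<close> jumps at integers. On an open interval around [p, p + 1]
  four fixed translates give a formula without a floor, from which continuity and differentiability
  can be read off.\<close>

lemma per_local:
  fixes p :: int
  assumes f: "\<And>t. \<bar>t\<bar> \<ge> 1 \<Longrightarrow> f t = 0" and t: "of_int p - 1 < t" "t < of_int p + 2"
  shows "per f t = f (t - of_int p + 1) + f (t - of_int p) + f (t - of_int p - 1) + f (t - of_int p - 2)"
proof -
  have b: "of_int \<lfloor>t\<rfloor> \<le> t" "t < of_int \<lfloor>t\<rfloor> + 1" by linarith+
  have "\<lfloor>t\<rfloor> = p - 1 \<or> \<lfloor>t\<rfloor> = p \<or> \<lfloor>t\<rfloor> = p + 1" using t by linarith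
  then consider "\<lfloor>t\<rfloor> = p - 1" | "\<lfloor>t\<rfloor> = p" | "\<lfloor>t\<rfloor> = p + 1" by blast
  then show ?thesis
  proof cases
    case 1
    then have r: "of_int \<lfloor>t\<rfloor> = (of_int p :: real) - 1" by simp
    have "f (t - of_int p - 1) = 0" "f (t - of_int p - 2) = 0" by (rule f, use r b in linarith)+
    moreover have e: "t - of_int \<lfloor>t\<rfloor> = t - of_int p + 1" "t - of_int p + 1 - 1 = t - of_int p" using 1 by simp_all
    ultimately show ?thesis unfolding per_def e by simp
  next
    case 2
    then have r: "of_int \<lfloor>t\<rfloor> = (of_int p :: real)" by simp
    have "f (t - of_int p + 1) = 0" "f (t - of_int p - 2) = 0" by (rule f, use r b in linarith)+
    then show ?thesis unfolding per_def 2 by simp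
  next
    case 3
    then have r: "of_int \<lfloor>t\<rfloor> = (of_int p :: real) + 1" by simp
    have "f (t - of_int p + 1) = 0" "f (t - of_int p) = 0" by (rule f, use r b in linarith)+
    moreover have e: "t - of_int \<lfloor>t\<rfloor> = t - of_int p - 1" "t - of_int p - 1 - 1 = t - of_int p - 2" using 3 by simp_all
    ultimately show ?thesis unfolding per_def e by simp
  qed
qed

lemma isCont_per:
  assumes f: "\<And>t. \<bar>t\<bar> \<ge> 1 \<Longrightarrow> f t = 0" and c: "\<And>t. isCont f t"
  shows "isCont (per f) t"
proof -
  let ?p = "of_int \<lfloor>t\<rfloor> :: real"
  let ?g = "\<lambda>t. f (t - ?p + 1) + f (t - ?p) + f (t - ?p - 1) + f (t - ?p - 2)"
  have "isCont ?g t" by (intro continuous_intros isCont_o2[OF _ c])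
  moreover have ev: "\<forall>\<^sub>F s in nhds t. per f s = ?g s"
  proof (rule eventually_nhds_in_open[THEN eventually_mono])
    show "open {?p - 1 <..< ?p + 2}" by simp
    show "t \<in> {?p - 1 <..< ?p + 2}" unfolding greaterThanLessThan_iff by linarith
    show "per f s = ?g s" if "s \<in> {?p - 1 <..< ?p + 2}" for s
      using that by (intro per_local f) auto
  qed
  ultimately show ?thesis by (simp only: isCont_cong[OF ev])
qed

lemma DERIV_per:
  assumes f: "\<And>t. \<bar>t\<bar> \<ge> 1 \<Longrightarrow> f t = 0" "\<And>t. \<bar>t\<bar> \<ge> 1 \<Longrightarrow> f' t = 0"
    and D: "\<And>t. (f has_real_derivative f' t) (at t)"
  shows "(per f has_real_derivative per f' t) (at t)"
proof -
  let ?p = "of_int \<lfloor>t\<rfloor> :: real"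
  have t: "t \<in> {?p - 1 <..< ?p + 2}" unfolding greaterThanLessThan_iff by linarith
  let ?g = "\<lambda>f t. f (t - ?p + 1) + f (t - ?p) + f (t - ?p - 1) + f (t - ?p - 2)"
  have sh: "((\<lambda>t. f (t + c)) has_real_derivative f' (t + c)) (at t)" for c
    using D[of "t + c"] by (simp add: DERIV_shift)
  have "(?g f has_real_derivative ?g f' t) (at t)"
    using DERIV_add[OF DERIV_add[OF DERIV_add[OF sh[of "- ?p + 1"] sh[of "- ?p"]] sh[of "- ?p - 1"]] sh[of "- ?p - 2"]]
    by (simp add: algebra_simps)
  then have "(per f has_real_derivative ?g f' t) (at t)"
    by (rule has_field_derivative_transform_within_open[OF _ _ t])
      (auto intro!: per_local[symmetric] f(1))
  moreover have "?g f' t = per f' t" using t by (intro per_local[symmetric] f(2)) auto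
  ultimately show ?thesis by simp
qed

definition ramp :: "nat \<Rightarrow> real \<Rightarrow> real" where
  "ramp n t = max 0 (1 - \<bar>t\<bar> * real n)"

lemma hat_eq_per: "hat n = per (ramp n)"
  by (auto simp: hat_def per_def ramp_def)

lemma ramp_eq_0: "n \<ge> 1 \<Longrightarrow> \<bar>t\<bar> \<ge> 1 \<Longrightarrow> ramp n t = 0"
  using mult_mono[of 1 "\<bar>t\<bar>" 1 "real n"] by (simp add: ramp_def)

lemma isCont_hat: "n \<ge> 1 \<Longrightarrow> isCont (hat n) t"
  unfolding hat_eq_per by (rule isCont_per[OF ramp_eq_0]) (auto simp: ramp_def intro!: continuous_intros)

lemma continuous_lam: "n \<ge> 1 \<Longrightarrow> continuous_on UNIV (lam n k)"
  unfolding lam_def continuous_on_eq_continuous_at[OF open_UNIV]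
  by (intro ballI continuous_intros isCont_o2[OF _ isCont_hat])

text \<open>The shift by 2s moves the support strictly inside that of the ramp.\<close>

definition spike :: "nat \<Rightarrow> real \<Rightarrow> real \<Rightarrow> real" where
  "spike n s t = soft_pos s (1 + - real n * (soft_pos s t + soft_pos s (- 1 * t) + 2 * s))"

definition spike' :: "nat \<Rightarrow> real \<Rightarrow> real \<Rightarrow> real" where
  "spike' n s t = soft_pos' s (1 + - real n * (soft_pos s t + soft_pos s (- 1 * t) + 2 * s)) *
    (- real n * (soft_pos' s t - soft_pos' s (- 1 * t)))"

lemma Ck_spike: "Ck k (spike n s)"
  unfolding spike_def
  by (rule Ck_compose[OF Ck_soft_pos Ck_add[OF Ck_const Ck_mult[OF Ck_const Ck_add[OF Ck_add[OF Ck_soft_pos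
     Ck_compose[OF Ck_soft_pos Ck_mult[OF Ck_const Ck_id]]] Ck_const]]]])

lemma DERIV_spike:
  assumes s: "s > 0"
  shows "(spike n s has_real_derivative spike' n s t) (at t)"
proof -
  have 1: "((\<lambda>t. soft_pos s (- 1 * t)) has_real_derivative soft_pos' s (- 1 * t) * (- 1)) (at t)"
    by (rule DERIV_chain2[OF DERIV_soft_pos[OF s]]) (auto intro!: derivative_eq_intros)
  have 2: "((\<lambda>t. 1 + - real n * (soft_pos s t + soft_pos s (- 1 * t) + 2 * s)) has_real_derivative
      - real n * (soft_pos' s t - soft_pos' s (- 1 * t))) (at t)"
    using DERIV_add[OF DERIV_const DERIV_cmult[OF DERIV_add[OF DERIV_add[OF DERIV_soft_pos[OF s] 1] DERIV_const]],
        of 1 "- real n" "2 * s"] by simp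
  show ?thesis
    unfolding spike_def[abs_def] spike'_def by (rule DERIV_chain2[OF DERIV_soft_pos[OF s] 2])
qed

lemma soft_abs_bounds:
  assumes s: "s > 0"
  shows "\<bar>t\<bar> - s \<le> soft_pos s t + soft_pos s (- 1 * t)" "0 \<le> soft_pos s t + soft_pos s (- 1 * t)"
  using soft_pos_bounds[OF s, of t] soft_pos_bounds[OF s, of "- 1 * t"] by (auto simp: max_def split: if_splits)

text \<open>The smoothed modulus falls short of \<open>\<bar>t\<bar>\<close> by at most
  \<open>s\<close>; of the shift \<open>2 * s\<close> a margin \<open>s\<close> therefore
  remains.\<close>

lemma spike_support:
  assumes n: "n \<ge> 1" and s: "s > 0" and t: "1 - real n * s \<le> \<bar>t\<bar> * real n"
  shows "spike n s t = 0"
proof -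
  have "real n * (\<bar>t\<bar> - s) \<le> real n * (soft_pos s t + soft_pos s (- 1 * t))"
    by (intro mult_left_mono soft_abs_bounds s) auto
  then have "1 + - real n * (soft_pos s t + soft_pos s (- 1 * t) + 2 * s) \<le> 0"
    using t by (simp add: algebra_simps)
  then show ?thesis unfolding spike_def using s by (simp add: soft_pos_eq)
qed

lemma spike_bounds:
  assumes s: "s > 0"
  shows "0 \<le> spike n s t" "spike n s t \<le> 1"
proof -
  show "0 \<le> spike n s t" unfolding spike_def by (rule soft_pos_bounds[OF s])
  have "0 \<le> real n * (soft_pos s t + soft_pos s (- 1 * t) + 2 * s)"
    using soft_abs_bounds(2)[OF s, of t] s by (intro mult_nonneg_nonneg) auto
  then have "max 0 (1 + - real n * (soft_pos s t + soft_pos s (- 1 * t) + 2 * s)) \<le> 1" by simp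
  then show "spike n s t \<le> 1" unfolding spike_def using soft_pos_bounds(2)[OF s] order_trans by blast
qed

lemma spike'_bounds:
  assumes s: "s > 0"
  shows "\<bar>spike' n s t\<bar> \<le> real n"
proof -
  let ?a = "soft_pos' s (1 + - real n * (soft_pos s t + soft_pos s (- 1 * t) + 2 * s))"
  have 1: "\<bar>?a\<bar> \<le> 1" using soft_pos'_bounds[OF s] by (simp add: abs_le_iff order_trans[of _ 0])
  have "\<bar>soft_pos' s t - soft_pos' s (- 1 * t)\<bar> \<le> 1"
    using soft_pos'_bounds[OF s, of t] soft_pos'_bounds[OF s, of "- 1 * t"] by linarith
  then have "\<bar>- real n * (soft_pos' s t - soft_pos' s (- 1 * t))\<bar> \<le> real n * 1"
    unfolding abs_mult by (intro mult_mono) auto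
  then have "\<bar>?a\<bar> * \<bar>- real n * (soft_pos' s t - soft_pos' s (- 1 * t))\<bar> \<le> 1 * (real n * 1)"
    using 1 by (intro mult_mono) auto
  then show ?thesis unfolding spike'_def abs_mult[of ?a] by simp
qed

definition smoothing :: "nat \<Rightarrow> real" where
  "smoothing m = 1 / (real m + 1)"

lemma smoothing: "smoothing m > 0" "smoothing \<longlonglongrightarrow> 0"
  using LIMSEQ_inverse_real_of_nat by (auto simp: smoothing_def[abs_def] inverse_eq_divide add.commute)

lemma tendsto_spike_arg:
  "(\<lambda>m. 1 + - real n * (soft_pos (smoothing m) t + soft_pos (smoothing m) (- 1 * t) + 2 * smoothing m)) \<longlonglongrightarrow> 1 - \<bar>t\<bar> * real n"
proof -
  have "(\<lambda>m. 1 + - real n * (soft_pos (smoothing m) t + soft_pos (smoothing m) (- 1 * t) + 2 * smoothing m))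
      \<longlonglongrightarrow> 1 + - real n * (max 0 t + max 0 (- 1 * t) + 2 * 0)"
    by (intro tendsto_intros tendsto_soft_pos smoothing)
  also have "max 0 t + max 0 (- 1 * t) + 2 * 0 = \<bar>t\<bar>" by (simp add: max_def)
  finally show ?thesis by (simp add: mult.commute)
qed

lemma tendsto_spike: "(\<lambda>m. spike n (smoothing m) t) \<longlonglongrightarrow> ramp n t"
  unfolding spike_def ramp_def by (rule tendsto_soft_pos[OF smoothing tendsto_spike_arg])

text \<open>The excluded points are the kinks of \<open>ramp\<close>, where an argument of
  \<open>soft_pos'\<close> tends to 0.\<close>

lemma convergent_spike':
  assumes "t \<noteq> 0" "\<bar>t\<bar> * real n \<noteq> 1"
  shows "convergent (\<lambda>m. spike' n (smoothing m) t)"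
proof -
  have "convergent (\<lambda>m. soft_pos' (smoothing m) (1 + - real n * (soft_pos (smoothing m) t + soft_pos (smoothing m) (- 1 * t) + 2 * smoothing m)))"
    by (rule convergent_soft_pos'[OF smoothing tendsto_spike_arg]) (use assms in simp)
  moreover have "convergent (\<lambda>m. soft_pos' (smoothing m) t)" "convergent (\<lambda>m. soft_pos' (smoothing m) (- 1 * t))"
    using assms by (auto intro!: convergent_soft_pos'[OF smoothing tendsto_const])
  ultimately show ?thesis
    unfolding spike'_def by (intro convergent_mult convergent_diff convergent_const)
qed

text \<open>Indexed by the order of the derivative, so that it is a sequence in the sense of
  \<open>smooth1\<close>.\<close>

definition shat :: "nat \<Rightarrow> real \<Rightarrow> nat \<Rightarrow> real \<Rightarrow> real" where
  "shat n s k = per ((deriv ^^ k) (spike n s))"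

lemma shat_0: "shat n s 0 = per (spike n s)"
  by (simp add: shat_def)

lemma shat_1: "s > 0 \<Longrightarrow> shat n s 1 = per (spike' n s)"
proof -
  assume "s > 0"
  then have "deriv (spike n s) = spike' n s" using DERIV_spike DERIV_imp_deriv by blast
  then show ?thesis by (simp add: shat_def)
qed

lemma smooth1_shat:
  assumes n: "n \<ge> 1" and s: "s > 0"
  shows "smooth1 (shat n s)"
proof -
  have sm: "smooth1 (\<lambda>k. (deriv ^^ k) (spike n s))" by (rule smooth1_derivs[OF Ck_spike])
  \<comment> \<open>Because of the margin, the spike vanishes on an open set containing all points
    with \<open>\<bar>t\<bar> \<ge> 1\<close>; so its derivatives vanish up to the endpoints, as
    \<open>DERIV_per\<close> demands.\<close>
  have z: "(deriv ^^ k) (spike n s) t = 0" if "\<bar>t\<bar> \<ge> 1" for k t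
  proof (rule smooth1_eq_0[OF sm, of "{t. 1 - real n * s < \<bar>t\<bar> * real n}"])
    show "open {t. 1 - real n * s < \<bar>t\<bar> * real n}"
      by (intro open_Collect_less continuous_intros)
    have "1 * 1 \<le> \<bar>t\<bar> * real n" using n that by (intro mult_mono) auto
    moreover have "real n * s > 0" using n s by simp
    ultimately show "t \<in> {t. 1 - real n * s < \<bar>t\<bar> * real n}" by simp
    show "(deriv ^^ 0) (spike n s) t = 0" if "t \<in> {t. 1 - real n * s < \<bar>t\<bar> * real n}" for t
      using that spike_support[OF n s] by simp
  qed
  show ?thesis
    unfolding smooth1_def shat_def
    by (intro allI DERIV_per z) (use sm in \<open>simp_all add: smooth1_def\<close>)
qed

definition slam :: "nat \<Rightarrow> nat \<Rightarrow> ('d::finite \<Rightarrow> nat) \<Rightarrow> real^'d \<Rightarrow> real" where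
  "slam n m k x = (\<Prod>i\<in>UNIV. shat n (smoothing m) 0 (x $ i - real (k i) / real n))"

lemma test_fun_slam:
  assumes n: "n \<ge> 1"
  shows "test_fun (slam n m k)"
  unfolding test_fun_def
proof
  show "smooth_fun (slam n m k)"
    unfolding slam_def[abs_def] by (intro smooth_fun_prod smooth_fun_coordinate smooth1_shat n smoothing)
  have "slam n m k (x + axis j 1) = slam n m k x" for x j
    unfolding slam_def
  proof (rule prod.cong[OF refl])
    fix i
    have "per f (x $ j + 1 - real (k j) / real n) = per f (x $ j - real (k j) / real n)" for f
      using per_plus_1[of f "x $ j - real (k j) / real n"] by (simp add: algebra_simps)
    then show "shat n (smoothing m) 0 ((x + axis j 1) $ i - real (k i) / real n) = shat n (smoothing m) 0 (x $ i - real (k i) / real n)"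
      by (cases "i = j") (simp_all add: axis_def shat_def)
  qed
  then show "periodic_fun (slam n m k)" by (simp add: periodic_fun_def)
qed

lemma pd_slam:
  assumes n: "n \<ge> 1"
  shows "pd i (slam n m k) x = shat n (smoothing m) 1 (x $ i - real (k i) / real n)
    * (\<Prod>j\<in>UNIV - {i}. shat n (smoothing m) 0 (x $ j - real (k j) / real n))"
proof -
  have "((\<lambda>s. shat n (smoothing m) 0 (s - real (k j) / real n)) has_real_derivative shat n (smoothing m) 1 (t - real (k j) / real n)) (at t)" for j t
  proof -
    have "(shat n (smoothing m) 0 has_real_derivative shat n (smoothing m) 1 (t + - (real (k j) / real n))) (at (t + - (real (k j) / real n)))"
      using smooth1_shat[OF n smoothing(1)[of m]] by (simp add: smooth1_def)
    then show ?thesis by (subst (asm) DERIV_shift) simp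
  qed
  from pd_prod_coordinate[OF this] show ?thesis by (simp add: slam_def[abs_def])
qed

lemma shat_bounds:
  shows "\<bar>shat n (smoothing m) 0 t\<bar> \<le> 2" "\<bar>shat n (smoothing m) 1 t\<bar> \<le> 2 * real n"
proof -
  have "\<bar>spike n (smoothing m) u\<bar> \<le> 1" for u using spike_bounds[OF smoothing(1), of n m u] by simp
  then have "\<bar>per (spike n (smoothing m)) t\<bar> \<le> 1 + 1"
    unfolding per_def by (intro order_trans[OF abs_triangle_ineq] add_mono)
  then show "\<bar>shat n (smoothing m) 0 t\<bar> \<le> 2" by (simp add: shat_0)
  have "\<bar>per (spike' n (smoothing m)) t\<bar> \<le> real n + real n"
    unfolding per_def by (intro order_trans[OF abs_triangle_ineq] add_mono spike'_bounds smoothing)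
  then show "\<bar>shat n (smoothing m) 1 t\<bar> \<le> 2 * real n" by (simp only: shat_1[OF smoothing(1)] mult_2)
qed

text \<open>The point is independence of \<open>m\<close>. The powers of 2 come from the two
  translates in \<open>per\<close>, the factor \<open>n\<close> from the slope of the ramp; one
  constant serves values and derivatives, as the multiplier theorem expects.\<close>

lemma slam_bounds:
  assumes n: "n \<ge> 1"
  shows "\<bar>slam n m (k :: 'd::finite \<Rightarrow> nat) x\<bar> \<le> 2 * real n * 2 ^ CARD('d)"
    and "\<bar>pd i (slam n m k) x\<bar> \<le> 2 * real n * 2 ^ CARD('d)"
proof -
  have P: "\<bar>\<Prod>j\<in>J. shat n (smoothing m) 0 (x $ j - real (k j) / real n)\<bar> \<le> 2 ^ CARD('d)" for J
  proof -
    have "\<bar>\<Prod>j\<in>J. shat n (smoothing m) 0 (x $ j - real (k j) / real n)\<bar> \<le> (\<Prod>j\<in>J. 2)"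
      unfolding abs_prod by (intro prod_mono) (auto simp: shat_bounds)
    also have "\<dots> = 2 ^ card J" by simp
    also have "\<dots> \<le> 2 ^ CARD('d)" by (intro power_increasing card_mono) auto
    finally show ?thesis .
  qed
  have c: "2 ^ CARD('d) \<le> 2 * real n * 2 ^ CARD('d)" using n by simp
  show "\<bar>slam n m k x\<bar> \<le> 2 * real n * 2 ^ CARD('d)"
    unfolding slam_def by (rule order_trans[OF P c])
  show "\<bar>pd i (slam n m k) x\<bar> \<le> 2 * real n * 2 ^ CARD('d)"
    unfolding pd_slam[OF n] abs_mult by (intro mult_mono shat_bounds P) auto
qed

lemma tendsto_shat: "(\<lambda>m. shat n (smoothing m) 0 t) \<longlonglongrightarrow> hat n t"
  unfolding shat_0 hat_eq_per per_def by (intro tendsto_add tendsto_spike)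

lemma tendsto_slam: "(\<lambda>m. slam n m k x) \<longlonglongrightarrow> lam n k x"
  unfolding slam_def lam_def by (intro tendsto_prod tendsto_shat)

text \<open>Singles out almost all points: every kink of a hat function and every boundary of a
  patch lies on an excluded hyperplane.\<close>

definition off_grid :: "nat \<Rightarrow> (real^'d::finite) \<Rightarrow> bool" where
  "off_grid n x \<longleftrightarrow> (\<forall>i. real n * x $ i \<notin> \<int>)"

lemma AE_off_grid:
  assumes n: "n \<ge> 1"
  shows "AE x in cubeM. off_grid n (x :: real^'d::finite)"
proof -
  have "AE x in lborel. \<forall>i. \<forall>z :: int. (x :: real^'d) $ i \<noteq> of_int z / real n"
    unfolding AE_all_countable by (intro allI AE_lborel_nth_neq)
  then have "AE x in lborel. off_grid n (x :: real^'d)"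
  proof eventually_elim
    case (elim x)
    then show ?case using n by (auto simp: off_grid_def field_simps elim!: Ints_cases)
  qed
  then show ?thesis unfolding AE_cubeM_iff by eventually_elim simp
qed

lemma convergent_pd_slam:
  assumes n: "n \<ge> 1" and x: "off_grid n x"
  shows "convergent (\<lambda>m. pd i (slam n m k) x)"
proof -
  have n0: "real n > 0" using n by simp
  have sp: "convergent (\<lambda>m. spike' n (smoothing m) (x $ i - real (k i) / real n - of_int z))" for z :: int
  proof -
    let ?t = "x $ i - real (k i) / real n - of_int z"
    \<comment> \<open>\<open>real n * ?t\<close> and \<open>real n * x $ i\<close> differ by an
      integer, so neither is one; this excludes the three kinks of the ramp.\<close>
    have "real n * ?t = real n * x $ i - real (k i) - real n * of_int z" using n0 by (simp add: field_simps)
    then have t: "real n * ?t + of_int q \<notin> \<int>" for q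
    proof -
      assume e: "real n * ?t = real n * x $ i - real (k i) - real n * of_int z"
      have "real n * x $ i = (real n * ?t + of_int q) + of_int (int (k i) + int n * z - q)"
        unfolding e by simp
      then show ?thesis using x unfolding off_grid_def by (metis Ints_add Ints_of_int)
    qed
    have "?t \<noteq> 0" using t[of 0] by auto
    moreover have "\<bar>?t\<bar> * real n \<noteq> 1"
    proof
      assume "\<bar>?t\<bar> * real n = 1"
      then have "\<bar>real n * ?t\<bar> = 1" by (simp add: abs_mult mult.commute)
      then have "real n * ?t = 1 \<or> real n * ?t = -1" by linarith
      then show False using t[of 0] by (metis Ints_1 Ints_minus add.right_neutral of_int_0)
    qed
    ultimately show ?thesis by (rule convergent_spike')
  qed
  have "convergent (\<lambda>m. shat n (smoothing m) 1 (x $ i - real (k i) / real n))"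
    unfolding shat_1[OF smoothing(1)] per_def
    using sp[of "\<lfloor>x $ i - real (k i) / real n\<rfloor>"] sp[of "\<lfloor>x $ i - real (k i) / real n\<rfloor> + 1"]
    by (intro convergent_add) (simp_all add: algebra_simps)
  moreover have "convergent (\<lambda>m. \<Prod>j\<in>UNIV - {i}. shat n (smoothing m) 0 (x $ j - real (k j) / real n))"
    by (rule convergentI[OF tendsto_prod[OF tendsto_shat]])
  ultimately show ?thesis unfolding pd_slam[OF n] by (rule convergent_mult)
qed

text \<open>Where the smoothed function is nonzero, each hat factor is at least \<open>e\<close>.
  The resulting bound \<open>lam n k x \<ge> e ^ CARD('d)\<close> is a closed condition and survives
  the closure, while it forces membership in the open set where \<open>lam\<close> is
  nonzero.\<close>

lemma slam_support:
  assumes n: "n \<ge> 1"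
  shows "closure {x. slam n m k x \<noteq> 0} \<subseteq> interior (Dz n (k :: 'd::finite \<Rightarrow> nat))"
proof -
  \<comment> \<open>The margin of \<open>spike_support\<close>, read as a height: wherever the spike
    is nonzero, the ramp exceeds it.\<close>
  define e where "e = real n * smoothing m"
  have e: "e > 0" using n smoothing(1)[of m] by (simp add: e_def)
  have ramp: "e \<le> ramp n t" if "spike n (smoothing m) t \<noteq> 0" for t
    using that spike_support[OF n smoothing(1), of m t] by (force simp: e_def ramp_def)
  have ramp0: "0 \<le> ramp n t" for t by (simp add: ramp_def)
  have hat: "e \<le> hat n t" if t: "shat n (smoothing m) 0 t \<noteq> 0" for t
  proof -
    have "spike n (smoothing m) (t - of_int \<lfloor>t\<rfloor>) \<noteq> 0 \<or> spike n (smoothing m) (t - of_int \<lfloor>t\<rfloor> - 1) \<noteq> 0"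
      using t by (auto simp: shat_0 per_def)
    then show ?thesis
      using ramp ramp0[of "t - of_int \<lfloor>t\<rfloor>"] ramp0[of "t - of_int \<lfloor>t\<rfloor> - 1"] unfolding hat_eq_per per_def by fastforce
  qed
  have "{x. slam n m k x \<noteq> 0} \<subseteq> {x. e ^ CARD('d) \<le> lam n k x}"
  proof safe
    fix x assume "slam n m k x \<noteq> 0"
    then have "e \<le> hat n (x $ i - real (k i) / real n)" for i
      unfolding slam_def by (intro hat) auto
    then have "(\<Prod>i\<in>(UNIV :: 'd set). e) \<le> lam n k x"
      unfolding lam_def using e by (intro prod_mono) auto
    then show "e ^ CARD('d) \<le> lam n k x" by simp
  qed
  then have "closure {x. slam n m k x \<noteq> 0} \<subseteq> {x. e ^ CARD('d) \<le> lam n k x}"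
    by (rule closure_minimal) (intro closed_Collect_le continuous_on_const continuous_lam n)
  also have "\<dots> \<subseteq> {x. lam n k x \<noteq> 0}" using zero_less_power[OF e, of "CARD('d)"] by force
  also have "\<dots> \<subseteq> interior (Dz n k)"
    unfolding Dz_def by (intro interior_maximal closure_subset open_Collect_neq continuous_lam n continuous_on_const)
  finally show ?thesis .
qed

subsection \<open>The local spaces\<close>

definition local_tests :: "nat \<Rightarrow> ('d::finite \<Rightarrow> nat) \<Rightarrow> (real^'d \<Rightarrow> real) set" where
  "local_tests n k = {\<phi>. test_fun \<phi> \<and> closure {x. \<phi> x \<noteq> 0} \<subseteq> interior (Dz n k)}"

lemma Vz_eq_H1_closure: "Vz n k = H1_closure (local_tests n k)"
  by (simp add: Vz_def H1_closure_def local_tests_def)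

lemma local_tests_subset: "local_tests n k \<subseteq> Collect test_fun"
  by (auto simp: local_tests_def)

lemma local_tests_lincomb:
  assumes "\<phi> \<in> local_tests n k" "\<psi> \<in> local_tests n k"
  shows "(\<lambda>x. a * \<phi> x + b * \<psi> x) \<in> local_tests n k"
proof -
  have "closure {x. a * \<phi> x + b * \<psi> x \<noteq> 0} \<subseteq> closure ({x. \<phi> x \<noteq> 0} \<union> {x. \<psi> x \<noteq> 0})"
    by (rule closure_mono) auto
  then show ?thesis
    using assms unfolding local_tests_def closure_Un by (auto intro: test_fun_lincomb)
qed

lemma zero_local_tests: "(\<lambda>x. 0) \<in> local_tests n k"
  by (simp add: local_tests_def test_fun_const)

lemma lam_mult_Vz:
  assumes n: "n \<ge> 1" and u: "H1per u"
  shows "(\<lambda>x. lam n k x * u x) \<in> Vz n k"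
  unfolding Vz_eq_H1_closure
proof (rule multiplier_H1_closure[where \<eta> = "\<lambda>m. slam n m k", OF _ _ _ _ _ _ local_tests_subset _ u])
  show "test_fun (slam n m k)" for m by (rule test_fun_slam[OF n])
  show "lam n k \<in> borel_measurable cubeM" by (rule continuous_measurable_cubeM[OF continuous_lam[OF n]])
  show "AE x in cubeM. \<bar>slam n m k x\<bar> \<le> 2 * real n * 2 ^ CARD('a)" for m by (intro AE_I2 slam_bounds n)
  show "AE x in cubeM. \<bar>pd i (slam n m k) x\<bar> \<le> 2 * real n * 2 ^ CARD('a)" for m i by (intro AE_I2 slam_bounds n)
  show "AE x in cubeM. (\<lambda>m. slam n m k x) \<longlonglongrightarrow> lam n k x" by (intro AE_I2 tendsto_slam)
  show "AE x in cubeM. convergent (\<lambda>m. pd i (slam n m k) x)" for i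
    using AE_off_grid[OF n] by eventually_elim (rule convergent_pd_slam[OF n])
  fix m and \<phi> :: "real^'a \<Rightarrow> real" assume \<phi>: "test_fun \<phi>"
  have "closure {x. slam n m k x * \<phi> x \<noteq> 0} \<subseteq> closure {x. slam n m k x \<noteq> 0}" by (rule closure_mono) auto
  then show "(\<lambda>x. slam n m k x * \<phi> x) \<in> local_tests n k"
    using slam_support[OF n, of m k] test_fun_mult[OF test_fun_slam[OF n] \<phi>] by (auto simp: local_tests_def)
qed

subsection \<open>Partition of unity and finite overlap\<close>

text \<open>Together with \<open>grid_high\<close>, the vertex indices on either side of
  \<open>y\<close> in one coordinate, wrapped around the torus. The two coincide for
  \<open>n = 1\<close>.\<close>

definition grid_low :: "nat \<Rightarrow> real \<Rightarrow> nat" where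
  "grid_low n y = nat (\<lfloor>real n * y\<rfloor> mod int n)"

definition grid_high :: "nat \<Rightarrow> real \<Rightarrow> nat" where
  "grid_high n y = nat ((\<lfloor>real n * y\<rfloor> + 1) mod int n)"

lemma grid_less: "n \<ge> 1 \<Longrightarrow> grid_low n y < n" "n \<ge> 1 \<Longrightarrow> grid_high n y < n"
  by (auto simp: grid_low_def grid_high_def nat_less_iff)

lemma eq_nat_mod_iff:
  fixes z :: int
  assumes "q < n"
  shows "q = nat (z mod int n) \<longleftrightarrow> int n dvd z - int q"
proof -
  have "q = nat (z mod int n) \<longleftrightarrow> z mod int n = int q mod int n"
    using assms by (auto simp: nat_eq_iff)
  then show ?thesis by (simp add: mod_eq_dvd_iff)
qed

text \<open>Only the residue \<open>r\<close> of the index difference modulo the period matters: the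
  first half of \<open>hat\<close> can be nonzero only for \<open>r = 0\<close>, the second only for
  \<open>r = n - 1\<close>. The conditionals are added rather than nested since both hold when
  \<open>n = 1\<close>.\<close>

lemma hat_shift:
  assumes n: "n \<ge> 1" and q: "q < n"
  shows "hat n (y - real q / real n) = (if q = grid_low n y then 1 - frac (real n * y) else 0)
    + (if q = grid_high n y then frac (real n * y) else 0)"
proof -
  define f where "f = frac (real n * y)"
  define z where "z = \<lfloor>real n * y\<rfloor> - int q"
  define r where "r = z mod int n"
  define t where "t = y - real q / real n"
  have n0: "real n > 0" using n by simp
  have f: "0 \<le> f" "f < 1" by (auto simp: f_def frac_lt_1)
  have r: "0 \<le> r" "r < int n" using n by (auto simp: r_def)
  have "z = int n * (z div int n) + r" by (simp add: r_def)
  then have zr: "real_of_int z = real n * of_int (z div int n) + of_int r" by (metis of_int_add of_int_mult of_int_of_nat_eq)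
  have nt: "real n * t = of_int z + f"
    using n0 by (simp add: t_def z_def f_def frac_def right_diff_distrib)
  then have t: "t = of_int (z div int n) + (of_int r + f) / real n"
    using n0 zr by (simp add: field_simps)
  have b: "0 \<le> (of_int r + f) / real n" "(of_int r + f) / real n < 1"
  proof -
    show "0 \<le> (of_int r + f) / real n" using r f n0 by simp
    have "real_of_int r + 1 \<le> real n" using r(2) by linarith
    then show "(of_int r + f) / real n < 1" using f n0 by simp
  qed
  have fl: "\<lfloor>t\<rfloor> = z div int n" using t b by (intro floor_unique) auto
  have u: "t - of_int \<lfloor>t\<rfloor> = (of_int r + f) / real n" unfolding fl using t by simp
  have e1: "\<bar>t - of_int \<lfloor>t\<rfloor>\<bar> * real n = of_int r + f"
    unfolding u abs_of_nonneg[OF b(1)] using n0 by simp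
  have e2: "\<bar>t - of_int \<lfloor>t\<rfloor> - 1\<bar> * real n = real n - (of_int r + f)"
    unfolding u using b n0 by (simp add: abs_if field_simps)
  have h1: "max 0 (1 - (of_int r + f)) = (if r = 0 then 1 - f else 0)"
  proof (cases "r = 0")
    case False
    then have "real_of_int r \<ge> 1" using r by linarith
    then show ?thesis using f False by simp
  qed (use f in simp)
  have h2: "max 0 (1 - (real n - (of_int r + f))) = (if r = int n - 1 then f else 0)"
  proof (cases "r = int n - 1")
    case False
    then have "real_of_int r \<le> real n - 2" using r by linarith
    then show ?thesis using f False by simp
  qed (use f in simp)
  have c1: "r = 0 \<longleftrightarrow> q = grid_low n y"
    unfolding r_def grid_low_def eq_nat_mod_iff[OF q] by (simp add: z_def dvd_eq_mod_eq_0)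
  have c2: "r = int n - 1 \<longleftrightarrow> q = grid_high n y"
  proof -
    have "int n dvd z + 1 \<longleftrightarrow> int n dvd r + 1"
      unfolding r_def by (metis dvd_eq_mod_eq_0 mod_add_left_eq)
    also have "\<dots> \<longleftrightarrow> r = int n - 1"
      using r zdvd_imp_le[of "int n" "r + 1"] by auto
    finally show ?thesis unfolding grid_high_def eq_nat_mod_iff[OF q] by (simp add: z_def algebra_simps)
  qed
  show ?thesis
    unfolding t_def[symmetric] hat_def e1 e2 h1 h2 f_def[symmetric] using c1 c2 by simp
qed

lemma sum_hat:
  assumes n: "n \<ge> 1"
  shows "(\<Sum>q<n. hat n (y - real q / real n)) = 1"
proof -
  have "(\<Sum>q<n. hat n (y - real q / real n)) = (\<Sum>q<n. (if q = grid_low n y then 1 - frac (real n * y) else 0)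
    + (if q = grid_high n y then frac (real n * y) else 0))"
    by (intro sum.cong refl hat_shift n) simp
  also have "\<dots> = 1" using grid_less[OF n] by (simp add: sum.distrib)
  finally show ?thesis .
qed

lemma Idx_eq_PiE: "Idx n = PiE UNIV (\<lambda>_. {..<n})"
  by (auto simp: Idx_def)

lemma finite_Idx: "finite (Idx n :: ('d::finite \<Rightarrow> nat) set)"
  unfolding Idx_eq_PiE by (intro finite_PiE) auto

text \<open>The tensor structure turns the sum over all vertices into a product of one-dimensional
  sums, each equal to 1.\<close>

lemma sum_lam:
  assumes "n \<ge> 1"
  shows "(\<Sum>k\<in>Idx n. lam n k x) = 1"
  unfolding lam_def Idx_eq_PiE
  by (subst prod_sum_PiE[symmetric, where f = "\<lambda>i q. hat n (x $ i - real q / real n)"]) (auto simp: sum_hat[OF assms])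

text \<open>The patch is a closure, so it is excluded by an open set: between two consecutive grid
  hyperplanes the floor is constant, and for any other index the hat factor vanishes on the whole
  slab around \<open>x\<close>.\<close>

lemma Dz_off_grid:
  assumes n: "n \<ge> 1" and k: "k \<in> Idx n" and x: "off_grid n x" "x \<in> Dz n k"
  shows "k i \<in> {grid_low n (x $ i), grid_high n (x $ i)}"
proof (rule ccontr)
  assume ki: "k i \<notin> {grid_low n (x $ i), grid_high n (x $ i)}"
  define m where "m = \<lfloor>real n * x $ i\<rfloor>"
  let ?U = "{y :: real^'a. of_int m < real n * y $ i} \<inter> {y. real n * y $ i < of_int m + 1}"
  have U: "open ?U" by (intro open_Int open_Collect_less continuous_intros)
  have ne: "of_int m \<noteq> real n * x $ i" using x(1) unfolding off_grid_def by (metis Ints_of_int)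
  have "of_int m < real n * x $ i"
    using order_neq_le_trans[OF ne] unfolding m_def by simp
  moreover have "real n * x $ i < of_int m + 1" unfolding m_def by linarith
  ultimately have "x \<in> ?U" by simp
  moreover have "?U \<inter> {y. lam n k y \<noteq> 0} = {}"
  proof safe
    fix y assume y: "of_int m < real n * y $ i" "real n * y $ i < of_int m + 1" "lam n k y \<noteq> 0"
    have "\<lfloor>real n * y $ i\<rfloor> = m" using y by (intro floor_unique) auto
    then have "grid_low n (y $ i) = grid_low n (x $ i)" "grid_high n (y $ i) = grid_high n (x $ i)"
      by (auto simp: grid_low_def grid_high_def m_def)
    then have "hat n (y $ i - real (k i) / real n) = 0"
      using ki k hat_shift[OF n, of "k i" "y $ i"] by (simp add: Idx_def)
    then have "lam n k y = 0" unfolding lam_def by (intro prod_zero) auto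
    then show "y \<in> {}" using y by simp
  qed
  ultimately have "x \<notin> closure {y. lam n k y \<noteq> 0}"
    using open_Int_closure_eq_empty[OF U] by blast
  then show False using x(2) by (simp add: Dz_def)
qed

text \<open>At most two admissible indices per coordinate: this is the origin of
  \<open>K2\<close>.\<close>

lemma card_overlap:
  assumes n: "n \<ge> 1" and x: "off_grid n x"
  shows "card {k \<in> Idx n. x \<in> Dz n (k :: 'd::finite \<Rightarrow> nat)} \<le> 2 ^ CARD('d)"
proof -
  let ?S = "PiE UNIV (\<lambda>i. {grid_low n (x $ i), grid_high n (x $ i)})"
  have "{k \<in> Idx n. x \<in> Dz n k} \<subseteq> ?S"
    using Dz_off_grid[OF n _ x] by (auto simp: PiE_UNIV_domain)
  then have "card {k \<in> Idx n. x \<in> Dz n k} \<le> card ?S" by (intro card_mono finite_PiE) auto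
  also have "\<dots> = (\<Prod>i\<in>UNIV. card {grid_low n (x $ i), grid_high n (x $ i)})" by (simp add: card_PiE)
  also have "\<dots> \<le> (\<Prod>i\<in>(UNIV :: 'd set). 2)" by (intro prod_mono) (auto simp: card_insert_if)
  finally show ?thesis by simp
qed

lemma L2_limit_eq_0:
  assumes f: "sqint M f" and p: "\<And>m. sqint M (p m)" and A: "A \<in> sets M"
    and z: "\<And>m x. x \<in> A \<Longrightarrow> p m x = 0" and lim: "(\<lambda>m. \<integral>x. (p m x - f x)\<^sup>2 \<partial>M) \<longlonglongrightarrow> 0"
  shows "AE x in M. x \<in> A \<longrightarrow> f x = 0"
proof -
  note [measurable] = A
  have h: "(indicator A :: _ \<Rightarrow> real) \<in> borel_measurable M" "AE x in M. \<bar>indicator A x :: real\<bar> \<le> 1"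
    by (auto simp: indicator_def)
  have "sqint M (\<lambda>x. indicator A x * f x)" by (rule sqint_bounded_mult[OF f h])
  then have int: "integrable M (\<lambda>x. (indicator A x * f x)\<^sup>2)" by (simp add: sqint_def)
  have "(\<integral>x. (indicator A x * f x)\<^sup>2 \<partial>M) \<le> (\<integral>x. (p m x - f x)\<^sup>2 \<partial>M)" for m
  proof -
    have "(\<integral>x. (indicator A x * f x)\<^sup>2 \<partial>M) = (\<integral>x. (indicator A x * (p m x - f x))\<^sup>2 \<partial>M)"
      using z by (intro Bochner_Integration.integral_cong) (auto simp: indicator_def)
    also have "\<dots> \<le> 1\<^sup>2 * (\<integral>x. (p m x - f x)\<^sup>2 \<partial>M)" by (rule L2_bounded_mult_le[OF sqint_diff[OF p f] h])
    finally show ?thesis by simp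
  qed
  then have "(\<integral>x. (indicator A x * f x)\<^sup>2 \<partial>M) \<le> 0" by (intro LIMSEQ_le_const[OF lim]) auto
  moreover have "(\<integral>x. (indicator A x * f x)\<^sup>2 \<partial>M) \<ge> 0" by (intro Bochner_Integration.integral_nonneg) auto
  ultimately have "(\<integral>x. (indicator A x * f x)\<^sup>2 \<partial>M) = 0" by simp
  then have "AE x in M. (indicator A x * f x)\<^sup>2 = 0"
    using integral_nonneg_eq_0_iff_AE[OF int] by auto
  then show ?thesis by eventually_elim (auto simp: indicator_def)
qed

text \<open>\<open>Vz\<close> is defined by approximation, so vanishing off the patch has to be
  recovered: the approximating functions and their derivatives vanish there, and L2 limits inherit
  this almost everywhere.\<close>

lemma Vz_vanishes_outside:
  assumes w: "w \<in> Vz n k"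
  shows "AE x in cubeM. x \<notin> Dz n k \<longrightarrow> w x = 0 \<and> wgrad w x = 0"
proof -
  obtain \<phi> where \<phi>: "\<And>m. test_fun (\<phi> m)" "\<And>m. closure {x. \<phi> m x \<noteq> 0} \<subseteq> interior (Dz n k)"
    and lim: "(\<lambda>m. h1sq (\<lambda>x. \<phi> m x - w x)) \<longlonglongrightarrow> 0" and H: "H1per w"
    using w unfolding Vz_def by auto
  have z: "\<phi> m x = 0 \<and> pd i (\<phi> m) x = 0" if "x \<notin> Dz n k" for m i x
  proof -
    let ?S = "- closure {x. \<phi> m x \<noteq> 0}"
    have x: "x \<in> ?S" using \<phi>(2)[of m] that interior_subset by blast
    have oS: "open ?S" by (simp add: open_Compl)
    have S: "\<phi> m y = 0" if "y \<in> ?S" for y using that closure_subset[of "{x. \<phi> m x \<noteq> 0}"] by auto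
    have "((\<lambda>x. 0) has_derivative (\<lambda>v. 0)) (at x)" by (rule has_derivative_const)
    then have "(\<phi> m has_derivative (\<lambda>v. 0)) (at x)"
      by (rule has_derivative_transform_within_open[OF _ oS x]) (rule S[symmetric])
    from pd_eqI[OF this] show ?thesis using S[OF x] by simp
  qed
  define A where "A = unitD - Dz n k"
  have A: "A \<in> sets cubeM"
    unfolding A_def cubeM_def sets_restrict_space Dz_def by (auto intro!: image_eqI[where x = "- closure {x. lam n k x \<noteq> 0}"])
  have lim1: "(\<lambda>m. \<integral>x. (\<phi> m x - w x)\<^sup>2 \<partial>cubeM) \<longlonglongrightarrow> 0"
    by (rule tendsto_sandwich[OF _ _ tendsto_const lim])
      (auto intro!: always_eventually Bochner_Integration.integral_nonneg h1sq_test_diff_ge \<phi> H)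
  have lim2: "(\<lambda>m. \<integral>x. (pd i (\<phi> m) x - wgrad w x $ i)\<^sup>2 \<partial>cubeM) \<longlonglongrightarrow> 0" for i
    by (rule tendsto_sandwich[OF _ _ tendsto_const lim])
      (auto intro!: always_eventually Bochner_Integration.integral_nonneg h1sq_test_diff_ge \<phi> H)
  have "AE x in cubeM. x \<in> A \<longrightarrow> w x = 0"
    by (rule L2_limit_eq_0[OF H1per_sqint[OF H] sqint_test_fun[OF \<phi>(1)] A _ lim1]) (use z in \<open>auto simp: A_def\<close>)
  moreover have "AE x in cubeM. x \<in> A \<longrightarrow> wgrad w x $ i = 0" for i
    by (rule L2_limit_eq_0[OF H1per_wgrad_sqint[OF H] sqint_test_fun[OF test_fun_pd[OF \<phi>(1)]] A _ lim2])
      (use z in \<open>auto simp: A_def\<close>)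
  then have "AE x in cubeM. \<forall>i. x \<in> A \<longrightarrow> wgrad w x $ i = 0" unfolding AE_all_countable by blast
  ultimately show ?thesis
    using AE_space
  proof eventually_elim
    case (elim x)
    then show ?case by (auto simp: A_def vec_eq_iff)
  qed
qed

text \<open>Cauchy-Schwarz over the indices in \<open>Z\<close> only, so the constant counts
  overlaps and not all summands.\<close>

lemma square_sum_le_overlap:
  fixes f :: "'a \<Rightarrow> real"
  assumes "finite I" "Z \<subseteq> I" "card Z \<le> N" "\<And>k. k \<in> I - Z \<Longrightarrow> f k = 0"
  shows "(\<Sum>k\<in>I. f k)\<^sup>2 \<le> real N * (\<Sum>k\<in>I. (f k)\<^sup>2)"
proof -
  have "(\<Sum>k\<in>I. f k) = (\<Sum>k\<in>Z. f k)" using assms by (intro sum.mono_neutral_right) auto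
  then have "(\<Sum>k\<in>I. f k)\<^sup>2 \<le> (\<Sum>k\<in>Z. (f k)\<^sup>2) * card Z"
    using sum_squared_le_sum_of_squares[of f Z] by simp
  also have "\<dots> \<le> (\<Sum>k\<in>I. (f k)\<^sup>2) * N"
    using assms by (intro mult_mono sum_mono2 sum_nonneg) auto
  finally show ?thesis by (simp add: mult.commute)
qed

text \<open>The overlap count acts pointwise almost everywhere, on each gradient component and on
  the value; nonnegativity of \<open>V\<close> lets the latter be weighted before
  integrating.\<close>

lemma aform_sum_overlap:
  fixes w :: "('d::finite \<Rightarrow> nat) \<Rightarrow> real^'d \<Rightarrow> real"
  assumes n: "n \<ge> 1" and V: "bounded_coeff C V" and w: "\<And>k. k \<in> Idx n \<Longrightarrow> w k \<in> Vz n k"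
  shows "aform V (\<lambda>x. \<Sum>k\<in>Idx n. w k x) (\<lambda>x. \<Sum>k\<in>Idx n. w k x)
    \<le> 2 ^ CARD('d) * (\<Sum>k\<in>Idx n. aform V (w k) (w k))"
proof -
  define W where "W = (\<lambda>x. \<Sum>k\<in>Idx n. w k x)"
  have wH: "H1per (w k)" if "k \<in> Idx n" for k
    using w[OF that] by (auto simp: Vz_def)
  have ne: "Idx n \<noteq> ({} :: ('d \<Rightarrow> nat) set)" using n by (auto simp: Idx_def intro!: exI[of _ "\<lambda>_. 0"])
  have WH: "H1per W" and Wg: "AE x in cubeM. wgrad W x = (\<Sum>k\<in>Idx n. wgrad (w k) x)"
    using wgrad_sum[OF finite_Idx ne wH] by (auto simp: W_def)
  have "AE x in cubeM. \<forall>k\<in>Idx n. x \<notin> Dz n k \<longrightarrow> w k x = 0 \<and> wgrad (w k) x = 0"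
    using w by (intro AE_finite_allI finite_Idx Vz_vanishes_outside)
  then have le: "AE x in cubeM. wgrad W x \<bullet> wgrad W x + V x * W x * W x
      \<le> 2 ^ CARD('d) * (\<Sum>k\<in>Idx n. wgrad (w k) x \<bullet> wgrad (w k) x + V x * w k x * w k x)"
    using Wg AE_off_grid[OF n] V[unfolded bounded_coeff_def, THEN conjunct2]
  proof eventually_elim
    case (elim x)
    let ?Z = "{k \<in> Idx n. x \<in> Dz n k}"
    have Z: "?Z \<subseteq> Idx n" by blast
    have sq: "(\<Sum>k\<in>Idx n. f k)\<^sup>2 \<le> 2 ^ CARD('d) * (\<Sum>k\<in>Idx n. (f k)\<^sup>2)"
      if "\<And>k. k \<in> Idx n - ?Z \<Longrightarrow> f k = 0" for f :: "_ \<Rightarrow> real"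
      using square_sum_le_overlap[OF finite_Idx Z card_overlap[OF n elim(3)], of f] that by simp
    have "wgrad W x \<bullet> wgrad W x = (\<Sum>i\<in>UNIV. (\<Sum>k\<in>Idx n. wgrad (w k) x $ i)\<^sup>2)"
      unfolding elim(2) inner_vec_def by (simp add: power2_eq_square)
    also have "\<dots> \<le> (\<Sum>i\<in>UNIV. 2 ^ CARD('d) * (\<Sum>k\<in>Idx n. (wgrad (w k) x $ i)\<^sup>2))"
      by (intro sum_mono sq) (use elim(1) in auto)
    also have "\<dots> = 2 ^ CARD('d) * (\<Sum>k\<in>Idx n. wgrad (w k) x \<bullet> wgrad (w k) x)"
      unfolding inner_vec_def sum_distrib_left[symmetric] by (subst sum.swap) (simp add: power2_eq_square)
    finally have 1: "wgrad W x \<bullet> wgrad W x \<le> 2 ^ CARD('d) * (\<Sum>k\<in>Idx n. wgrad (w k) x \<bullet> wgrad (w k) x)" .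
    have "(W x)\<^sup>2 \<le> 2 ^ CARD('d) * (\<Sum>k\<in>Idx n. (w k x)\<^sup>2)"
      unfolding W_def by (intro sq) (use elim(1) in auto)
    then have "V x * (W x)\<^sup>2 \<le> V x * (2 ^ CARD('d) * (\<Sum>k\<in>Idx n. (w k x)\<^sup>2))"
      using elim(4) by (intro mult_left_mono) auto
    also have "\<dots> = 2 ^ CARD('d) * (\<Sum>k\<in>Idx n. V x * w k x * w k x)"
      by (simp add: sum_distrib_left power2_eq_square algebra_simps)
    finally have 2: "V x * W x * W x \<le> 2 ^ CARD('d) * (\<Sum>k\<in>Idx n. V x * w k x * w k x)"
      by (simp add: power2_eq_square mult.assoc)
    show ?case using 1 2 by (simp add: sum.distrib distrib_left)
  qed
  have "aform V W W \<le> (\<integral>x. 2 ^ CARD('d) * (\<Sum>k\<in>Idx n. wgrad (w k) x \<bullet> wgrad (w k) x + V x * w k x * w k x) \<partial>cubeM)"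
    unfolding aform_cubeM
    by (rule integral_mono_AE[OF aform_integrable[OF V WH WH] _ le])
      (intro integrable_mult_right Bochner_Integration.integrable_sum aform_integrable[OF V] wH)
  also have "\<dots> = 2 ^ CARD('d) * (\<Sum>k\<in>Idx n. aform V (w k) (w k))"
    unfolding aform_cubeM using aform_integrable[OF V] wH
    by (simp add: Bochner_Integration.integral_sum)
  finally show ?thesis by (simp add: W_def)
qed

subsection \<open>The additive Schwarz operator\<close>

lemma elem_eq_cbox: "elem n k = cbox (\<chi> i. real (k i) / real n) (\<chi> i. real (k i + 1) / real n)"
  by (auto simp: elem_def mem_box_cart)

lemma interior_elem: "interior (elem n k) = box (\<chi> i. real (k i) / real n) (\<chi> i. real (k i + 1) / real n)"
  unfolding elem_eq_cbox by (rule interior_cbox)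

lemma interior_elem_unitD:
  assumes n: "n \<ge> 1" and k: "k \<in> Idx n"
  shows "interior (elem n k) \<subseteq> unitD"
proof
  fix x assume "x \<in> interior (elem n k)"
  then have x: "real (k i) / real n < x $ i" "x $ i < real (k i + 1) / real n" for i
    unfolding interior_elem mem_box_cart by auto
  have "0 < x $ i \<and> x $ i < 1" for i
  proof -
    have "k i < n" using k by (simp add: Idx_def)
    then have "real (k i + 1) \<le> real n" by linarith
    then have "real (k i + 1) / real n \<le> 1" using n by simp
    moreover have "0 \<le> real (k i) / real n" by simp
    ultimately show ?thesis using x[of i] by linarith
  qed
  then show "x \<in> unitD" by (simp add: unitD_def)
qed

lemma measure_interior_elem_pos:
  assumes n: "n \<ge> 1"
  shows "measure lborel (interior (elem n k)) > 0"
proof -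
  have "real (k i) / real n < real (k i + 1) / real n" for i using n by (simp add: divide_strict_right_mono)
  then show ?thesis
    unfolding interior_elem measure_lborel_box_eq by (auto simp: Basis_vec_def inner_axis intro!: prod_pos less_imp_le)
qed

lemma off_grid_in_interior:
  assumes n: "n \<ge> 1" and x: "off_grid n x" "x \<in> unitD"
  shows "\<exists>k\<in>Idx n. x \<in> interior (elem n k)"
proof -
  define k where "k i = nat \<lfloor>real n * x $ i\<rfloor>" for i
  have n0: "real n > 0" using n by simp
  have "real (k i) < real n * x $ i \<and> real n * x $ i < real (k i + 1) \<and> k i < n" for i
  proof -
    have x01: "0 < x $ i" "x $ i < 1" using x(2) by (auto simp: unitD_def)
    then have p: "0 < real n * x $ i" "real n * x $ i < real n" using n0 by auto
    have ne: "of_int \<lfloor>real n * x $ i\<rfloor> \<noteq> real n * x $ i" using x(1) unfolding off_grid_def by (metis Ints_of_int)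
    have fl: "of_int \<lfloor>real n * x $ i\<rfloor> < real n * x $ i"
      by (rule order_neq_le_trans[OF ne of_int_floor_le])
    have fl': "real n * x $ i < of_int \<lfloor>real n * x $ i\<rfloor> + 1" by linarith
    have k: "real (k i) = of_int \<lfloor>real n * x $ i\<rfloor>" unfolding k_def using p(1) by simp
    have "real (k i) < real n" using fl p(2) k by linarith
    then have "k i < n" by simp
    moreover have "real (k i) < real n * x $ i" "real n * x $ i < real (k i + 1)" using fl fl' k by linarith+
    ultimately show ?thesis by blast
  qed
  then have k: "real (k i) < real n * x $ i" "real n * x $ i < real (k i + 1)" "k i < n" for i by auto
  have "x \<in> interior (elem n k)"
    unfolding interior_elem mem_box_cart using k(1,2) n0 by (auto simp: pos_divide_less_eq pos_less_divide_eq mult.commute)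
  then show ?thesis using k(3) by (auto simp: Idx_def)
qed

text \<open>\<open>Pz\<close> is a choice, and the existence of a projection onto the closed space
  \<open>Vz\<close> is what gives the chosen function its defining property.\<close>

lemma Pz_projection:
  assumes V: "bounded_coeff C V" and coercive: "\<And>u. H1per u \<Longrightarrow> h1sq u \<le> K * aform V u u" and u: "H1per u"
  shows "Pz V n k u \<in> Vz n k" "v \<in> Vz n k \<Longrightarrow> aform V (Pz V n k u) v = aform V u v"
proof -
  have ex: "\<exists>p\<in>Vz n k. \<forall>v\<in>Vz n k. aform V p v = aform V u v"
    unfolding Vz_eq_H1_closure
  proof (rule H1_closure_projection[OF V coercive _ _ local_tests_lincomb u])
    show "H1per \<phi>" if "\<phi> \<in> local_tests n k" for \<phi> using that local_tests_subset by (auto intro: H1per_test_fun)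
    show "local_tests n k \<noteq> {}" using zero_local_tests by blast
  qed
  have "Pz V n k u \<in> Vz n k \<and> (\<forall>v\<in>Vz n k. aform V (Pz V n k u) v = aform V u v)"
    unfolding Pz_def by (rule someI_ex[OF ex[unfolded Bex_def]])
  then show "Pz V n k u \<in> Vz n k" "v \<in> Vz n k \<Longrightarrow> aform V (Pz V n k u) v = aform V u v" by auto
qed

theorem mainTheorem7:
  fixes n :: nat and \<alpha> \<beta> c0 c :: real
    and V :: "real^'d::finite \<Rightarrow> real" and Ta :: "('d \<Rightarrow> nat) set"
  assumes n_pos: "n \<ge> 1"
    and ab: "0 \<le> \<alpha>" "\<alpha> \<le> \<beta>"
    and Ta: "Ta \<subseteq> Idx n"
    and V_meas: "V \<in> borel_measurable lborel"
    and V_pc: "\<forall>k\<in>Idx n. \<forall>x\<in>interior (elem n k). V x = (if k \<in> Ta then \<alpha> else \<beta>)"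
    and A1: "Idx n - Ta \<noteq> {}" "c0 > 0" "\<beta> \<ge> c0 * (real n)^2"
    and c_stab: "\<forall>u. H1per u \<longrightarrow>
        (\<Sum>k\<in>Idx n. (enorm V (\<lambda>x. lam n k x * u x))^2) \<le> K1 c n Ta * (enorm V u)^2"
  shows "K2 TYPE('d) / (1 / K1 c n Ta + K2 TYPE('d)) < 1 \<and>
         (\<forall>v. H1per v \<longrightarrow>
            enorm V (\<lambda>x. v x - (1 / (K2 TYPE('d) + 1 / K1 c n Ta)) * Pop V n v x)
            \<le> K2 TYPE('d) / (1 / K1 c n Ta + K2 TYPE('d)) * enorm V v)"
proof -
  have beta: "\<beta> > 0"
  proof -
    have "0 < c0 * (real n)\<^sup>2" using A1(2) n_pos by simp
    then show ?thesis using A1(3) by linarith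
  qed
  have V: "bounded_coeff \<beta> V"
    unfolding bounded_coeff_def
  proof
    show "V \<in> borel_measurable cubeM" using V_meas by (intro measurable_cubeM) simp
    \<comment> \<open>The values of \<open>V\<close> are prescribed in the interiors of elements
      only; these cover every off-grid point of the cube.\<close>
    show "AE x in cubeM. 0 \<le> V x \<and> V x \<le> \<beta>"
      using AE_off_grid[OF n_pos] AE_space
    proof eventually_elim
      case (elim x)
      then obtain k where "k \<in> Idx n" "x \<in> interior (elem n k)" using off_grid_in_interior[OF n_pos] by auto
      then have "V x = (if k \<in> Ta then \<alpha> else \<beta>)" using V_pc by blast
      then show ?case using ab by auto
    qed
  qed
  obtain k0 where k0: "k0 \<in> Idx n" "k0 \<notin> Ta" using A1(1) by blast
  have "\<exists>K. \<forall>u. H1per u \<longrightarrow> h1sq u \<le> K * aform V u u"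
  proof (rule aform_coercive[OF V _ interior_elem_unitD[OF n_pos k0(1)] measure_interior_elem_pos[OF n_pos] beta])
    show "AE x in cubeM. x \<in> interior (elem n k0) \<longrightarrow> \<beta> \<le> V x" using V_pc k0 by auto
  qed simp
  then obtain K where coercive: "\<And>u. H1per u \<Longrightarrow> h1sq u \<le> K * aform V u u" by blast
  interpret semi_inner "{u. H1per u}" "aform V" by (rule semi_inner_aform[OF V])
  have enorm_sq: "(enorm V u)\<^sup>2 = aform V u u" if "H1per u" for u
    unfolding enorm_def using B_nonneg that by simp
  have VzH: "Vz n k \<subseteq> {u. H1per u}" for k by (auto simp: Vz_def)
  let ?one = "\<lambda>x :: real^'d. 1 :: real"
  have one: "H1per ?one" by (rule H1per_test_fun[OF test_fun_const])
  \<comment> \<open>The constant function 1 is the witness of positive energy from which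
    \<open>K1 c n Ta > 0\<close> is deduced: its H1 norm is at least 1, so coercivity excludes
    energy zero.\<close>
  have one_pos: "aform V ?one ?one > 0"
  proof -
    have "h1sq ?one \<ge> 1"
      unfolding h1sq_eq[OF H1per_sqint[OF one] H1per_wgrad[OF one]]
      by (simp add: sum_nonneg)
    then have "aform V ?one ?one \<noteq> 0" using coercive[OF one] by auto
    moreover have "aform V ?one ?one \<ge> 0" using B_nonneg one by simp
    ultimately show ?thesis by simp
  qed
  have ne: "Idx n \<noteq> ({} :: ('d \<Rightarrow> nat) set)" using k0 by blast
  note S = additive_Schwarz[where I = "Idx n" and W = "Vz n" and P = "Pz V n" and T = "\<lambda>k u x. lam n k x * u x"
      and ?k1.0 = "K1 c n Ta" and ?k2.0 = "K2 TYPE('d)" and ?u0.0 = ?one, OF finite_Idx ne VzH]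
  have stable: "(\<Sum>k\<in>Idx n. aform V (\<lambda>x. lam n k x * u x) (\<lambda>x. lam n k x * u x)) \<le> K1 c n Ta * aform V u u"
    if u: "H1per u" for u
  proof -
    have "H1per (\<lambda>x. lam n k x * u x)" for k using lam_mult_Vz[OF n_pos u, of k] VzH by blast
    then show ?thesis using c_stab[rule_format, OF u] by (simp add: enorm_sq u)
  qed
  have T_sum: "u = (\<lambda>x. \<Sum>k\<in>Idx n. lam n k x * u x)" for u :: "real^'d \<Rightarrow> real"
    by (simp add: sum_distrib_right[symmetric] sum_lam[OF n_pos])
  have k1: "K1 c n Ta > 0"
    by (rule S(1)) (use Pz_projection[OF V coercive] lam_mult_Vz[OF n_pos] T_sum stable aform_sum_overlap[OF n_pos V] one one_pos
      in \<open>auto simp: K2_def\<close>)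
  have bd: "sqrt (aform V (\<lambda>x. v x - 1 / (K2 TYPE('d) + 1 / K1 c n Ta) * (\<Sum>k\<in>Idx n. Pz V n k v x))
                    (\<lambda>x. v x - 1 / (K2 TYPE('d) + 1 / K1 c n Ta) * (\<Sum>k\<in>Idx n. Pz V n k v x)))
        \<le> K2 TYPE('d) / (1 / K1 c n Ta + K2 TYPE('d)) * sqrt (aform V v v)" if "H1per v" for v
    by (rule S(2)) (use that Pz_projection[OF V coercive] lam_mult_Vz[OF n_pos] T_sum stable aform_sum_overlap[OF n_pos V] one one_pos
      in \<open>auto simp: K2_def\<close>)
  have k2: "K2 TYPE('d) > 0" by (simp add: K2_def)
  have "K2 TYPE('d) / (1 / K1 c n Ta + K2 TYPE('d)) < 1" using k1 k2 by (simp add: divide_less_eq add_pos_pos)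
  then show ?thesis using bd by (simp add: enorm_def Pop_def)
qed

end
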